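(* Let $d\in\mathbb N$ and let $w$ be admissible weights on $\mathbb Z^d$ which are bipartite, i.e. $w(x)=0$ whenever $|x|_1$ is even (in particular $w(0)=0$). Suppose that $$g_{d,w}<\frac43 .$$ Then there exists a constant $c=c(w,d)>0$ such that $$\liminf_{L\to\infty,\ L\in2\mathbb N}M^{\mathrm{mdd}}_{L,w}\ \ge\ c,\qquad \liminf_{L\to\infty,\ L\in2\mathbb N}\frac{\mathbb E^{\mathrm{mdd}}_{L,w}(|\mathcal L_0|)}{L^d}\ \ge\ c,$$ and such that, for all sufficiently large even $L$ and all odd integers $n\in(0,cL)$, $$G^{\mathrm{mdd}}_{L,w}(ne_1)\ge c,\qquad \mathbb P^{\mathrm{mdd}}_{L,w}(ne_1\in\mathcal L_0)\ge c .$$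
   Context: Weights. A weight is a function $w:\mathbb Z^d\times\mathbb Z^d\to[0,\infty)$. For translation-invariant $w$ write $w(x):=w_{0,x}$, $\widehat w(k):=\sum_{x\in\mathbb Z^d}w(x)e^{\mathrm i k\cdot x}$, and $$g_{d,w}:=\sum_{n\ge0}w^{*n}(0)=\int_{(-\pi,\pi]^d}\frac{1}{1-\widehat w(k)}\frac{\mathrm dk}{(2\pi)^d}\in[1,\infty].$$ Let $\mathbb T_L:=(\mathbb Z/L\mathbb Z)^d$ and $\mathbb T_L^*:=\frac{2\pi}{L}\mathbb T_L$, represented in $(-\pi,\pi]^d$. The weight $w$ is called admissible if: (i) $w_{x,y}=w_{y,x}$; (ii) $w_{x,y}=w_{x+z,y+z}$ for all $x,y,z$; (iii) the additive subgroup generated by $\{x:w_{0,x}>0\}$ is $\mathbb Z^d$; (iv) $\sum_yw_{0,y}=1$; (v) (OS-positivity) for every $i\in\{1,\dots,d\}$, with $\theta_ix:=x-2(x\cdot e_i)e_i+e_i$ and $\mathbb Z^d_{i,+}:=\{x:x\cdot e_i>0\}$, one has $\sum_{x,y\in\mathbb Z^d_{i,+}}\overline{f(x)}\,w_{x,\theta_iy}f(y)\ge0$ for every finitely supported $f:\mathbb Z^d_{i,+}\to\mathbb C$; (vi) if $g_{d,w}<\infty$, then $\lim_{L\to\infty,\,L\in2\mathbb N}L^{-d}\sum_{k\in\mathbb T_L^*\setminus\{0\}}\frac1{1-\widehat w(k)}=g_{d,w}$. The periodised weights on $\mathbb T_L$ are $w^{(L)}_{x,y}:=\sum_{z\in\mathbb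 Z^d}w_{x,y+Lz}$. Monomer double-dimer model (MDD). Let $V$ be a finite set with symmetric weights $w_{x,y}\ge0$, $x,y\in V$, and let $E$ be the set of unordered pairs $\{x,y\}$, $x\ne y$, with $w_{x,y}>0$. For $m\in\{0,1\}^E$ put $n_x(m):=\sum_{y:\{x,y\}\in E}m_{x,y}$. Let $\Omega$ be the set of $(m^1,m^2)\in\{0,1\}^E\times\{0,1\}^E$ with $n_x(m^1)=n_x(m^2)\in\{0,1\}$ for all $x\in V$. The MDD measure $\mathbb P^{\mathrm{mdd}}$ on $\Omega$ gives $(m^1,m^2)$ probability proportional, with normalising constant $Z^{\mathrm{mdd}}$, to $\prod_{x\in V}w_{x,x}^{1-n_x(m^1)}\prod_{\{x,y\}\in E}w_{x,y}^{m^1_{x,y}+m^2_{x,y}}$ (with $0^0=1$). The multigraph in which $\{u,v\}\in E$ has multiplicity $m^1_{u,v}+m^2_{u,v}$ is a disjoint union of loops (possibly a doubled edge) and isolated vertices (monomers); $\mathcal L_x$ is the loop containing $x$ ($\mathcal L_x=\{x\}$ if $x$ is a monomer), $y\in\mathcal L_x$ means that $y$ is a vertex of it, and $|\mathcal L_x|$ is the total number of dimers (edges of $m^1$ and $m^2$, with multiplicity) in it, so $|\mathcal L_x|=0$ iff $x$ is a monomer. Two-point function. For $x\neq y$ let $\Omega_{x,y}$ be the set of $(m^1,m^2)\in\{0,1\}^E\times\{0,1\}^E$ with $n_z(m^1)=n_z(m^2)\in\{0,1\}$ for $z\notin\{x,y\}$, $n_x(m^1)=n_y(m^1)=0$, $n_x(m^2)=n_y(m^2)=1$;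 then $$G^{\mathrm{mdd}}(x,y):=\frac1{Z^{\mathrm{mdd}}}\sum_{(m^1,m^2)\in\Omega_{x,y}}\ \prod_{z\in V\setminus\{x,y\}}w_{z,z}^{1-n_z(m^1)}\prod_{\{u,v\}\in E}w_{u,v}^{m^1_{u,v}+m^2_{u,v}},$$ and $G^{\mathrm{mdd}}(x,x):=0$. The subscript $_{L,w}$ means that the model is taken on $V=\mathbb T_L$ with weights $w^{(L)}$; $G^{\mathrm{mdd}}_{L,w}(x):=G^{\mathrm{mdd}}_{L,w}(0,x)$ and $M^{\mathrm{mdd}}_{L,w}:=L^{-d}\sum_{x\in\mathbb T_L}G^{\mathrm{mdd}}_{L,w}(x)$. $e_1$ is the first coordinate unit vector. *)

theory Defs
  imports "HOL-Analysis.Analysis" "HOL-Computational_Algebra.Group_Closure"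
begin

section \<open>Admissible weights on the integer lattice\<close>

text \<open>The lattice of dimension \<open>d\<close> is \<^typ>\<open>int ^ 'd\<close> with \<open>d = CARD('d)\<close>. A translation-invariant
  weight \<open>w\<close> gives rise to the one-argument function \<open>w 0\<close>.\<close>

definition one_norm :: "int ^ 'd::finite \<Rightarrow> int" where
  "one_norm x = (\<Sum>i\<in>UNIV. \<bar>x $ i\<bar>)"

primrec conv_pow :: "('a::ab_group_add \<Rightarrow> real) \<Rightarrow> nat \<Rightarrow> 'a \<Rightarrow> real" where
  "conv_pow u 0 = (\<lambda>x. if x = 0 then 1 else 0)"
| "conv_pow u (Suc n) = (\<lambda>x. \<Sum>\<^sub>\<infinity>y. u y * conv_pow u n (x - y))"

text \<open>The sum of the return probabilities, i.e. the integral of \<open>1 / (1 - fourier w k)\<close> over the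
  torus with respect to the normalised Lebesgue measure, possibly infinite.\<close>

definition green :: "(int ^ 'd::finite \<Rightarrow> int ^ 'd \<Rightarrow> real) \<Rightarrow> ennreal" where
  "green w = (\<Sum>n. ennreal (conv_pow (w 0) n 0))"

definition fourier :: "(int ^ 'd::finite \<Rightarrow> int ^ 'd \<Rightarrow> real) \<Rightarrow> real ^ 'd \<Rightarrow> complex" where
  "fourier w k = (\<Sum>\<^sub>\<infinity>x. complex_of_real (w 0 x) * cis (\<Sum>i\<in>UNIV. k $ i * real_of_int (x $ i)))"

definition dual_torus :: "nat \<Rightarrow> (real ^ 'd::finite) set" where
  "dual_torus L = {k. \<forall>i. - pi < k $ i \<and> k $ i \<le> pi \<and>
                          (\<exists>j::int. k $ i = 2 * pi / real L * real_of_int j)}"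

definition even_to_infinity :: "nat filter" where
  "even_to_infinity = inf sequentially (principal {L. even L})"

definition half_space :: "'d::finite \<Rightarrow> (int ^ 'd) set" where
  "half_space i = {x. x $ i > 0}"

text \<open>\<open>reflection i x = x - 2 (x \<cdot> e\<^sub>i) e\<^sub>i + e\<^sub>i\<close>\<close>

definition reflection :: "'d::finite \<Rightarrow> int ^ 'd \<Rightarrow> int ^ 'd" where
  "reflection i x = x - axis i (2 * (x $ i)) + axis i 1"

text \<open>Only the restriction of \<open>f\<close> to the half space matters below, and membership in \<open>\<real>\<^sub>\<ge>\<^sub>0\<close> says that
  the complex sum is real and nonnegative.\<close>

definition OS_positive :: "(int ^ 'd::finite \<Rightarrow> int ^ 'd \<Rightarrow> real) \<Rightarrow> bool" where
  "OS_positive w \<longleftrightarrow>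
     (\<forall>i. \<forall>f :: int ^ 'd \<Rightarrow> complex. finite {x \<in> half_space i. f x \<noteq> 0} \<longrightarrow>
        (\<Sum>x \<in> {x \<in> half_space i. f x \<noteq> 0}. \<Sum>y \<in> {y \<in> half_space i. f y \<noteq> 0}.
            cnj (f x) * complex_of_real (w x (reflection i y)) * f y) \<in> \<real>\<^sub>\<ge>\<^sub>0)"

definition admissible :: "(int ^ 'd::finite \<Rightarrow> int ^ 'd \<Rightarrow> real) \<Rightarrow> bool" where
  "admissible w \<longleftrightarrow>
     (\<forall>x y. 0 \<le> w x y) \<and>
     (\<forall>x y. w x y = w y x) \<and>
     (\<forall>x y z. w x y = w (x + z) (y + z)) \<and>
     group_closure {x. w 0 x > 0} = UNIV \<and>
     (w 0 has_sum 1) UNIV \<and>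
     OS_positive w \<and>
     (green w < \<infinity> \<longrightarrow>
        ((\<lambda>L. (\<Sum>k \<in> dual_torus L - {0}. 1 / (1 - fourier w k)) / of_nat L ^ CARD('d))
           \<longlongrightarrow> complex_of_real (enn2real (green w))) even_to_infinity)"

definition bipartite :: "(int ^ 'd::finite \<Rightarrow> int ^ 'd \<Rightarrow> real) \<Rightarrow> bool" where
  "bipartite w \<longleftrightarrow> (\<forall>x. even (one_norm x) \<longrightarrow> w 0 x = 0)"


section \<open>The monomer double-dimer model on a finite weighted vertex set\<close>

text \<open>An edge is the two-element set of its end points.\<close>

definition edges :: "'a set \<Rightarrow> ('a \<Rightarrow> 'a \<Rightarrow> real) \<Rightarrow> 'a set set" where
  "edges V w = {{x, y} | x y. x \<in> V \<and> y \<in> V \<and> x \<noteq> y \<and> w x y > 0}"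

text \<open>For symmetric \<open>w\<close> the value on the unordered pair \<open>{x, y}\<close> is \<open>w x y\<close>.\<close>

definition edge_weight :: "('a \<Rightarrow> 'a \<Rightarrow> real) \<Rightarrow> 'a set \<Rightarrow> real" where
  "edge_weight w e = (THE r. \<exists>x y. e = {x, y} \<and> r = w x y)"

lemma edge_weight_doubleton:
  assumes "w x y = w y x"
  shows "edge_weight w {x, y} = w x y"
  unfolding edge_weight_def using assms
  by (intro the_equality) (auto simp: doubleton_eq_iff)

definition dimer_degree :: "'a set \<Rightarrow> ('a \<Rightarrow> 'a \<Rightarrow> real) \<Rightarrow> ('a set \<Rightarrow> nat) \<Rightarrow> 'a \<Rightarrow> nat" where
  "dimer_degree V w m x = (\<Sum>y | {x, y} \<in> edges V w. m {x, y})"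

type_synonym 'a dimer_pair = "('a set \<Rightarrow> nat) \<times> ('a set \<Rightarrow> nat)"

definition dimer_pairs :: "'a set \<Rightarrow> ('a \<Rightarrow> 'a \<Rightarrow> real) \<Rightarrow> 'a dimer_pair set" where
  "dimer_pairs V w = (edges V w \<rightarrow>\<^sub>E {0, 1}) \<times> (edges V w \<rightarrow>\<^sub>E {0, 1})"

definition mdd_configs :: "'a set \<Rightarrow> ('a \<Rightarrow> 'a \<Rightarrow> real) \<Rightarrow> 'a dimer_pair set" where
  "mdd_configs V w = {(m1, m2) \<in> dimer_pairs V w.
     \<forall>x\<in>V. dimer_degree V w m1 x = dimer_degree V w m2 x \<and> dimer_degree V w m1 x \<in> {0, 1}}"

text \<open>The set \<open>U\<close> holds the vertices whose monomer weights are counted: all of \<open>V\<close> for the measure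
  itself, and \<open>V - {x, y}\<close> in the two-point function.\<close>

definition mdd_weight ::
    "'a set \<Rightarrow> ('a \<Rightarrow> 'a \<Rightarrow> real) \<Rightarrow> 'a set \<Rightarrow> 'a dimer_pair \<Rightarrow> real" where
  "mdd_weight V w U = (\<lambda>(m1, m2).
     (\<Prod>x\<in>U. w x x ^ (1 - dimer_degree V w m1 x)) *
     (\<Prod>e\<in>edges V w. edge_weight w e ^ (m1 e + m2 e)))"

definition mdd_Z :: "'a set \<Rightarrow> ('a \<Rightarrow> 'a \<Rightarrow> real) \<Rightarrow> real" where
  "mdd_Z V w = (\<Sum>\<omega>\<in>mdd_configs V w. mdd_weight V w V \<omega>)"

definition mdd_measure :: "'a set \<Rightarrow> ('a \<Rightarrow> 'a \<Rightarrow> real) \<Rightarrow> 'a dimer_pair measure" where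
  "mdd_measure V w =
     point_measure (mdd_configs V w) (\<lambda>\<omega>. ennreal (mdd_weight V w V \<omega> / mdd_Z V w))"

text \<open>The loop containing \<open>x\<close> is the connected component of \<open>x\<close> in the multigraph in which the edge
  \<open>e\<close> has multiplicity \<open>m1 e + m2 e\<close>; \<open>loop_vertices\<close> is its vertex set.\<close>

definition loop_vertices ::
    "'a set \<Rightarrow> ('a \<Rightarrow> 'a \<Rightarrow> real) \<Rightarrow> 'a \<Rightarrow> 'a dimer_pair \<Rightarrow> 'a set" where
  "loop_vertices V w x = (\<lambda>(m1, m2).
     {(u, v). {u, v} \<in> edges V w \<and> m1 {u, v} + m2 {u, v} > 0}\<^sup>* `` {x})"

definition loop_length ::
    "'a set \<Rightarrow> ('a \<Rightarrow> 'a \<Rightarrow> real) \<Rightarrow> 'a \<Rightarrow> 'a dimer_pair \<Rightarrow> nat" where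
  "loop_length V w x = (\<lambda>(m1, m2).
     (\<Sum>e | e \<in> edges V w \<and> e \<subseteq> loop_vertices V w x (m1, m2). m1 e + m2 e))"

definition mdd_configs2 ::
    "'a set \<Rightarrow> ('a \<Rightarrow> 'a \<Rightarrow> real) \<Rightarrow> 'a \<Rightarrow> 'a \<Rightarrow> 'a dimer_pair set" where
  "mdd_configs2 V w x y = {(m1, m2) \<in> dimer_pairs V w.
     (\<forall>z\<in>V - {x, y}. dimer_degree V w m1 z = dimer_degree V w m2 z \<and>
                      dimer_degree V w m1 z \<in> {0, 1}) \<and>
     dimer_degree V w m1 x = 0 \<and> dimer_degree V w m1 y = 0 \<and>
     dimer_degree V w m2 x = 1 \<and> dimer_degree V w m2 y = 1}"

definition mdd_G :: "'a set \<Rightarrow> ('a \<Rightarrow> 'a \<Rightarrow> real) \<Rightarrow> 'a \<Rightarrow> 'a \<Rightarrow> real" where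
  "mdd_G V w x y =
     (if x = y then 0
      else (\<Sum>\<omega>\<in>mdd_configs2 V w x y. mdd_weight V w (V - {x, y}) \<omega>) / mdd_Z V w)"


section \<open>The model on the torus\<close>

text \<open>The torus of side length \<open>L\<close> is represented by the residues in \<open>{0..<L}\<close>, coordinatewise;
  \<open>to_torus L\<close> is the projection from the lattice.\<close>

definition torus :: "nat \<Rightarrow> (int ^ 'd::finite) set" where
  "torus L = {x. \<forall>i. 0 \<le> x $ i \<and> x $ i < int L}"

definition to_torus :: "nat \<Rightarrow> int ^ 'd::finite \<Rightarrow> int ^ 'd" where
  "to_torus L x = (\<chi> i. x $ i mod int L)"

definition periodised ::
    "nat \<Rightarrow> (int ^ 'd::finite \<Rightarrow> int ^ 'd \<Rightarrow> real) \<Rightarrow> int ^ 'd \<Rightarrow> int ^ 'd \<Rightarrow> real" where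
  "periodised L w x y = (\<Sum>\<^sub>\<infinity>z. w x (y + int L *s z))"

definition torus_G :: "nat \<Rightarrow> (int ^ 'd::finite \<Rightarrow> int ^ 'd \<Rightarrow> real) \<Rightarrow> int ^ 'd \<Rightarrow> real" where
  "torus_G L w x = mdd_G (torus L) (periodised L w) 0 (to_torus L x)"

definition torus_M :: "nat \<Rightarrow> (int ^ 'd::finite \<Rightarrow> int ^ 'd \<Rightarrow> real) \<Rightarrow> real" where
  "torus_M L w = (\<Sum>x\<in>torus L. torus_G L w x) / real L ^ CARD('d)"

definition torus_mdd ::
    "nat \<Rightarrow> (int ^ 'd::finite \<Rightarrow> int ^ 'd \<Rightarrow> real) \<Rightarrow> (int ^ 'd) dimer_pair measure" where
  "torus_mdd L w = mdd_measure (torus L) (periodised L w)"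

definition torus_exp_length :: "nat \<Rightarrow> (int ^ 'd::finite \<Rightarrow> int ^ 'd \<Rightarrow> real) \<Rightarrow> real" where
  "torus_exp_length L w =
     (\<integral>\<omega>. real (loop_length (torus L) (periodised L w) 0 \<omega>) \<partial>torus_mdd L w)"

definition torus_prob_visit ::
    "nat \<Rightarrow> (int ^ 'd::finite \<Rightarrow> int ^ 'd \<Rightarrow> real) \<Rightarrow> int ^ 'd \<Rightarrow> real" where
  "torus_prob_visit L w x = measure (torus_mdd L w)
     {\<omega> \<in> space (torus_mdd L w). to_torus L x \<in> loop_vertices (torus L) (periodised L w) 0 \<omega>}"

end

theory Submission
  imports Defs
begin

text \<open>
  Bipartite weights vanish on the diagonal, so there are no monomers: both copies are dimer
  coverings, and with the dimer partition function \<open>Z\<close> one has \<open>G(x, y) = Z(V - {x, y}) / Z(V)\<close>.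
  Removing the dimer at the origin gives \<open>\<Sum>\<^sub>x w(x) G(x) = 1\<close>.

  Reflection positivity of the weights carries over to the dimer model and yields, by Gaussian
  domination, the infrared bound \<open>\<Gamma>(k) \<le> 1 / (1 - \<omega>(k))\<close> for \<open>k \<noteq> 0\<close>, where \<open>\<omega>\<close> and \<open>\<Gamma>\<close> are the Fourier
  transforms of \<open>w\<close> and \<open>G\<close>. As \<open>w\<close> and \<open>G\<close> live on odd sites, both transforms change sign under
  \<open>k \<mapsto> k + (\<pi>, \<dots>, \<pi>)\<close>, which turns this into a two-sided bound. The modes \<open>0\<close> and \<open>(\<pi>, \<dots>, \<pi>)\<close>
  together contribute \<open>2 M\<close> to \<open>1 = L\<^sup>-\<^sup>d \<Sum>\<^sub>k \<omega>(k) \<Gamma>(k)\<close>, so \<open>2 M\<close> is at least one minus the average of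
  \<open>\<bar>\<omega>\<bar> / (1 - \<bar>\<omega>\<bar>)\<close> over the other modes. Since \<open>\<bar>\<omega>\<bar> \<le> \<omega>\<^sup>2 + 1 / 4\<close>, this average is at most that of
  \<open>9 / 4 / (1 - \<omega>\<^sup>2) - 2\<close>, which tends to \<open>9 g / 4 - 2\<close>, a number below one exactly if \<open>g < 4 / 3\<close>.

  Reflection positivity also makes \<open>n \<mapsto> G(n e\<^sub>i)\<close> log-convex on the odd integers, which turns the
  bound on the mean into a pointwise one. Finally, a covering of \<open>V - {x, y}\<close> and one of
  \<open>V - {x + e, y + e}\<close> can be rewired, at the cost of two edge weights, into two coverings of \<open>V\<close>
  with \<open>x\<close> and \<open>y\<close> in the same loop, so \<open>P(y \<in> L\<^sub>x) \<ge> w(e)\<^sup>2 G(x, y)\<^sup>2\<close>.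
\<close>

section \<open>Weighted dimer coverings\<close>

text \<open>After the first section, coverings themselves return only where loops are studied.
  Everything about positivity rests on the recursion for removing one vertex, which together with
  the value 1 on the empty set determines \<open>Z\<close>; two quantities are identified by
  checking that both obey it. Gaussian domination is needed only to second order in the external
  field, so it is phrased as nonpositivity of one explicit quadratic form whose part across each
  mirror is nonnegative. OS-positivity is given for one plane of the infinite lattice, whereas a
  mirror of the torus has two planes and each weight is a sum over all images; an even side length
  lets each slice of images be read as a reflection in one plane of the lattice. The constant
  \<open>1 / 4\<close> is optimal in its family: from
  \<open>a \<le> a\<^sup>2 / (2 t) + t / 2\<close> the condition becomes
  \<open>g < (4 t + 1) / (1 + t)\<^sup>2\<close>, whose right side is largest at
  \<open>t = 1 / 2\<close>, with value \<open>4 / 3\<close>.\<close>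

definition covers :: "'a set \<Rightarrow> ('a \<Rightarrow> 'a \<Rightarrow> real) \<Rightarrow> 'a set \<Rightarrow> ('a set \<Rightarrow> nat) set" where
  "covers V w S = {m \<in> edges V w \<rightarrow>\<^sub>E {0, 1}. \<forall>x\<in>V. dimer_degree V w m x = of_bool (x \<in> S)}"

definition cover_weight :: "'a set \<Rightarrow> ('a \<Rightarrow> 'a \<Rightarrow> real) \<Rightarrow> ('a set \<Rightarrow> nat) \<Rightarrow> real" where
  "cover_weight V w m = (\<Prod>e\<in>edges V w. edge_weight w e ^ m e)"

text \<open>Coverings of \<open>S\<close> live on the fixed edge set of \<open>V\<close>, with
  degree 0 outside \<open>S\<close>. Edges that leave \<open>S\<close> then carry 0 and contribute a
  factor 1, so deleting vertices changes only the argument \<open>S\<close>.\<close>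

definition dimer_Z :: "'a set \<Rightarrow> ('a \<Rightarrow> 'a \<Rightarrow> real) \<Rightarrow> 'a set \<Rightarrow> real" where
  "dimer_Z V w S = (\<Sum>m\<in>covers V w S. cover_weight V w m)"

lemma fun_upd_in_PiE:
  assumes "i \<in> I" "f \<in> Pi\<^sub>E I B" "a \<in> B i"
  shows "f(i := a) \<in> Pi\<^sub>E I B"
  using assms by (auto simp: PiE_def Pi_def extensional_def)

locale dimer_graph =
  fixes V :: "'a set" and w :: "'a \<Rightarrow> 'a \<Rightarrow> real"
  assumes fin: "finite V"
    and sym: "\<And>x y. x \<in> V \<Longrightarrow> y \<in> V \<Longrightarrow> w x y = w y x"
    and nonneg: "\<And>x y. x \<in> V \<Longrightarrow> y \<in> V \<Longrightarrow> 0 \<le> w x y"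
begin

abbreviation "E \<equiv> edges V w"
abbreviation "deg \<equiv> dimer_degree V w"
abbreviation "Z \<equiv> dimer_Z V w"

lemma edges_sub: "E \<subseteq> Pow V"
  unfolding edges_def by auto

lemma finite_edges: "finite E"
  using edges_sub fin finite_subset by blast

lemma edge_in: "{x, y} \<in> E \<longleftrightarrow> x \<in> V \<and> y \<in> V \<and> x \<noteq> y \<and> 0 < w x y"
  unfolding edges_def using sym by (auto simp: doubleton_eq_iff)

lemma edgeE:
  assumes "e \<in> E" obtains x y where "e = {x, y}" "x \<in> V" "y \<in> V" "x \<noteq> y" "0 < w x y"
  using assms unfolding edges_def by auto

lemma edge_weight_eq: "x \<in> V \<Longrightarrow> y \<in> V \<Longrightarrow> edge_weight w {x, y} = w x y"
  by (intro edge_weight_doubleton sym)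

lemma edge_weight_pos: "e \<in> E \<Longrightarrow> 0 < edge_weight w e"
  by (metis edgeE edge_weight_eq)

lemma finite_nbrs: "finite {y. {x, y} \<in> E}"
  by (rule finite_subset[OF _ fin]) (auto simp: edge_in)

lemma finite_covers: "finite (covers V w S)"
proof -
  have "finite (E \<rightarrow>\<^sub>E {0, 1 :: nat})" by (intro finite_PiE finite_edges) auto
  then show ?thesis unfolding covers_def by simp
qed

lemma cover_weight_pos: "0 < cover_weight V w m"
  unfolding cover_weight_def by (intro prod_pos) (simp add: edge_weight_pos)

lemma Z_nonneg: "0 \<le> Z S"
  unfolding dimer_Z_def by (intro sum_nonneg less_imp_le[OF cover_weight_pos])

text \<open>Starting from the value 0 keeps the rule free of subtraction on naturals. Removing a
  dimer is the same rule, applied to the function from which the dimer is already deleted.\<close>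

lemma deg_upd:
  assumes "{x, y} \<in> E" "m {x, y} = 0"
  shows "deg (m({x, y} := c)) z = deg m z + (if z = x \<or> z = y then c else 0)"
proof -
  have ne: "x \<noteq> y" using assms(1) edge_in by auto
  let ?N = "{u. {z, u} \<in> E}"
  have "deg (m({x, y} := c)) z = (\<Sum>u\<in>?N. m {z, u} + (if {z, u} = {x, y} then c else 0))"
    unfolding dimer_degree_def using assms(2) by (intro sum.cong) auto
  also have "\<dots> = deg m z + (\<Sum>u\<in>?N. if {z, u} = {x, y} then c else 0)"
    unfolding dimer_degree_def by (simp add: sum.distrib)
  also have "(\<Sum>u\<in>?N. if {z, u} = {x, y} then c else 0) = (if z = x \<or> z = y then c else 0)"
  proof (cases "z = x \<or> z = y")
    case True
    define v where "v = (if z = x then y else x)"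
    have eq: "{z, u} = {x, y} \<longleftrightarrow> u = v" for u using True ne by (auto simp: v_def doubleton_eq_iff)
    have "v \<in> ?N" using assms(1) True by (auto simp: v_def insert_commute)
    then show ?thesis using True finite_nbrs[of z] unfolding eq by simp
  next
    case False
    then have "{z, u} \<noteq> {x, y}" for u by (auto simp: doubleton_eq_iff)
    then show ?thesis using False by simp
  qed
  finally show ?thesis .
qed

lemma cover_val: "m \<in> covers V w S \<Longrightarrow> e \<in> E \<Longrightarrow> m e = 0 \<or> m e = 1"
  unfolding covers_def by (auto simp: PiE_iff)

lemma cover_deg: "m \<in> covers V w S \<Longrightarrow> x \<in> V \<Longrightarrow> deg m x = of_bool (x \<in> S)"
  unfolding covers_def by auto

lemma deg_ge: "{x, y} \<in> E \<Longrightarrow> m {x, y} \<le> deg m x"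
  unfolding dimer_degree_def using finite_nbrs by (intro member_le_sum) auto

lemma cover_in:
  assumes "m \<in> covers V w S" "{x, y} \<in> E" "m {x, y} \<noteq> 0"
  shows "x \<in> S" "y \<in> S"
proof -
  have "x \<in> V" "y \<in> V" "{y, x} \<in> E" using assms(2) edge_in by (auto simp: insert_commute)
  moreover have "m {x, y} \<le> deg m x" using deg_ge assms(2) by blast
  moreover have "m {x, y} \<le> deg m y"
    using deg_ge[OF \<open>{y, x} \<in> E\<close>, of m] by (simp add: insert_commute)
  ultimately show "x \<in> S" "y \<in> S" using assms cover_deg[OF assms(1)]
    by (auto simp: of_bool_def split: if_splits)
qed

lemma cover_partner:
  assumes "m \<in> covers V w S" "x \<in> S" "x \<in> V"
  obtains y where "{x, y} \<in> E" "m {x, y} = 1" "\<And>z. {x, z} \<in> E \<Longrightarrow> m {x, z} \<noteq> 0 \<Longrightarrow> z = y"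
proof -
  let ?N = "{u. {x, u} \<in> E}"
  have d: "(\<Sum>u\<in>?N. m {x, u}) = 1"
    using cover_deg[OF assms(1,3)] assms(2) by (simp add: dimer_degree_def)
  then obtain y where y: "y \<in> ?N" "m {x, y} \<noteq> 0"
    by (metis sum.neutral zero_neq_one)
  have "m {x, y} = 1" using cover_val[OF assms(1), of "{x, y}"] y by auto
  moreover have "z = y" if "{x, z} \<in> E" "m {x, z} \<noteq> 0" for z
  proof (rule ccontr)
    assume "z \<noteq> y"
    then have "m {x, y} + m {x, z} = (\<Sum>u\<in>{y, z}. m {x, u})" by simp
    also have "\<dots> \<le> (\<Sum>u\<in>?N. m {x, u})"
      using y that finite_nbrs by (intro sum_mono2) auto
    finally show False using d that y by simp
  qed
  ultimately show ?thesis using that y by blast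
qed

lemma covers_insert:
  assumes "x \<in> V" "S \<subseteq> V" "x \<notin> S"
  shows "covers V w (insert x S) =
    (\<Union>y\<in>{y\<in>S. {x, y} \<in> E}. (\<lambda>m. m({x, y} := 1)) ` covers V w (S - {y}))"
proof (intro equalityI subsetI)
  fix m assume m: "m \<in> covers V w (insert x S)"
  then obtain y where y: "{x, y} \<in> E" "m {x, y} = 1"
    using cover_partner[of m "insert x S" x] assms by blast
  have yS: "y \<in> S" using cover_in[OF m y(1)] y edge_in by auto
  define m' where "m' = m({x, y} := 0)"
  have mm: "m'({x, y} := 1) = m" using y by (auto simp: m'_def)
  have "m' \<in> E \<rightarrow>\<^sub>E {0, 1}"
    using m fun_upd_in_PiE[OF y(1), of m "\<lambda>_. {0, 1}" 0] unfolding covers_def m'_def by auto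
  moreover have "deg m' z = of_bool (z \<in> S - {y})" if "z \<in> V" for z
  proof -
    have "deg m z = deg m' z + (if z = x \<or> z = y then 1 else 0)"
      using deg_upd[of x y m' 1 z] y(1) unfolding mm by (simp add: m'_def)
    then show ?thesis using cover_deg[OF m that] assms yS by (auto split: if_splits)
  qed
  ultimately have "m' \<in> covers V w (S - {y})" unfolding covers_def by auto
  then show "m \<in> (\<Union>y\<in>{y\<in>S. {x, y} \<in> E}. (\<lambda>m. m({x, y} := 1)) ` covers V w (S - {y}))"
    using mm[symmetric] yS y by blast
next
  fix m assume "m \<in> (\<Union>y\<in>{y\<in>S. {x, y} \<in> E}. (\<lambda>m. m({x, y} := 1)) ` covers V w (S - {y}))"
  then obtain y m' where y: "y \<in> S" "{x, y} \<in> E" and m': "m' \<in> covers V w (S - {y})"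
    and m: "m = m'({x, y} := 1)" by blast
  have z: "m' {x, y} = 0" using cover_in[OF m' y(2)] by auto
  have "m \<in> E \<rightarrow>\<^sub>E {0, 1}"
    using m' fun_upd_in_PiE[OF y(2), of m' "\<lambda>_. {0, 1}" 1] unfolding covers_def m by auto
  moreover have "deg m v = of_bool (v \<in> insert x S)" if "v \<in> V" for v
    using deg_upd[of x y m' 1 v] y z cover_deg[OF m' that] assms unfolding m
    by (cases "v = x"; cases "v = y") auto
  ultimately show "m \<in> covers V w (insert x S)" unfolding covers_def by auto
qed

lemma cover_weight_upd:
  assumes "{x, y} \<in> E" "m {x, y} = 0"
  shows "cover_weight V w (m({x, y} := 1)) = w x y * cover_weight V w m"
proof -
  have "(\<Prod>e\<in>E. edge_weight w e ^ (m({x, y} := 1)) e) =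
      (\<Prod>e\<in>E. (if e = {x, y} then edge_weight w e else 1) * edge_weight w e ^ m e)"
    using assms(2) by (intro prod.cong) auto
  also have "\<dots> = (\<Prod>e\<in>E. if e = {x, y} then edge_weight w e else 1) * (\<Prod>e\<in>E. edge_weight w e ^ m e)"
    by (rule prod.distrib)
  finally show ?thesis
    using assms finite_edges edge_weight_eq[of x y] edge_in unfolding cover_weight_def by simp
qed

text \<open>Coverings are sorted by the partner \<open>y\<close> of \<open>x\<close>; deleting the
  dimer leaves a covering of \<open>S - {y}\<close>. This is the recursion on which the positivity
  arguments are built.\<close>

theorem Z_insert:
  assumes "x \<in> V" "S \<subseteq> V" "x \<notin> S"
  shows "Z (insert x S) = (\<Sum>y\<in>S. w x y * Z (S - {y}))"
proof -
  let ?T = "{y\<in>S. {x, y} \<in> E}"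
  let ?f = "\<lambda>y m. (m({x, y} := 1)) :: 'a set \<Rightarrow> nat"
  have finS: "finite S" using assms fin finite_subset by blast
  have z: "m {x, y} = 0" if "y \<in> ?T" "m \<in> covers V w (S - {y})" for y m
    using cover_in[OF that(2)] that(1) by blast
  have zz: "m {x, y'} = 0" if "y \<in> ?T" "y' \<in> ?T" "m \<in> covers V w (S - {y})" for y y' m
    using cover_in[OF that(3)] that assms by blast
  have inj: "inj_on (?f y) (covers V w (S - {y}))" if "y \<in> ?T" for y
  proof (rule inj_onI)
    fix m m' assume "m \<in> covers V w (S - {y})" "m' \<in> covers V w (S - {y})" "?f y m = ?f y m'"
    then show "m = m'" using z[OF that] by (metis fun_upd_triv fun_upd_upd)
  qed
  have disj: "?f y ` covers V w (S - {y}) \<inter> ?f y' ` covers V w (S - {y'}) = {}"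
    if T: "y \<in> ?T" "y' \<in> ?T" "y \<noteq> y'" for y y'
  proof -
    have "?f y m \<noteq> ?f y' m'" if m: "m \<in> covers V w (S - {y})" "m' \<in> covers V w (S - {y'})" for m m'
    proof
      assume eq: "?f y m = ?f y' m'"
      have ne: "{x, y} \<noteq> {x, y'}" using \<open>y \<noteq> y'\<close> by (auto simp: doubleton_eq_iff)
      have "1 = ?f y m {x, y}" by simp
      also have "\<dots> = m' {x, y}" using ne unfolding eq by simp
      also have "\<dots> = 0" using zz[OF T(2,1) m(2)] .
      finally show False by simp
    qed
    then show ?thesis by blast
  qed
  have "Z (insert x S) = (\<Sum>y\<in>?T. \<Sum>m\<in>?f y ` covers V w (S - {y}). cover_weight V w m)"
    unfolding dimer_Z_def covers_insert[OF assms]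
    using finS finite_covers disj by (intro sum.UNION_disjoint) auto
  also have "\<dots> = (\<Sum>y\<in>?T. w x y * Z (S - {y}))"
  proof (intro sum.cong refl)
    fix y assume y: "y \<in> ?T"
    have "cover_weight V w (?f y m) = w x y * cover_weight V w m" if "m \<in> covers V w (S - {y})" for m
      using cover_weight_upd[of x y m] z[OF y that] y by blast
    then show "(\<Sum>m\<in>?f y ` covers V w (S - {y}). cover_weight V w m) = w x y * Z (S - {y})"
      by (simp only: sum.reindex[OF inj[OF y]] o_def dimer_Z_def sum_distrib_left cong: sum.cong)
  qed
  also have "\<dots> = (\<Sum>y\<in>S. w x y * Z (S - {y}))"
  proof (intro sum.mono_neutral_left finS ballI)
    fix y assume "y \<in> S - ?T"
    then have "w x y = 0" using assms edge_in nonneg[of x y] by (cases "x = y") force+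
    then show "w x y * Z (S - {y}) = 0" by simp
  qed auto
  finally show ?thesis .
qed

lemma Z_empty: "Z {} = 1"
proof -
  define m0 :: "'a set \<Rightarrow> nat" where "m0 = (\<lambda>e\<in>E. 0)"
  have "covers V w {} = {m0}"
  proof (intro equalityI subsetI)
    fix m assume m: "m \<in> covers V w {}"
    have "m e = m0 e" for e
    proof (cases "e \<in> E")
      case True
      then show ?thesis using cover_in[OF m] by (metis edgeE empty_iff m0_def restrict_apply)
    next
      case False
      then show ?thesis using m unfolding covers_def m0_def by (auto simp: PiE_iff extensional_def)
    qed
    then show "m \<in> {m0}" by auto
  next
    fix m assume "m \<in> {m0}"
    then show "m \<in> covers V w {}" unfolding covers_def m0_def
      by (auto simp: dimer_degree_def)
  qed
  moreover have "cover_weight V w m0 = 1" unfolding cover_weight_def m0_def by simp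
  ultimately show ?thesis unfolding dimer_Z_def by simp
qed

end

section \<open>Positive semidefinite kernels\<close>

definition psd :: "'i set \<Rightarrow> ('i \<Rightarrow> 'i \<Rightarrow> real) \<Rightarrow> bool" where
  "psd I C \<longleftrightarrow> (\<forall>x\<in>I. \<forall>y\<in>I. C x y = C y x) \<and>
     (\<forall>c. 0 \<le> (\<Sum>x\<in>I. \<Sum>y\<in>I. c x * c y * C x y))"

lemma psd_sym: "psd I C \<Longrightarrow> x \<in> I \<Longrightarrow> y \<in> I \<Longrightarrow> C x y = C y x"
  unfolding psd_def by blast

lemma psd_form: "psd I C \<Longrightarrow> 0 \<le> (\<Sum>x\<in>I. \<Sum>y\<in>I. c x * c y * C x y)"
  unfolding psd_def by blast

lemma sum_push:
  fixes a b :: "'p \<Rightarrow> real"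
  assumes "finite P" "finite T" "f ` P \<subseteq> T"
  shows "(\<Sum>p\<in>P. \<Sum>q\<in>P. a p * b q * K (f p) (f q)) =
    (\<Sum>s\<in>T. \<Sum>t\<in>T. (\<Sum>p | p \<in> P \<and> f p = s. a p) * (\<Sum>q | q \<in> P \<and> f q = t. b q) * K s t)"
proof -
  have prod3: "sum a A * sum b B * k = (\<Sum>p\<in>A. \<Sum>q\<in>B. a p * b q * k)" for A B and k :: real
    unfolding sum_product by (simp only: sum_distrib_right)
  have "(\<Sum>s\<in>T. \<Sum>t\<in>T. (\<Sum>p | p \<in> P \<and> f p = s. a p) * (\<Sum>q | q \<in> P \<and> f q = t. b q) * K s t)
      = (\<Sum>s\<in>T. \<Sum>t\<in>T. \<Sum>p | p \<in> P \<and> f p = s. \<Sum>q | q \<in> P \<and> f q = t. a p * b q * K (f p) (f q))"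
    unfolding prod3 by (intro sum.cong refl) auto
  also have "\<dots> = (\<Sum>s\<in>T. \<Sum>p | p \<in> P \<and> f p = s. \<Sum>t\<in>T. \<Sum>q | q \<in> P \<and> f q = t. a p * b q * K (f p) (f q))"
    by (intro sum.cong refl sum.swap)
  also have "\<dots> = (\<Sum>p\<in>P. \<Sum>q\<in>P. a p * b q * K (f p) (f q))"
    by (simp only: sum.group[OF assms])
  finally show ?thesis by simp
qed

text \<open>The map \<open>f\<close> may identify indices: coefficients of indices with the same
  image are added. This permits duplicated vertices and families with repeated points.\<close>

lemma psd_push:
  assumes "psd T K" "finite P" "finite T" "f ` P \<subseteq> T"
  shows "psd P (\<lambda>p q. K (f p) (f q))"
  unfolding psd_def
proof (intro conjI allI ballI)
  fix c :: "'b \<Rightarrow> real"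
  show "0 \<le> (\<Sum>x\<in>P. \<Sum>y\<in>P. c x * c y * K (f x) (f y))"
    unfolding sum_push[OF assms(2-4), of c c K] by (rule psd_form[OF assms(1)])
qed (use assms in \<open>auto intro: psd_sym\<close>)

lemma psd_cong: "(\<And>x y. x \<in> I \<Longrightarrow> y \<in> I \<Longrightarrow> C x y = D x y) \<Longrightarrow> psd I C \<longleftrightarrow> psd I D"
  unfolding psd_def by (auto cong: sum.cong)

lemma psd_cauchy:
  assumes "psd I C" "finite I" "x \<in> I" "y \<in> I"
  shows "(C x y)\<^sup>2 \<le> C x x * C y y" "0 \<le> C x x"
proof -
  have two: "0 \<le> a\<^sup>2 * C x x + 2 * a * b * C x y + b\<^sup>2 * C y y" for a b
  proof -
    \<comment> \<open>A two-element index set, mapped to \<open>x\<close> and \<open>y\<close>, so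
      that \<open>x = y\<close> needs no separate treatment.\<close>
    have "psd {False, True} (\<lambda>p q. C (if p then x else y) (if q then x else y))"
      using psd_push[OF assms(1), of "{False, True}" "\<lambda>p. if p then x else y"] assms by auto
    from psd_form[OF this, of "\<lambda>p. if p then a else b"]
    show ?thesis using psd_sym[OF assms(1,3,4)] by (simp add: power2_eq_square algebra_simps)
  qed
  show xx: "0 \<le> C x x" using two[of 1 0] by simp
  show "(C x y)\<^sup>2 \<le> C x x * C y y"
  proof (cases "C x x = 0")
    case True
    have "C x y = 0"
    proof (rule ccontr)
      assume n: "C x y \<noteq> 0"
      \<comment> \<open>With \<open>C x x = 0\<close> the form is affine in the coefficient of
        \<open>x\<close>; this coefficient makes its value \<open>-1\<close>.\<close>
      have "0 \<le> 2 * (- (C y y + 1) / (2 * C x y)) * C x y + C y y"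
        using two[of "- (C y y + 1) / (2 * C x y)" 1] True by simp
      then show False using n by (simp add: field_simps)
    qed
    then show ?thesis using True by simp
  next
    case False
    then have p: "0 < C x x" using xx by simp
    have "0 \<le> (C x y)\<^sup>2 * C x x - 2 * C x y * C x x * C x y + (C x x)\<^sup>2 * C y y"
      using two[of "- C x y" "C x x"] by (simp add: algebra_simps)
    also have "\<dots> = C x x * (C x x * C y y - (C x y)\<^sup>2)"
      by (simp add: algebra_simps power2_eq_square)
    finally show ?thesis using p by (simp add: zero_le_mult_iff)
  qed
qed

text \<open>Cholesky elimination: \<open>C'\<close> is the Schur complement after eliminating
  \<open>p\<close>. If \<open>C p p = 0\<close>, the whole row of \<open>p\<close> vanishes by
  Cauchy-Schwarz, so the convention that division by zero gives zero produces the right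
  formulas.\<close>

lemma gram:
  assumes "finite I" "psd I C"
  shows "\<exists>g::'i \<Rightarrow> 'i \<Rightarrow> real. \<forall>x\<in>I. \<forall>y\<in>I. C x y = (\<Sum>k\<in>I. g k x * g k y)"
  using assms
proof (induction I arbitrary: C rule: finite_induct)
  case empty
  then show ?case by simp
next
  case (insert p I)
  note psd_p = \<open>psd (insert p I) C\<close>
  have sym: "C x y = C y x" if "x \<in> insert p I" "y \<in> insert p I" for x y
    using psd_sym[OF psd_p that] .
  have pp: "0 \<le> C p p" using psd_cauchy(2)[OF psd_p, of p p] insert by simp
  define C' where "C' = (\<lambda>x y. C x y - C p x * C p y / C p p)"
  have zero: "C p x = 0" if "C p p = 0" "x \<in> I" for x
    using psd_cauchy(1)[OF psd_p, of p x] that insert by simp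
  have "psd I C'"
    unfolding psd_def
  proof (intro conjI ballI allI)
    fix x y assume "x \<in> I" "y \<in> I"
    then show "C' x y = C' y x" using sym unfolding C'_def by simp
  next
    fix c :: "'i \<Rightarrow> real"
    define t where "t = (\<Sum>x\<in>I. c x * C p x)"
    \<comment> \<open>The coefficient at \<open>p\<close> that minimises the form when the others
      are fixed; the minimum is the form of the Schur complement.\<close>
    define c' where "c' = c(p := - t / C p p)"
    have c': "c' x = c x" if "x \<in> I" for x using that insert(2) by (auto simp: c'_def)
    have "0 \<le> (\<Sum>x\<in>insert p I. \<Sum>y\<in>insert p I. c' x * c' y * C x y)"
      by (rule psd_form[OF psd_p])
    also have "\<dots> = c' p * c' p * C p p + (\<Sum>y\<in>I. c' p * c y * C p y)
        + (\<Sum>x\<in>I. c x * c' p * C x p) + (\<Sum>x\<in>I. \<Sum>y\<in>I. c x * c y * C x y)"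
      using insert(1,2) c' by (simp add: sum.distrib)
    also have "(\<Sum>y\<in>I. c' p * c y * C p y) = c' p * t"
      unfolding t_def sum_distrib_left by (simp add: mult.assoc)
    also have "(\<Sum>x\<in>I. c x * c' p * C x p) = c' p * t"
      unfolding t_def sum_distrib_left using sym by (intro sum.cong) (auto simp: mult_ac)
    also have "c' p * c' p * C p p + c' p * t + c' p * t = - t * t / C p p"
      using zero by (cases "C p p = 0") (auto simp: c'_def field_simps t_def)
    also have "\<dots> = - (\<Sum>x\<in>I. \<Sum>y\<in>I. c x * c y * (C p x * C p y / C p p))"
      unfolding t_def by (simp add: sum_product sum_divide_distrib sum_negf mult_ac)
    finally show "0 \<le> (\<Sum>x\<in>I. \<Sum>y\<in>I. c x * c y * C' x y)"
      unfolding C'_def by (simp add: right_diff_distrib sum_subtractf)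
  qed
  from insert.IH[OF this] obtain g where g: "\<And>x y. x \<in> I \<Longrightarrow> y \<in> I \<Longrightarrow> C' x y = (\<Sum>k\<in>I. g k x * g k y)"
    by blast
  define h where "h = (\<lambda>k x. if k = p then C p x / sqrt (C p p) else if x = p then 0 else g k x)"
  have "C x y = (\<Sum>k\<in>insert p I. h k x * h k y)" if xy: "x \<in> insert p I" "y \<in> insert p I" for x y
  proof -
    have z: "C p u = 0" "C u p = 0" if "C p p = 0" "u \<in> insert p I" for u
      using zero[of u] sym[of p u] that by auto
    have "(\<Sum>k\<in>insert p I. h k x * h k y) = C p x * C p y / C p p + (\<Sum>k\<in>I. h k x * h k y)"
      using insert(1,2) pp by (simp add: h_def)
    also have "(\<Sum>k\<in>I. h k x * h k y) = (if x = p \<or> y = p then 0 else C' x y)"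
    proof (cases "x = p \<or> y = p")
      case True
      then show ?thesis using insert(2) by (auto simp: h_def intro!: sum.neutral)
    next
      case False
      then have "C' x y = (\<Sum>k\<in>I. g k x * g k y)" using g xy by simp
      also have "\<dots> = (\<Sum>k\<in>I. h k x * h k y)" using False insert(2) by (intro sum.cong) (auto simp: h_def)
      finally show ?thesis using False by simp
    qed
    also have "C p x * C p y / C p p + (if x = p \<or> y = p then 0 else C' x y) = C x y"
      using z xy sym[of p x] by (cases "C p p = 0") (auto simp: C'_def)
    finally show ?thesis by simp
  qed
  then show ?case by blast
qed

text \<open>The weight of the dimer coverings of the disjoint union of \<open>X\<close> and \<open>Y\<close> with exactly \<open>k\<close> dimers
  between the two sides, when \<open>C\<close> weighs these and \<open>l\<close> is the partition function of either side.
  Removing one of the \<open>k\<close> crossing dimers gives the recursion.\<close>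

primrec crossings :: "('i \<Rightarrow> 'i \<Rightarrow> real) \<Rightarrow> ('i set \<Rightarrow> real) \<Rightarrow> nat \<Rightarrow> 'i set \<Rightarrow> 'i set \<Rightarrow> real" where
  "crossings C l 0 = (\<lambda>X Y. l X * l Y)"
| "crossings C l (Suc k) = (\<lambda>X Y.
     (\<Sum>u\<in>X. \<Sum>v\<in>Y. C u v * crossings C l k (X - {u}) (Y - {v})) / real (Suc k))"

lemma crossings_zero: "finite X \<Longrightarrow> card X < k \<Longrightarrow> crossings C l k X Y = 0"
proof (induction k arbitrary: X Y)
  case (Suc k)
  have "crossings C l k (X - {u}) (Y - {v}) = 0" if "u \<in> X" for u v
  proof (intro Suc.IH)
    have "0 < card X" using Suc.prems that card_gt_0_iff by blast
    then show "card (X - {u}) < k" using Suc.prems that by simp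
  qed (use Suc.prems in simp)
  then show ?case by simp
qed simp

lemma crossings_sym:
  assumes "\<And>x y. x \<in> I \<Longrightarrow> y \<in> I \<Longrightarrow> C x y = C y x" "X \<subseteq> I" "Y \<subseteq> I"
  shows "crossings C l k X Y = crossings C l k Y X"
  using assms(2,3)
proof (induction k arbitrary: X Y)
  case (Suc k)
  have "(\<Sum>u\<in>X. \<Sum>v\<in>Y. C u v * crossings C l k (X - {u}) (Y - {v})) =
        (\<Sum>v\<in>Y. \<Sum>u\<in>X. C v u * crossings C l k (Y - {v}) (X - {u}))"
    unfolding sum.swap[of _ Y X]
  proof (intro sum.cong refl)
    fix u v assume "u \<in> X" "v \<in> Y"
    then show "C u v * crossings C l k (X - {u}) (Y - {v}) = C v u * crossings C l k (Y - {v}) (X - {u})"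
      using Suc.IH[of "X - {u}" "Y - {v}"] Suc.prems assms(1)[of u v]
      by (simp add: subset_iff)
  qed
  then show ?case by simp
qed simp

lemma sum_swap_diff:
  fixes f :: "'a \<Rightarrow> 'a \<Rightarrow> real"
  assumes "finite X"
  shows "(\<Sum>u\<in>X. \<Sum>y\<in>X - {u}. f u y) = (\<Sum>y\<in>X. \<Sum>u\<in>X - {y}. f u y)"
proof -
  have "(\<Sum>u\<in>X. \<Sum>y\<in>X - {u}. f u y) = (\<Sum>u\<in>X. \<Sum>y\<in>X. if y = u then 0 else f u y)"
    using assms by (intro sum.cong refl sum.mono_neutral_cong_left) auto
  also have "\<dots> = (\<Sum>y\<in>X. \<Sum>u\<in>X. if y = u then 0 else f u y)" by (rule sum.swap)
  also have "\<dots> = (\<Sum>y\<in>X. \<Sum>u\<in>X - {y}. f u y)"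
    using assms by (intro sum.cong refl sum.mono_neutral_cong_right) auto
  finally show ?thesis .
qed

text \<open>Either \<open>x\<close> has its partner on its own side, or it is the end of a crossing
  dimer. In the defining recursion the removed crossing dimer sits at \<open>x\<close> or elsewhere;
  by induction the second case yields the crossing term of \<open>x\<close> another \<open>k\<close>
  times. The total multiplicity \<open>Suc k\<close> cancels the denominator.\<close>

lemma crossings_insert:
  assumes fin: "finite I" and X: "X \<subseteq> I" and Y: "Y \<subseteq> I" and x: "x \<in> I" "x \<notin> X"
    and l: "\<And>x X. X \<subseteq> I \<Longrightarrow> x \<in> I \<Longrightarrow> x \<notin> X \<Longrightarrow> l (insert x X) = (\<Sum>y\<in>X. A x y * l (X - {y}))"
  shows "crossings C l k (insert x X) Y = (\<Sum>y\<in>X. A x y * crossings C l k (X - {y}) Y) +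
     (case k of 0 \<Rightarrow> 0 | Suc j \<Rightarrow> (\<Sum>v\<in>Y. C x v * crossings C l j X (Y - {v})))"
  using X Y x(2)
proof (induction k arbitrary: X Y)
  case 0
  then show ?case using l[of X x] x(1) by (simp add: sum_distrib_right mult.assoc)
next
  case (Suc k)
  let ?c = "crossings C l"
  have fX: "finite X" and fY: "finite Y" using Suc.prems fin finite_subset by blast+
  let ?Q = "\<lambda>X Y. case k of 0 \<Rightarrow> 0 | Suc j \<Rightarrow> (\<Sum>v\<in>Y. C x v * ?c j X (Y - {v}))"
  have e: "real (Suc k) * ?c (Suc k) X Y =
      (\<Sum>u\<in>X. \<Sum>v\<in>Y. C u v * ?c k (X - {u}) (Y - {v}))" for k X Y
    by (simp del: of_nat_Suc)
  have rm: "insert x X - {u} = insert x (X - {u})" if "u \<in> X" for u using that Suc.prems by auto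
  have "real (Suc k) * ?c (Suc k) (insert x X) Y
      = (\<Sum>v\<in>Y. C x v * ?c k X (Y - {v}))
        + (\<Sum>u\<in>X. \<Sum>v\<in>Y. C u v * ?c k (insert x (X - {u})) (Y - {v}))"
    using Suc.prems fX rm by (simp del: of_nat_Suc)
  also have "(\<Sum>u\<in>X. \<Sum>v\<in>Y. C u v * ?c k (insert x (X - {u})) (Y - {v}))
      = (\<Sum>u\<in>X. \<Sum>v\<in>Y. C u v * ((\<Sum>y\<in>X - {u}. A x y * ?c k (X - {u} - {y}) (Y - {v})) + ?Q (X - {u}) (Y - {v})))"
    using Suc.prems by (intro sum.cong refl arg_cong2[where f="(*)"] Suc.IH) auto
  also have "\<dots> = (\<Sum>u\<in>X. \<Sum>v\<in>Y. \<Sum>y\<in>X - {u}. C u v * (A x y * ?c k (X - {u} - {y}) (Y - {v})))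
      + (\<Sum>u\<in>X. \<Sum>v\<in>Y. C u v * ?Q (X - {u}) (Y - {v}))"
    by (simp add: distrib_left sum.distrib sum_distrib_left)
  also have "(\<Sum>u\<in>X. \<Sum>v\<in>Y. \<Sum>y\<in>X - {u}. C u v * (A x y * ?c k (X - {u} - {y}) (Y - {v})))
      = (\<Sum>u\<in>X. \<Sum>y\<in>X - {u}. \<Sum>v\<in>Y. C u v * (A x y * ?c k (X - {u} - {y}) (Y - {v})))"
    by (intro sum.cong refl sum.swap)
  also have "\<dots> = (\<Sum>y\<in>X. \<Sum>u\<in>X - {y}. \<Sum>v\<in>Y. C u v * (A x y * ?c k (X - {u} - {y}) (Y - {v})))"
    by (rule sum_swap_diff[OF fX])
  also have "\<dots> = (\<Sum>y\<in>X. A x y * (real (Suc k) * ?c (Suc k) (X - {y}) Y))"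
    unfolding e by (simp add: sum_distrib_left mult_ac Diff_insert2[symmetric] insert_commute)
  also have "(\<Sum>u\<in>X. \<Sum>v\<in>Y. C u v * ?Q (X - {u}) (Y - {v}))
      = real k * (\<Sum>v\<in>Y. C x v * ?c k X (Y - {v}))"
  proof (cases k)
    case (Suc j)
    have "(\<Sum>u\<in>X. \<Sum>v\<in>Y. C u v * ?Q (X - {u}) (Y - {v}))
        = (\<Sum>u\<in>X. \<Sum>v\<in>Y. \<Sum>v'\<in>Y - {v}. C u v * (C x v' * ?c j (X - {u}) (Y - {v} - {v'})))"
      by (simp add: Suc sum_distrib_left)
    also have "\<dots> = (\<Sum>u\<in>X. \<Sum>v'\<in>Y. \<Sum>v\<in>Y - {v'}. C u v * (C x v' * ?c j (X - {u}) (Y - {v} - {v'})))"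
      by (intro sum.cong refl sum_swap_diff[OF fY])
    also have "\<dots> = (\<Sum>v'\<in>Y. \<Sum>u\<in>X. \<Sum>v\<in>Y - {v'}. C u v * (C x v' * ?c j (X - {u}) (Y - {v} - {v'})))"
      by (rule sum.swap)
    also have "\<dots> = (\<Sum>v'\<in>Y. C x v' * (real k * ?c k X (Y - {v'})))"
      unfolding Suc e by (simp add: sum_distrib_left mult_ac Diff_insert2[symmetric] insert_commute)
    also have "\<dots> = real k * (\<Sum>v\<in>Y. C x v * ?c k X (Y - {v}))"
      by (simp add: sum_distrib_left mult_ac)
    finally show ?thesis .
  qed simp
  finally have "real (Suc k) * ?c (Suc k) (insert x X) Y =
      real (Suc k) * ((\<Sum>y\<in>X. A x y * ?c (Suc k) (X - {y}) Y) + (\<Sum>v\<in>Y. C x v * ?c k X (Y - {v})))"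
    by (simp add: algebra_simps sum_distrib_left sum.distrib del: crossings.simps)
  then show ?case by (simp del: crossings.simps of_nat_Suc)
qed

text \<open>By a Gram representation of \<open>C\<close>, the next kernel is, up to a positive
  factor, a sum over \<open>q\<close> of pullbacks of the previous one along
  \<open>(X, u) \<mapsto> X - {u}\<close>, with coefficients \<open>c X * g q u\<close>. For
  \<open>k = 0\<close> the form is a square.\<close>

lemma crossings_psd:
  assumes "finite I" "psd I C"
  shows "psd (Pow I) (crossings C l k)"
proof (induction k)
  case 0
  have "(\<Sum>X\<in>Pow I. \<Sum>Y\<in>Pow I. c X * c Y * crossings C l 0 X Y) = (\<Sum>X\<in>Pow I. c X * l X)\<^sup>2" for c
    by (simp add: power2_eq_square sum_product mult_ac)
  then show ?case unfolding psd_def by (auto simp: mult.commute)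
next
  case (Suc k)
  obtain g where g: "\<And>x y. x \<in> I \<Longrightarrow> y \<in> I \<Longrightarrow> C x y = (\<Sum>q\<in>I. g q x * g q y)"
    using gram[OF assms] by blast
  let ?c = "crossings C l k"
  let ?P = "SIGMA X : Pow I. X"
  have finP: "finite ?P" using assms(1) finite_subset by (intro finite_SigmaI) auto
  have p: "psd ?P (\<lambda>p q. ?c (fst p - {snd p}) (fst q - {snd q}))"
  proof (rule psd_push[OF Suc finP, of "\<lambda>p. fst p - {snd p}"])
    show "(\<lambda>p. fst p - {snd p}) ` ?P \<subseteq> Pow I" by auto
  qed (use assms(1) in simp)
  show ?case unfolding psd_def
  proof (intro conjI ballI allI)
    fix X Y assume "X \<in> Pow I" "Y \<in> Pow I"
    then show "crossings C l (Suc k) X Y = crossings C l (Suc k) Y X"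
      using crossings_sym[of I C X Y] psd_sym[OF assms(2)] by blast
  next
    fix c :: "'a set \<Rightarrow> real"
    have "(\<Sum>X\<in>Pow I. \<Sum>Y\<in>Pow I. c X * c Y * (\<Sum>u\<in>X. \<Sum>v\<in>Y. C u v * ?c (X - {u}) (Y - {v})))
        = (\<Sum>X\<in>Pow I. \<Sum>Y\<in>Pow I. \<Sum>u\<in>X. \<Sum>v\<in>Y. \<Sum>q\<in>I.
            (c X * g q u) * (c Y * g q v) * ?c (X - {u}) (Y - {v}))"
      unfolding sum_distrib_left
    proof (intro sum.cong refl)
      fix X Y u v assume "X \<in> Pow I" "Y \<in> Pow I" "u \<in> X" "v \<in> Y"
      then have "C u v = (\<Sum>q\<in>I. g q u * g q v)" using g by blast
      then show "c X * c Y * (C u v * ?c (X - {u}) (Y - {v})) =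
        (\<Sum>q\<in>I. (c X * g q u) * (c Y * g q v) * ?c (X - {u}) (Y - {v}))"
        by (simp add: sum_distrib_left sum_distrib_right mult_ac)
    qed
    also have "\<dots> = (\<Sum>X\<in>Pow I. \<Sum>u\<in>X. \<Sum>Y\<in>Pow I. \<Sum>v\<in>Y. \<Sum>q\<in>I.
            (c X * g q u) * (c Y * g q v) * ?c (X - {u}) (Y - {v}))"
      by (intro sum.cong refl sum.swap)
    also have "\<dots> = (\<Sum>(X, u)\<in>?P. \<Sum>(Y, v)\<in>?P. \<Sum>q\<in>I.
            (c X * g q u) * (c Y * g q v) * ?c (X - {u}) (Y - {v}))"
      using assms(1) finite_subset by (subst sum.Sigma; (subst sum.Sigma)?) auto
    also have "\<dots> = (\<Sum>p\<in>?P. \<Sum>p'\<in>?P. \<Sum>q\<in>I.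
            (c (fst p) * g q (snd p)) * (c (fst p') * g q (snd p')) * ?c (fst p - {snd p}) (fst p' - {snd p'}))"
      by (simp add: case_prod_unfold)
    also have "\<dots> = (\<Sum>q\<in>I. \<Sum>p\<in>?P. \<Sum>p'\<in>?P.
            (c (fst p) * g q (snd p)) * (c (fst p') * g q (snd p')) * ?c (fst p - {snd p}) (fst p' - {snd p'}))"
      by (subst sum.swap[of _ I], subst sum.swap[of _ I]) (rule refl)
    also have "0 \<le> \<dots>" by (intro sum_nonneg psd_form[OF p])
    finally show "0 \<le> (\<Sum>X\<in>Pow I. \<Sum>Y\<in>Pow I. c X * c Y * crossings C l (Suc k) X Y)"
      by (simp add: sum_divide_distrib[symmetric] del: of_nat_Suc)
  qed
qed

text \<open>Only the recursion of \<open>l\<close> is assumed, no graph. All positivity comes from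
  \<open>C\<close>, the weight across the mirror; the inner weight \<open>A\<close> is
  arbitrary.\<close>

locale cross_sum =
  fixes I :: "'i set" and A C :: "'i \<Rightarrow> 'i \<Rightarrow> real" and l :: "'i set \<Rightarrow> real"
  assumes fin: "finite I" and psd: "psd I C" and l_empty: "l {} = 1"
    and l_insert: "\<And>x X. X \<subseteq> I \<Longrightarrow> x \<in> I \<Longrightarrow> x \<notin> X \<Longrightarrow>
      l (insert x X) = (\<Sum>y\<in>X. A x y * l (X - {y}))"
begin

text \<open>The partition function of \<open>X\<close> in one copy of \<open>I\<close> together with
  \<open>Y\<close> in a second copy, the copies being coupled by \<open>C\<close>. There are at most
  \<open>card I\<close> crossing dimers.\<close>

definition R :: "'i set \<Rightarrow> 'i set \<Rightarrow> real" where
  "R X Y = (\<Sum>k\<le>card I. crossings C l k X Y)"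

lemma R_psd: "psd (Pow I) R"
  unfolding psd_def
proof (intro conjI ballI allI)
  fix X Y assume "X \<in> Pow I" "Y \<in> Pow I"
  then show "R X Y = R Y X"
    unfolding R_def using psd_sym[OF crossings_psd[OF fin psd]] by (intro sum.cong) auto
next
  fix c
  have "(\<Sum>X\<in>Pow I. \<Sum>Y\<in>Pow I. c X * c Y * R X Y)
      = (\<Sum>X\<in>Pow I. \<Sum>k\<le>card I. \<Sum>Y\<in>Pow I. c X * c Y * crossings C l k X Y)"
    unfolding R_def sum_distrib_left by (intro sum.cong refl sum.swap)
  also have "\<dots> = (\<Sum>k\<le>card I. \<Sum>X\<in>Pow I. \<Sum>Y\<in>Pow I. c X * c Y * crossings C l k X Y)"
    by (rule sum.swap)
  also have "0 \<le> \<dots>" by (intro sum_nonneg psd_form crossings_psd fin psd)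
  finally show "0 \<le> (\<Sum>X\<in>Pow I. \<Sum>Y\<in>Pow I. c X * c Y * R X Y)" .
qed

lemma R_sym: "X \<subseteq> I \<Longrightarrow> Y \<subseteq> I \<Longrightarrow> R X Y = R Y X"
  using psd_sym[OF R_psd] by blast

lemma R_empty: "R {} {} = 1"
proof -
  have "crossings C l k {} {} = (if k = 0 then 1 else 0)" for k
    by (cases k) (auto simp: l_empty)
  then show ?thesis unfolding R_def by simp
qed

lemma R_insert:
  assumes "X \<subseteq> I" "Y \<subseteq> I" "x \<in> I" "x \<notin> X"
  shows "R (insert x X) Y = (\<Sum>y\<in>X. A x y * R (X - {y}) Y) + (\<Sum>v\<in>Y. C x v * R X (Y - {v}))"
proof -
  let ?c = "crossings C l"
  let ?g = "\<lambda>k. case k of 0 \<Rightarrow> 0 | Suc j \<Rightarrow> (\<Sum>v\<in>Y. C x v * ?c j X (Y - {v}))"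
  have card: "card X < card I" using assms fin by (intro psubset_card_mono) auto
  have "R (insert x X) Y = (\<Sum>k\<le>card I. (\<Sum>y\<in>X. A x y * ?c k (X - {y}) Y) + ?g k)"
    unfolding R_def by (intro sum.cong refl crossings_insert[OF fin assms l_insert])
  also have "\<dots> = (\<Sum>k\<le>card I. \<Sum>y\<in>X. A x y * ?c k (X - {y}) Y) + (\<Sum>k\<le>card I. ?g k)"
    by (rule sum.distrib)
  also have "(\<Sum>k\<le>card I. \<Sum>y\<in>X. A x y * ?c k (X - {y}) Y) = (\<Sum>y\<in>X. A x y * R (X - {y}) Y)"
    unfolding R_def sum_distrib_left by (rule sum.swap)
  \<comment> \<open>The additional term involves \<open>card I\<close> crossings from
    \<open>X\<close>, which vanish because \<open>X\<close> lacks \<open>x\<close>. It compensates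
    for the index shift in the next step.\<close>
  also have "(\<Sum>k\<le>card I. ?g k) = (\<Sum>k\<le>Suc (card I). ?g k)"
    using crossings_zero[OF finite_subset[OF assms(1) fin] card] by simp
  also have "\<dots> = (\<Sum>k\<le>card I. \<Sum>v\<in>Y. C x v * ?c k X (Y - {v}))"
    by (simp only: sum.atMost_Suc_shift) simp
  also have "\<dots> = (\<Sum>v\<in>Y. C x v * R X (Y - {v}))"
    unfolding R_def sum_distrib_left by (rule sum.swap)
  finally show ?thesis .
qed

end

section \<open>Reflection positivity of the dimer model\<close>

lemma sum_product_right:
  fixes a :: "'a \<Rightarrow> real" and b :: "'b \<Rightarrow> real"
  shows "(\<Sum>x\<in>A. \<Sum>y\<in>B. a x * b y * k) = sum a A * sum b B * k"
  unfolding sum_product by (simp only: sum_distrib_right)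

section \<open>Consequences of the removal recursion\<close>

context dimer_graph
begin

text \<open>The two-point function before division by \<open>Z V\<close>. The value 0 on the
  diagonal agrees with \<open>mdd_G\<close> and lets sums run over all of \<open>V\<close>.\<close>

definition G0 :: "'a \<Rightarrow> 'a \<Rightarrow> real" where
  "G0 x y = (if x = y then 0 else Z (V - {x, y}))"

lemma G0_sym: "G0 x y = G0 y x"
  unfolding G0_def by (auto simp: insert_commute)

lemma G0_nonneg: "0 \<le> G0 x y"
  unfolding G0_def using Z_nonneg by auto

lemma G0_self [simp]: "G0 x x = 0"
  unfolding G0_def by simp

lemma Z_remove: "x \<in> V \<Longrightarrow> Z V = (\<Sum>y\<in>V. w x y * G0 x y)"
proof -
  assume x: "x \<in> V"
  have "Z (insert x (V - {x})) = (\<Sum>y\<in>V - {x}. w x y * Z (V - {x} - {y}))"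
    using x by (intro Z_insert) auto
  also have "\<dots> = (\<Sum>y\<in>V - {x}. w x y * G0 x y)"
    by (intro sum.cong refl) (auto simp: G0_def Diff_insert2[symmetric] insert_commute)
  also have "\<dots> = (\<Sum>y\<in>V. w x y * G0 x y)"
    using fin by (intro sum.mono_neutral_left) auto
  finally show ?thesis using x by (simp add: insert_absorb)
qed

lemma Z_insert2_ge:
  assumes "x \<in> V" "y \<in> V" "x \<noteq> y" "S \<subseteq> V" "x \<notin> S" "y \<notin> S"
  shows "w x y * Z S \<le> Z (insert x (insert y S))"
proof -
  have "w x y * Z (insert y S - {y}) \<le> (\<Sum>u\<in>insert y S. w x u * Z (insert y S - {u}))"
    using assms fin finite_subset nonneg Z_nonneg by (intro member_le_sum) auto
  also have "\<dots> = Z (insert x (insert y S))"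
    using assms by (intro Z_insert[symmetric]) auto
  finally show ?thesis using assms by simp
qed

text \<open>The pairs \<open>{x, f x}\<close> form a perfect matching along positive weights. The
  recursion retains at least the term of this matching, so one pair can be removed at a
  time.\<close>

lemma Z_pos_involution:
  assumes "S \<subseteq> V" "\<And>x. x \<in> S \<Longrightarrow> f x \<in> S \<and> f x \<noteq> x \<and> f (f x) = x \<and> 0 < w x (f x)"
  shows "0 < Z S"
proof -
  have "finite S" using assms(1) fin finite_subset by blast
  then show ?thesis using assms
  proof (induction S rule: finite_psubset_induct)
    case (psubset S)
    show ?case
    proof (cases "S = {}")
      case True
      then show ?thesis by (simp add: Z_empty)
    next
      case False
      then obtain x where x: "x \<in> S" by blast
      let ?T = "S - {x, f x}"
      have f: "f x \<in> S" "f x \<noteq> x" "f (f x) = x" "0 < w x (f x)" using psubset.prems x by auto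
      have "0 < Z ?T"
      proof (rule psubset.IH)
        show "?T \<subset> S" using x by auto
        show "?T \<subseteq> V" using psubset.prems by auto
        fix u assume u: "u \<in> ?T"
        then have fu: "f u \<in> S" "f u \<noteq> u" "f (f u) = u" "0 < w u (f u)" using psubset.prems by auto
        moreover have "f u \<noteq> x" using fu(3) u by auto
        moreover have "f u \<noteq> f x" using fu(3) f(3) u by (metis DiffD2 insertI1)
        ultimately show "f u \<in> ?T \<and> f u \<noteq> u \<and> f (f u) = u \<and> 0 < w u (f u)" by auto
      qed
      then have "0 < w x (f x) * Z ?T" using f by simp
      also have "\<dots> \<le> Z (insert x (insert (f x) ?T))"
        using x f(1,2,4) f(2)[symmetric] psubset.prems(1) by (intro Z_insert2_ge) auto
      also have "insert x (insert (f x) ?T) = S" using x f by auto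
      finally show ?thesis .
    qed
  qed
qed

lemma Z_image:
  assumes "S \<subseteq> V" "f ` V \<subseteq> V" "inj_on f V" "\<And>x y. x \<in> V \<Longrightarrow> y \<in> V \<Longrightarrow> w (f x) (f y) = w x y"
  shows "Z (f ` S) = Z S"
proof -
  have "finite S" using assms(1) fin finite_subset by blast
  then show ?thesis using assms(1)
  proof (induction S rule: finite_psubset_induct)
    case (psubset S)
    show ?case
    proof (cases "S = {}")
      case False
      then obtain x where x: "x \<in> S" by blast
      let ?T = "S - {x}"
      have inj: "inj_on f S" using assms(3) psubset.prems inj_on_subset by blast
      have S: "S = insert x ?T" using x by auto
      have "f ` S = insert (f x) (f ` ?T)" using x by auto
      then have "Z (f ` S) = Z (insert (f x) (f ` ?T))" by simp
      also have "\<dots> = (\<Sum>y\<in>f ` ?T. w (f x) y * Z (f ` ?T - {y}))"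
        using x psubset.prems assms(2) inj by (intro Z_insert) (auto simp: inj_on_def)
      also have "\<dots> = (\<Sum>y\<in>?T. w (f x) (f y) * Z (f ` ?T - {f y}))"
        using inj by (subst sum.reindex) (auto simp: inj_on_def)
      also have "\<dots> = (\<Sum>y\<in>?T. w x y * Z (?T - {y}))"
      proof (intro sum.cong refl)
        fix y assume y: "y \<in> ?T"
        have "f ` ?T - {f y} = f ` (?T - {y})"
          using inj_on_image_set_diff[OF inj, of ?T "{y}"] y by auto
        moreover have "Z (f ` (?T - {y})) = Z (?T - {y})"
          using x psubset.prems by (intro psubset.IH) auto
        ultimately show "w (f x) (f y) * Z (f ` ?T - {f y}) = w x y * Z (?T - {y})"
          using assms(4)[of x y] x y psubset.prems by auto
      qed
      also have "\<dots> = Z (insert x ?T)"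
        using x psubset.prems by (intro Z_insert[symmetric]) auto
      finally show ?thesis using S by simp
    qed simp
  qed
qed

lemma G0_image:
  assumes "f ` V \<subseteq> V" "inj_on f V" "\<And>x y. x \<in> V \<Longrightarrow> y \<in> V \<Longrightarrow> w (f x) (f y) = w x y"
    "x \<in> V" "y \<in> V"
  shows "G0 (f x) (f y) = G0 x y"
proof -
  have "f ` V = V" using endo_inj_surj[OF fin assms(1,2)] .
  then have "V - {f x, f y} = f ` (V - {x, y})"
    using inj_on_image_set_diff[OF assms(2), of V "{x, y}"] assms(4,5) by auto
  moreover have "f x = f y \<longleftrightarrow> x = y" using assms inj_on_eq_iff by metis
  ultimately show ?thesis unfolding G0_def using Z_image[of "V - {x, y}" f] assms by auto
qed

text \<open>A nonzero term of the recursion removes one vertex of each colour.\<close>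

lemma Z_balanced:
  assumes "S \<subseteq> V" "\<And>x y. x \<in> V \<Longrightarrow> y \<in> V \<Longrightarrow> (c x \<longleftrightarrow> c y) \<Longrightarrow> w x y = 0" "Z S \<noteq> 0"
  shows "card {x\<in>S. c x} = card {x\<in>S. \<not> c x}"
proof -
  have "finite S" using assms(1) fin finite_subset by blast
  then show ?thesis using assms(1,3)
  proof (induction S rule: finite_psubset_induct)
    case (psubset S)
    show ?case
    proof (cases "S = {}")
      case False
      then obtain x where x: "x \<in> S" by blast
      let ?T = "S - {x}"
      have S: "S = insert x ?T" using x by auto
      have "Z S = (\<Sum>y\<in>?T. w x y * Z (?T - {y}))"
        using x psubset.prems Z_insert[of x ?T] S by auto
      then obtain y where y: "y \<in> ?T" "w x y * Z (?T - {y}) \<noteq> 0"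
        using psubset.prems by (metis (no_types, lifting) sum.neutral)
      then have c: "c x \<noteq> c y" using assms(2)[of x y] x psubset.prems by auto
      let ?U = "?T - {y}"
      have IH: "card {x\<in>?U. c x} = card {x\<in>?U. \<not> c x}"
        using x y psubset.prems by (intro psubset.IH) auto
      have fS: "finite S" by fact
      have "{u\<in>S. c u} = insert (if c x then x else y) {x\<in>?U. c x}"
        "{u\<in>S. \<not> c u} = insert (if c x then y else x) {x\<in>?U. \<not> c x}"
        using x y c by auto
      then show ?thesis using IH fS x y by (simp add: card_insert_if)
    qed simp
  qed
qed

text \<open>Both \<open>V\<close> and \<open>V - {x, y}\<close> would have equally many vertices of
  each colour, which is impossible when the two removed vertices share a colour.\<close>

lemma G0_bipartite:
  assumes "\<And>x y. x \<in> V \<Longrightarrow> y \<in> V \<Longrightarrow> (c x \<longleftrightarrow> c y) \<Longrightarrow> w x y = 0" "Z V \<noteq> 0"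
    "x \<in> V" "y \<in> V" "c x \<longleftrightarrow> c y"
  shows "G0 x y = 0"
proof (rule ccontr)
  assume "G0 x y \<noteq> 0"
  then have ne: "x \<noteq> y" and "Z (V - {x, y}) \<noteq> 0" unfolding G0_def by (auto split: if_splits)
  then have 1: "card {u\<in>V - {x, y}. c u} = card {u\<in>V - {x, y}. \<not> c u}"
    using Z_balanced[of "V - {x, y}" c] assms(1) by auto
  have 2: "card {u\<in>V. c u} = card {u\<in>V. \<not> c u}"
    using Z_balanced[of V c] assms(1,2) by auto
  show False
  proof (cases "c x")
    case True
    have "{u\<in>V. c u} = insert x (insert y {u\<in>V - {x, y}. c u})"
      "{u\<in>V. \<not> c u} = {u\<in>V - {x, y}. \<not> c u}" using assms True by auto
    then show False using 1 2 fin ne by simp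
  next
    case False
    have "{u\<in>V. \<not> c u} = insert x (insert y {u\<in>V - {x, y}. \<not> c u})"
      "{u\<in>V. c u} = {u\<in>V - {x, y}. c u}" using assms False by auto
    then show False using 1 2 fin ne by simp
  qed
qed

end

text \<open>Here \<open>L\<close> is one side of the mirror, not a side length. The last assumption
  is OS-positivity of the weights.\<close>

locale reflected_graph = dimer_graph V w for V :: "'a set" and w +
  fixes \<theta> :: "'a \<Rightarrow> 'a" and L :: "'a set"
  assumes union: "V = L \<union> \<theta> ` L" and disj: "L \<inter> \<theta> ` L = {}"
    and invol: "\<And>x. x \<in> V \<Longrightarrow> \<theta> (\<theta> x) = x"
    and w_\<theta>: "\<And>x y. x \<in> V \<Longrightarrow> y \<in> V \<Longrightarrow> w (\<theta> x) (\<theta> y) = w x y"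
    and psd_w: "psd L (\<lambda>x y. w x (\<theta> y))"
begin

lemma L_sub: "L \<subseteq> V" and \<theta>L_sub: "\<theta> ` L \<subseteq> V" using union by auto

lemma finL: "finite L" using L_sub fin finite_subset by blast

lemma \<theta>_in: "x \<in> V \<Longrightarrow> \<theta> x \<in> V"
  using union invol by auto

lemma \<theta>_inj: "inj_on \<theta> V"
  by (metis inj_onI invol)

lemma \<theta>_notin: "x \<in> L \<Longrightarrow> \<theta> x \<notin> L"
  using disj by blast

lemma G0_\<theta>: "x \<in> V \<Longrightarrow> y \<in> V \<Longrightarrow> G0 (\<theta> x) (\<theta> y) = G0 x y"
  using \<theta>_in \<theta>_inj w_\<theta> by (intro G0_image) auto

abbreviation "I \<equiv> (Inl ` L \<union> Inr ` L :: ('a + 'a) set)"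
abbreviation "\<pi> \<equiv> (case_sum id id :: 'a + 'a \<Rightarrow> 'a)"

text \<open>The duplicated vertices \<open>Inr x\<close> have no edges inside the half space. They realise multiplication
  by the variable at \<open>x\<close>, which would be lost if sets of original vertices were the only states.\<close>

definition A :: "'a + 'a \<Rightarrow> 'a + 'a \<Rightarrow> real" where
  "A p q = (case p of Inr _ \<Rightarrow> 0 | Inl x \<Rightarrow> (case q of Inr _ \<Rightarrow> 0 | Inl y \<Rightarrow> w x y))"

definition C :: "'a + 'a \<Rightarrow> 'a + 'a \<Rightarrow> real" where
  "C p q = w (\<pi> p) (\<theta> (\<pi> q))"

lemma dimer_graph_A: "dimer_graph I A"
proof
  show "finite I" using finL by simp
qed (use L_sub sym nonneg in \<open>auto simp: A_def subset_iff split: sum.splits\<close>)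

lemma psd_C: "psd I C"
proof -
  have "\<pi> ` I \<subseteq> L" by auto
  then show ?thesis using psd_push[OF psd_w _ finL, of I \<pi>] finL unfolding C_def by auto
qed

sublocale H: cross_sum I A C "dimer_Z I A"
proof -
  interpret D: dimer_graph I A by (rule dimer_graph_A)
  show "cross_sum I A C (dimer_Z I A)"
    using finL psd_C D.Z_empty D.Z_insert by unfold_locales auto
qed

lemma Inl_diff: "Inl ` X - {Inl x} = (Inl ` (X - {x}) :: ('a + 'a) set)"
  by auto

text \<open>Both sides obey the same recursion: a vertex of \<open>X\<close> is joined inside
  \<open>L\<close> with weight \<open>w\<close>, or across the mirror to \<open>\<theta> v\<close>
  with weight \<open>C\<close>. When \<open>X\<close> is empty, a vertex of the reflected side is
  removed instead, using invariance of \<open>w\<close> under \<open>\<theta>\<close> and symmetry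
  of \<open>H.R\<close>.\<close>

lemma Z_split:
  assumes "X \<subseteq> L" "Y \<subseteq> L"
  shows "Z (X \<union> \<theta> ` Y) = H.R (Inl ` X) (Inl ` Y)"
  using assms
proof (induction "card X + card Y" arbitrary: X Y rule: less_induct)
  case less
  have fX: "finite X" and fY: "finite Y" using less.prems finL finite_subset by blast+
  have injY: "inj_on \<theta> Y" using \<theta>_inj less.prems L_sub inj_on_subset by (metis subset_trans)
  have \<theta>Y_diff: "\<theta> ` Y - {\<theta> v} = \<theta> ` (Y - {v})" if "v \<in> Y" for v
    using inj_on_image_set_diff[OF injY, of Y "{v}"] that by auto
  consider "X = {}" "Y = {}" | x where "x \<in> X" | y where "X = {}" "y \<in> Y" by blast
  then show ?case
  proof cases
    case 1
    then show ?thesis by (simp add: Z_empty H.R_empty)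
  next
    case (2 x)
    let ?X = "X - {x}"
    have X: "X = insert x ?X" using 2 by auto
    have xL: "x \<in> L" using 2 less.prems by auto
    have d: "?X \<inter> \<theta> ` Y = {}" "x \<notin> \<theta> ` Y" using disj less.prems xL by auto
    have lt: "card ?X < card X" using 2 fX by (metis card_Diff1_less)
    have "Z (X \<union> \<theta> ` Y) = Z (insert x (?X \<union> \<theta> ` Y))" using 2 by (intro arg_cong[of _ _ Z]) auto
    also have "\<dots> = (\<Sum>y\<in>?X \<union> \<theta> ` Y. w x y * Z (?X \<union> \<theta> ` Y - {y}))"
      using less.prems L_sub \<theta>_in xL d by (intro Z_insert) (auto simp: subset_iff)
    also have "\<dots> = (\<Sum>y\<in>?X. w x y * Z (?X \<union> \<theta> ` Y - {y})) + (\<Sum>y\<in>\<theta> ` Y. w x y * Z (?X \<union> \<theta> ` Y - {y}))"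
      using fX fY d by (intro sum.union_disjoint) auto
    also have "(\<Sum>y\<in>?X. w x y * Z (?X \<union> \<theta> ` Y - {y})) = (\<Sum>y\<in>?X. w x y * H.R (Inl ` (?X - {y})) (Inl ` Y))"
    proof (intro sum.cong refl arg_cong2[where f="(*)"])
      fix y assume y: "y \<in> ?X"
      have "?X \<union> \<theta> ` Y - {y} = (?X - {y}) \<union> \<theta> ` Y" using y d by auto
      moreover have "card (?X - {y}) \<le> card ?X" using fX by (intro card_mono) auto
      ultimately show "Z (?X \<union> \<theta> ` Y - {y}) = H.R (Inl ` (?X - {y})) (Inl ` Y)"
        using lt less.prems by (simp only:) (intro less.hyps, auto)
    qed
    also have "(\<Sum>y\<in>\<theta> ` Y. w x y * Z (?X \<union> \<theta> ` Y - {y})) =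
        (\<Sum>v\<in>Y. w x (\<theta> v) * Z (?X \<union> \<theta> ` Y - {\<theta> v}))"
      using injY by (subst sum.reindex) (auto simp: inj_on_def)
    also have "\<dots> = (\<Sum>v\<in>Y. w x (\<theta> v) * H.R (Inl ` ?X) (Inl ` (Y - {v})))"
    proof (intro sum.cong refl arg_cong2[where f="(*)"])
      fix v assume v: "v \<in> Y"
      have "?X \<union> \<theta> ` Y - {\<theta> v} = ?X \<union> \<theta> ` (Y - {v})" using v d \<theta>Y_diff[OF v] by auto
      moreover have "card (Y - {v}) \<le> card Y" using fY by (intro card_mono) auto
      ultimately show "Z (?X \<union> \<theta> ` Y - {\<theta> v}) = H.R (Inl ` ?X) (Inl ` (Y - {v}))"
        using lt less.prems by (simp only:) (intro less.hyps, auto)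
    qed
    also have "(\<Sum>y\<in>?X. w x y * H.R (Inl ` (?X - {y})) (Inl ` Y)) +
        (\<Sum>v\<in>Y. w x (\<theta> v) * H.R (Inl ` ?X) (Inl ` (Y - {v}))) =
        (\<Sum>q\<in>Inl ` ?X. A (Inl x) q * H.R (Inl ` ?X - {q}) (Inl ` Y)) +
        (\<Sum>q\<in>Inl ` Y. C (Inl x) q * H.R (Inl ` ?X) (Inl ` Y - {q}))"
      by (simp add: sum.reindex A_def C_def Inl_diff)
    also have "\<dots> = H.R (insert (Inl x) (Inl ` ?X)) (Inl ` Y)"
      using less.prems xL by (intro H.R_insert[symmetric]) auto
    also have "insert (Inl x) (Inl ` ?X) = Inl ` X" using 2 by auto
    finally show ?thesis .
  next
    case (3 y)
    let ?Y = "Y - {y}"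
    have yL: "y \<in> L" using 3 less.prems by auto
    have lt: "card ?Y < card Y" using 3 fY by (metis card_Diff1_less)
    have inj': "inj_on \<theta> ?Y" using injY inj_on_subset by blast
    have "\<theta> ` Y = insert (\<theta> y) (\<theta> ` ?Y)" using 3 by auto
    then have "Z (X \<union> \<theta> ` Y) = Z (insert (\<theta> y) (\<theta> ` ?Y))" using 3 by simp
    also have "\<dots> = (\<Sum>v\<in>\<theta> ` ?Y. w (\<theta> y) v * Z (\<theta> ` ?Y - {v}))"
    proof (rule Z_insert)
      show "\<theta> y \<notin> \<theta> ` ?Y" using injY 3 by (auto simp: inj_on_def)
    qed (use less.prems \<theta>L_sub yL in auto)
    also have "\<dots> = (\<Sum>v\<in>?Y. w (\<theta> y) (\<theta> v) * Z (\<theta> ` ?Y - {\<theta> v}))"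
      using inj' by (simp add: sum.reindex)
    also have "\<dots> = (\<Sum>v\<in>?Y. w y v * H.R (Inl ` {}) (Inl ` (?Y - {v})))"
    proof (intro sum.cong refl arg_cong2[where f="(*)"])
      fix v assume v: "v \<in> ?Y"
      show "w (\<theta> y) (\<theta> v) = w y v" using v yL less.prems L_sub by (intro w_\<theta>) auto
      have "\<theta> ` ?Y - {\<theta> v} = \<theta> ` (?Y - {v})"
        using inj_on_image_set_diff[OF inj', of ?Y "{v}"] v by auto
      moreover have "card (?Y - {v}) \<le> card ?Y" using fY by (intro card_mono) auto
      moreover have "Z ({} \<union> \<theta> ` (?Y - {v})) = H.R (Inl ` {}) (Inl ` (?Y - {v}))"
        if "card (?Y - {v}) \<le> card ?Y"
        using lt less.prems that by (intro less.hyps) auto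
      ultimately show "Z (\<theta> ` ?Y - {\<theta> v}) = H.R (Inl ` {}) (Inl ` (?Y - {v}))" by simp
    qed
    also have "\<dots> = (\<Sum>v\<in>?Y. w y v * H.R (Inl ` (?Y - {v})) {})"
    proof (intro sum.cong refl)
      fix v
      have "Inl ` (?Y - {v}) \<subseteq> I" using less.prems by auto
      then have "H.R {} (Inl ` (?Y - {v})) = H.R (Inl ` (?Y - {v})) {}" by (intro H.R_sym) auto
      then show "w y v * H.R (Inl ` {}) (Inl ` (?Y - {v})) = w y v * H.R (Inl ` (?Y - {v})) {}" by simp
    qed
    also have "\<dots> = (\<Sum>q\<in>Inl ` ?Y. A (Inl y) q * H.R (Inl ` ?Y - {q}) {})"
      by (simp add: sum.reindex A_def Inl_diff)
    also have "\<dots> = H.R (insert (Inl y) (Inl ` ?Y)) {}"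
    proof -
      have "Inl ` ?Y \<subseteq> I" "Inl y \<in> I" "Inl y \<notin> Inl ` ?Y" using less.prems yL by auto
      from H.R_insert[OF this(1) empty_subsetI this(2,3)] show ?thesis by simp
    qed
    also have "insert (Inl y) (Inl ` ?Y) = Inl ` Y" using 3 by auto
    also have "H.R (Inl ` Y) {} = H.R (Inl ` X) (Inl ` Y)"
      using 3 less.prems H.R_sym[of "Inl ` Y" "{}"] by auto
    finally show ?thesis .
  qed
qed

lemma G0_split:
  assumes "x \<in> L" "y \<in> L"
  shows "G0 x (\<theta> y) = H.R (Inl ` (L - {x})) (Inl ` (L - {y}))"
proof -
  have "x \<noteq> \<theta> y" using assms \<theta>_notin by auto
  moreover have "V - {x, \<theta> y} = (L - {x}) \<union> \<theta> ` (L - {y})"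
    using assms disj inj_on_image_set_diff[OF inj_on_subset[OF \<theta>_inj L_sub], of L "{y}"]
    unfolding union by auto
  ultimately show ?thesis unfolding G0_def using Z_split[of "L - {x}" "L - {y}"] by auto
qed

text \<open>Removing \<open>x\<close> and \<open>\<theta> y\<close> from \<open>V\<close> leaves
  \<open>L - {x}\<close> and the image of \<open>L - {y}\<close>, so this kernel is the pullback of
  \<open>H.R\<close> along \<open>x \<mapsto> L - {x}\<close>.\<close>

lemma psd_G0: "psd L (\<lambda>x y. G0 x (\<theta> y))"
proof -
  have "(\<lambda>x. Inl ` (L - {x})) ` L \<subseteq> Pow I" by auto
  then have "psd L (\<lambda>x y. H.R (Inl ` (L - {x})) (Inl ` (L - {y})))"
    using psd_push[OF H.R_psd finL, of "\<lambda>x. Inl ` (L - {x})"] finL by auto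
  then show ?thesis using psd_cong[of L] G0_split by (metis (no_types, lifting))
qed

text \<open>The test vector is \<open>\<Sum>x. s x \<cdot> (insert the duplicate of x) - \<Sum>x. p x \<cdot> (remove x)\<close>.\<close>

lemma reflection_positivity:
  fixes s p :: "'a \<Rightarrow> real"
  defines "r \<equiv> \<lambda>u. \<Sum>y\<in>L. w u (\<theta> y) * s y"
  shows "0 \<le> Z V * (\<Sum>x\<in>L. s x * r x) + (\<Sum>u\<in>L. \<Sum>v\<in>L. r u * r v * G0 u (\<theta> v))
    - 2 * (\<Sum>u\<in>L. \<Sum>v\<in>L. p u * r v * G0 (\<theta> u) (\<theta> v)) + (\<Sum>u\<in>L. \<Sum>v\<in>L. p u * p v * G0 u (\<theta> v))"
proof -
  define X :: "'a + 'a \<Rightarrow> ('a + 'a) set" where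
    "X = case_sum (\<lambda>x. Inl ` (L - {x})) (\<lambda>x. insert (Inr x) (Inl ` L))"
  define c where "c = case_sum (\<lambda>x. - p x) s"
  have wsym: "w u (\<theta> v) = w v (\<theta> u)" if "u \<in> L" "v \<in> L" for u v
    using psd_sym[OF psd_w that] .
  have Z_R: "H.R (Inl ` L) (Inl ` (L - {x} - {y})) = G0 (\<theta> x) (\<theta> y)"
    if "x \<in> L" "y \<in> L - {x}" for x y
  proof -
    have "\<theta> x \<noteq> \<theta> y" using that \<theta>_inj L_sub by (auto simp: inj_on_def subset_iff)
    moreover have "V - {\<theta> x, \<theta> y} = L \<union> \<theta> ` (L - {x} - {y})"
      using that disj inj_on_image_set_diff[OF inj_on_subset[OF \<theta>_inj L_sub], of L "{x, y}"]
      unfolding union by (auto simp: Diff_insert2[symmetric])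
    ultimately show ?thesis unfolding G0_def using Z_split[of L "L - {x} - {y}"] by (simp add: subset_iff)
  qed
  have X1: "H.R (X (Inl x)) (X (Inl y)) = G0 x (\<theta> y)" if "x \<in> L" "y \<in> L" for x y
    using G0_split[OF that] by (simp add: X_def)
  \<comment> \<open>The duplicate of \<open>x\<close> can only be joined across the mirror, to some
    \<open>\<theta> v\<close> with \<open>v \<noteq> y\<close>. Both missing vertices of
    \<open>V\<close> then lie on the reflected side.\<close>
  have X2: "H.R (X (Inr x)) (X (Inl y)) = (\<Sum>v\<in>L. w x (\<theta> v) * G0 (\<theta> y) (\<theta> v))"
    if "x \<in> L" "y \<in> L" for x y
  proof -
    have "H.R (X (Inr x)) (X (Inl y)) = (\<Sum>q\<in>Inl ` L. A (Inr x) q * H.R (Inl ` L - {q}) (Inl ` (L - {y})))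
        + (\<Sum>q\<in>Inl ` (L - {y}). C (Inr x) q * H.R (Inl ` L) (Inl ` (L - {y}) - {q}))"
      unfolding X_def sum.case using that by (intro H.R_insert) auto
    also have "\<dots> = (\<Sum>v\<in>L - {y}. w x (\<theta> v) * H.R (Inl ` L) (Inl ` (L - {y} - {v})))"
      by (simp add: A_def C_def sum.reindex Inl_diff)
    also have "\<dots> = (\<Sum>v\<in>L - {y}. w x (\<theta> v) * G0 (\<theta> y) (\<theta> v))"
      using Z_R that by (intro sum.cong) auto
    also have "\<dots> = (\<Sum>v\<in>L. w x (\<theta> v) * G0 (\<theta> y) (\<theta> v))"
      using finL by (intro sum.mono_neutral_left) auto
    finally show ?thesis .
  qed
  have X3: "H.R (X (Inl y)) (X (Inr x)) = (\<Sum>v\<in>L. w x (\<theta> v) * G0 (\<theta> y) (\<theta> v))"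
    if "x \<in> L" "y \<in> L" for x y
  proof -
    have "X (Inl y) \<subseteq> I" "X (Inr x) \<subseteq> I" using that by (auto simp: X_def)
    then show ?thesis using X2[OF that] H.R_sym by simp
  qed
  \<comment> \<open>Either the two duplicates are joined to each other, which leaves all of
    \<open>V\<close>, or each is joined to an original vertex across the mirror, which leaves
    \<open>V\<close> without these two.\<close>
  have X4: "H.R (X (Inr x)) (X (Inr y)) = w x (\<theta> y) * Z V
      + (\<Sum>v\<in>L. \<Sum>u\<in>L. w x (\<theta> v) * (w y (\<theta> u) * G0 u (\<theta> v)))"
    if "x \<in> L" "y \<in> L" for x y
  proof -
    have "H.R (X (Inr x)) (X (Inr y)) = (\<Sum>q\<in>Inl ` L. A (Inr x) q * H.R (Inl ` L - {q}) (insert (Inr y) (Inl ` L)))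
        + (\<Sum>q\<in>insert (Inr y) (Inl ` L). C (Inr x) q * H.R (Inl ` L) (insert (Inr y) (Inl ` L) - {q}))"
      unfolding X_def sum.case using that by (intro H.R_insert) auto
    also have "(\<Sum>q\<in>Inl ` L. A (Inr x) q * H.R (Inl ` L - {q}) (insert (Inr y) (Inl ` L))) = 0"
      by (simp add: A_def sum.reindex)
    also have "(\<Sum>q\<in>insert (Inr y) (Inl ` L). C (Inr x) q * H.R (Inl ` L) (insert (Inr y) (Inl ` L) - {q}))
        = w x (\<theta> y) * H.R (Inl ` L) (Inl ` L)
          + (\<Sum>v\<in>L. w x (\<theta> v) * H.R (Inl ` L) (insert (Inr y) (Inl ` L) - {Inl v}))"
    proof -
      have "Inr y \<notin> Inl ` L" "insert (Inr y) (Inl ` L) - {Inr y} = Inl ` L" by auto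
      then show ?thesis using finL by (simp add: sum.reindex C_def)
    qed
    also have "H.R (Inl ` L) (Inl ` L) = Z V" using Z_split[of L L] union by simp
    also have "(\<Sum>v\<in>L. w x (\<theta> v) * H.R (Inl ` L) (insert (Inr y) (Inl ` L) - {Inl v}))
        = (\<Sum>v\<in>L. \<Sum>u\<in>L. w x (\<theta> v) * (w y (\<theta> u) * G0 u (\<theta> v)))"
    proof (intro sum.cong refl)
      fix v assume v: "v \<in> L"
      have "insert (Inr y) (Inl ` L) - {Inl v} = insert (Inr y) (Inl ` (L - {v}))" by auto
      then have "H.R (Inl ` L) (insert (Inr y) (Inl ` L) - {Inl v})
          = H.R (insert (Inr y) (Inl ` (L - {v}))) (Inl ` L)"
        using that by (subst H.R_sym) auto
      also have "\<dots> = (\<Sum>q\<in>Inl ` (L - {v}). A (Inr y) q * H.R (Inl ` (L - {v}) - {q}) (Inl ` L))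
        + (\<Sum>q\<in>Inl ` L. C (Inr y) q * H.R (Inl ` (L - {v})) (Inl ` L - {q}))"
        using that by (intro H.R_insert) auto
      also have "\<dots> = (\<Sum>u\<in>L. w y (\<theta> u) * H.R (Inl ` (L - {v})) (Inl ` (L - {u})))"
        by (simp add: A_def C_def sum.reindex Inl_diff)
      also have "\<dots> = (\<Sum>u\<in>L. w y (\<theta> u) * G0 u (\<theta> v))"
        using G0_split[OF v] psd_sym[OF psd_G0] v by (intro sum.cong refl) auto
      finally show "w x (\<theta> v) * H.R (Inl ` L) (insert (Inr y) (Inl ` L) - {Inl v})
        = (\<Sum>u\<in>L. w x (\<theta> v) * (w y (\<theta> u) * G0 u (\<theta> v)))"
        by (simp add: sum_distrib_left)
    qed
    finally show ?thesis by simp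
  qed
  have sumI: "sum f I = (\<Sum>x\<in>L. f (Inl x)) + (\<Sum>x\<in>L. f (Inr x))" for f :: "'a + 'a \<Rightarrow> real"
    using finL by (subst sum.union_disjoint) (auto simp: sum.reindex)
  have "X ` I \<subseteq> Pow I" by (auto simp: X_def)
  then have "psd I (\<lambda>q q'. H.R (X q) (X q'))" using finL by (intro psd_push[OF H.R_psd]) auto
  from psd_form[OF this, of c]
  have "0 \<le> (\<Sum>x\<in>L. \<Sum>y\<in>L. p x * p y * G0 x (\<theta> y))
      + (\<Sum>x\<in>L. \<Sum>y\<in>L. - p x * s y * (\<Sum>v\<in>L. w y (\<theta> v) * G0 (\<theta> x) (\<theta> v)))
      + ((\<Sum>x\<in>L. \<Sum>y\<in>L. - s x * p y * (\<Sum>v\<in>L. w x (\<theta> v) * G0 (\<theta> y) (\<theta> v)))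
      + (\<Sum>x\<in>L. \<Sum>y\<in>L. s x * s y * (w x (\<theta> y) * Z V
          + (\<Sum>v\<in>L. \<Sum>u\<in>L. w x (\<theta> v) * (w y (\<theta> u) * G0 u (\<theta> v))))))"
    unfolding sumI by (simp add: X1 X2 X3 X4 c_def sum.distrib cong: sum.cong)
  also have "(\<Sum>x\<in>L. \<Sum>y\<in>L. - s x * p y * (\<Sum>v\<in>L. w x (\<theta> v) * G0 (\<theta> y) (\<theta> v)))
      = (\<Sum>x\<in>L. \<Sum>y\<in>L. - p x * s y * (\<Sum>v\<in>L. w y (\<theta> v) * G0 (\<theta> x) (\<theta> v)))"
    by (subst sum.swap) (simp add: mult_ac)
  also have "(\<Sum>x\<in>L. \<Sum>y\<in>L. - p x * s y * (\<Sum>v\<in>L. w y (\<theta> v) * G0 (\<theta> x) (\<theta> v)))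
      = - (\<Sum>x\<in>L. \<Sum>v\<in>L. p x * r v * G0 (\<theta> x) (\<theta> v))"
  proof -
    have "(\<Sum>y\<in>L. - p x * s y * (\<Sum>v\<in>L. w y (\<theta> v) * G0 (\<theta> x) (\<theta> v)))
        = - (\<Sum>v\<in>L. p x * r v * G0 (\<theta> x) (\<theta> v))" for x
    proof -
      have "(\<Sum>y\<in>L. - p x * s y * (\<Sum>v\<in>L. w y (\<theta> v) * G0 (\<theta> x) (\<theta> v)))
          = (\<Sum>y\<in>L. \<Sum>v\<in>L. - p x * (w y (\<theta> v) * s y) * G0 (\<theta> x) (\<theta> v))"
        by (simp add: sum_distrib_left mult_ac)
      also have "\<dots> = (\<Sum>v\<in>L. \<Sum>y\<in>L. - p x * (w v (\<theta> y) * s y) * G0 (\<theta> x) (\<theta> v))"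
        by (subst sum.swap) (intro sum.cong refl, simp add: wsym)
      also have "\<dots> = - (\<Sum>v\<in>L. p x * r v * G0 (\<theta> x) (\<theta> v))"
        by (simp add: r_def sum_distrib_left sum_distrib_right sum_negf mult_ac)
      finally show ?thesis .
    qed
    then show ?thesis by (simp add: sum_negf)
  qed
  also have "(\<Sum>x\<in>L. \<Sum>y\<in>L. s x * s y * (w x (\<theta> y) * Z V
          + (\<Sum>v\<in>L. \<Sum>u\<in>L. w x (\<theta> v) * (w y (\<theta> u) * G0 u (\<theta> v)))))
      = Z V * (\<Sum>x\<in>L. s x * r x) + (\<Sum>u\<in>L. \<Sum>v\<in>L. r u * r v * G0 u (\<theta> v))"
  proof -
    have "(\<Sum>x\<in>L. \<Sum>y\<in>L. s x * s y * (w x (\<theta> y) * Z V)) = Z V * (\<Sum>x\<in>L. s x * r x)"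
      by (simp add: r_def sum_distrib_left mult_ac)
    moreover have "(\<Sum>x\<in>L. \<Sum>y\<in>L. s x * s y * (\<Sum>v\<in>L. \<Sum>u\<in>L. w x (\<theta> v) * (w y (\<theta> u) * G0 u (\<theta> v))))
        = (\<Sum>u\<in>L. \<Sum>v\<in>L. r u * r v * G0 u (\<theta> v))"
    proof -
      have "(\<Sum>x\<in>L. \<Sum>y\<in>L. s x * s y * (\<Sum>v\<in>L. \<Sum>u\<in>L. w x (\<theta> v) * (w y (\<theta> u) * G0 u (\<theta> v))))
          = (\<Sum>x\<in>L. \<Sum>y\<in>L. \<Sum>v\<in>L. \<Sum>u\<in>L. (w x (\<theta> v) * s x) * (w y (\<theta> u) * s y) * G0 u (\<theta> v))"
        by (simp add: sum_distrib_left mult_ac)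
      also have "\<dots> = (\<Sum>x\<in>L. \<Sum>v\<in>L. \<Sum>u\<in>L. \<Sum>y\<in>L. (w x (\<theta> v) * s x) * (w y (\<theta> u) * s y) * G0 u (\<theta> v))"
        by (subst sum.swap, subst (2) sum.swap) (rule refl)
      also have "\<dots> = (\<Sum>v\<in>L. \<Sum>u\<in>L. \<Sum>x\<in>L. \<Sum>y\<in>L. (w x (\<theta> v) * s x) * (w y (\<theta> u) * s y) * G0 u (\<theta> v))"
        by (subst sum.swap, subst (2) sum.swap) (rule refl)
      also have "\<dots> = (\<Sum>v\<in>L. \<Sum>u\<in>L. r v * r u * G0 u (\<theta> v))"
      proof (intro sum.cong refl)
        fix v u assume vu: "v \<in> L" "u \<in> L"
        have "r v = (\<Sum>x\<in>L. w x (\<theta> v) * s x)" "r u = (\<Sum>y\<in>L. w y (\<theta> u) * s y)"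
          unfolding r_def using wsym vu by (auto intro!: sum.cong)
        then show "(\<Sum>x\<in>L. \<Sum>y\<in>L. (w x (\<theta> v) * s x) * (w y (\<theta> u) * s y) * G0 u (\<theta> v)) = r v * r u * G0 u (\<theta> v)"
          by (simp only: sum_product_right)
      qed
      also have "\<dots> = (\<Sum>u\<in>L. \<Sum>v\<in>L. r u * r v * G0 u (\<theta> v))"
        by (subst sum.swap) (simp add: mult_ac)
      finally show ?thesis .
    qed
    ultimately show ?thesis by (simp add: distrib_left sum.distrib)
  qed
  finally show ?thesis by simp
qed

end

section \<open>Gaussian domination\<close>

definition quad :: "'a set \<Rightarrow> ('a \<Rightarrow> 'a \<Rightarrow> real) \<Rightarrow> ('a \<Rightarrow> real) \<Rightarrow> real" where
  "quad V K h = (\<Sum>x\<in>V. \<Sum>y\<in>V. K x y * h x * h y)"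

definition reflects :: "'a set \<Rightarrow> ('a \<Rightarrow> 'a) \<Rightarrow> 'a set \<Rightarrow> bool" where
  "reflects V \<theta> L \<longleftrightarrow> V = L \<union> \<theta> ` L \<and> L \<inter> \<theta> ` L = {} \<and> (\<forall>x\<in>V. \<theta> (\<theta> x) = x)"

lemma sum_reflects:
  assumes "reflects V \<theta> L" "finite V"
  shows "sum f V = (\<Sum>x\<in>L. f x + f (\<theta> x) :: real)"
proof -
  have V: "V = L \<union> \<theta> ` L" "L \<inter> \<theta> ` L = {}" "\<And>x. x \<in> V \<Longrightarrow> \<theta> (\<theta> x) = x"
    using assms(1) unfolding reflects_def by auto
  have inj: "inj_on \<theta> L" using V by (metis UnI1 inj_onI)
  have "finite L" using assms(2) V(1) by auto
  then have "sum f V = sum f L + sum f (\<theta> ` L)" using V(1,2) by (subst V(1), intro sum.union_disjoint) auto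
  then show ?thesis using inj by (simp add: sum.reindex sum.distrib)
qed

text \<open>The two folded functions copy one half of \<open>h\<close> onto the other. Terms within
  a half agree on both sides; across the mirror, the products of \<open>h\<close> with its own half
  replace the mixed ones, and the difference is the form in the jumps
  \<open>h x - h (\<theta> x)\<close>.\<close>

lemma quad_fold:
  assumes r: "reflects V \<theta> L" and fin: "finite V"
    and inv: "\<And>x y. x \<in> V \<Longrightarrow> y \<in> V \<Longrightarrow> K (\<theta> x) (\<theta> y) = K x y"
  shows "quad V K (\<lambda>x. if x \<in> L then h x else h (\<theta> x)) + quad V K (\<lambda>x. if x \<in> L then h (\<theta> x) else h x)
    = 2 * quad V K h + 2 * (\<Sum>x\<in>L. \<Sum>y\<in>L. K x (\<theta> y) * (h x - h (\<theta> x)) * (h y - h (\<theta> y)))"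
    (is "quad V K ?a + quad V K ?b = _ + 2 * ?s")
proof -
  have V: "V = L \<union> \<theta> ` L" "L \<inter> \<theta> ` L = {}" "\<And>x. x \<in> V \<Longrightarrow> \<theta> (\<theta> x) = x"
    using r unfolding reflects_def by auto
  have split: "quad V K g = (\<Sum>x\<in>L. \<Sum>y\<in>L. K x y * (g x * g y + g (\<theta> x) * g (\<theta> y))
      + K x (\<theta> y) * (g x * g (\<theta> y) + g (\<theta> x) * g y))" for g
    unfolding quad_def sum_reflects[OF r fin] sum.distrib[symmetric]
  proof (intro sum.cong refl)
    fix x y assume xy: "x \<in> L" "y \<in> L"
    then have "x \<in> V" "y \<in> V" "\<theta> x \<in> V" "\<theta> y \<in> V" using V(1) by auto
    then have "K (\<theta> x) (\<theta> y) = K x y" "K (\<theta> x) y = K x (\<theta> y)"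
      using inv[of x y] inv[of x "\<theta> y"] V(3) by auto
    then show "K x y * g x * g y + K x (\<theta> y) * g x * g (\<theta> y) + (K (\<theta> x) y * g (\<theta> x) * g y
        + K (\<theta> x) (\<theta> y) * g (\<theta> x) * g (\<theta> y))
        = K x y * (g x * g y + g (\<theta> x) * g (\<theta> y)) + K x (\<theta> y) * (g x * g (\<theta> y) + g (\<theta> x) * g y)"
      by (simp add: algebra_simps)
  qed
  show ?thesis
    unfolding split sum.distrib[symmetric] sum_distrib_left
  proof (intro sum.cong refl)
    fix x y assume xy: "x \<in> L" "y \<in> L"
    then have t: "\<theta> x \<notin> L" "\<theta> y \<notin> L" "\<theta> (\<theta> x) = x" "\<theta> (\<theta> y) = y" using V by auto
    show "K x y * (?a x * ?a y + ?a (\<theta> x) * ?a (\<theta> y)) + K x (\<theta> y) * (?a x * ?a (\<theta> y) + ?a (\<theta> x) * ?a y)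
       + (K x y * (?b x * ?b y + ?b (\<theta> x) * ?b (\<theta> y)) + K x (\<theta> y) * (?b x * ?b (\<theta> y) + ?b (\<theta> x) * ?b y))
       = 2 * (K x y * (h x * h y + h (\<theta> x) * h (\<theta> y)) + K x (\<theta> y) * (h x * h (\<theta> y) + h (\<theta> x) * h y))
        + 2 * (K x (\<theta> y) * (h x - h (\<theta> x)) * (h y - h (\<theta> y)))"
      by (simp only: xy t if_True if_False simp_thms) algebra
  qed
qed

lemma quad_cong: "(\<And>x. x \<in> V \<Longrightarrow> g x = h x) \<Longrightarrow> quad V K g = quad V K h"
  unfolding quad_def by (auto intro!: sum.cong)

lemma quad_add: "quad V (\<lambda>x y. K x y + e * N x y) h = quad V K h + e * quad V N h"
  unfolding quad_def by (simp add: algebra_simps sum.distrib sum_distrib_left)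

text \<open>Adding a small multiple of \<open>N\<close> makes every reflection that meets a discontinuity of \<open>h\<close> a
  strict improvement, so a maximiser among the functions with values in a fixed finite set is
  constant.\<close>

lemma quad_nonpos:
  assumes fin: "finite V" and ne: "V \<noteq> {}"
    and r: "\<And>j. j \<in> J \<Longrightarrow> reflects V (\<theta> j) (L j)"
    and inv: "\<And>j x y. j \<in> J \<Longrightarrow> x \<in> V \<Longrightarrow> y \<in> V \<Longrightarrow> K (\<theta> j x) (\<theta> j y) = K x y"
      "\<And>j x y. j \<in> J \<Longrightarrow> x \<in> V \<Longrightarrow> y \<in> V \<Longrightarrow> N (\<theta> j x) (\<theta> j y) = N x y"
    and pos: "\<And>j s. j \<in> J \<Longrightarrow> 0 \<le> (\<Sum>x\<in>L j. \<Sum>y\<in>L j. K x (\<theta> j y) * s x * s y)"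
    and strict: "\<And>h :: 'a \<Rightarrow> real. (\<exists>x\<in>V. \<exists>y\<in>V. h x \<noteq> h y) \<Longrightarrow>
      \<exists>j\<in>J. 0 < (\<Sum>x\<in>L j. \<Sum>y\<in>L j. N x (\<theta> j y) * (h x - h (\<theta> j x)) * (h y - h (\<theta> j y)))"
    and row: "\<And>x. x \<in> V \<Longrightarrow> (\<Sum>y\<in>V. K x y) = 0"
  shows "quad V K h \<le> 0"
proof -
  define S where "S = h ` V"
  have finS: "finite S" using fin by (simp add: S_def)
  define F where "F = (V \<rightarrow>\<^sub>E S)"
  have finF: "finite F" unfolding F_def by (intro finite_PiE fin finS)
  have hF: "restrict h V \<in> F" unfolding F_def S_def by auto
  define M where "M = Max (abs ` S)"
  \<comment> \<open>Bounds the form of \<open>N\<close> on every constant function with value in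
    \<open>S\<close>, uniformly in \<open>e\<close>.\<close>
  define B where "B = M\<^sup>2 * \<bar>\<Sum>x\<in>V. \<Sum>y\<in>V. N x y\<bar>"
  have main: "quad V K h \<le> e * (B - quad V N h)" if e: "0 < e" for e
  proof -
    define \<Phi> where "\<Phi> = (\<lambda>g. quad V (\<lambda>x y. K x y + e * N x y) g)"
    obtain g where g: "g \<in> F" "\<And>f. f \<in> F \<Longrightarrow> \<Phi> f \<le> \<Phi> g"
    proof -
      have "Max (\<Phi> ` F) \<in> \<Phi> ` F" using finF hF by (intro Max_in) auto
      then obtain g where "g \<in> F" "\<Phi> g = Max (\<Phi> ` F)" by auto
      then show ?thesis using that finF by auto
    qed
    have const: "g x = g y" if "x \<in> V" "y \<in> V" for x y
    proof (rule ccontr)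
      assume "g x \<noteq> g y"
      then have "\<exists>x\<in>V. \<exists>y\<in>V. g x \<noteq> g y" using that by blast
      from strict[OF this] obtain j where j: "j \<in> J" and
        st: "0 < (\<Sum>x\<in>L j. \<Sum>y\<in>L j. N x (\<theta> j y) * (g x - g (\<theta> j x)) * (g y - g (\<theta> j y)))"
        by blast
      let ?s = "\<lambda>x. g x - g (\<theta> j x)"
      let ?a = "\<lambda>x. if x \<in> L j then g x else g (\<theta> j x)"
      let ?b = "\<lambda>x. if x \<in> L j then g (\<theta> j x) else g x"
      have \<theta>: "\<theta> j x \<in> V" if "x \<in> V" for x using r[OF j] that unfolding reflects_def by auto
      have "\<Phi> ?a + \<Phi> ?b = 2 * \<Phi> g + 2 * (\<Sum>x\<in>L j. \<Sum>y\<in>L j. (K x (\<theta> j y) + e * N x (\<theta> j y)) * ?s x * ?s y)"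
        unfolding \<Phi>_def using inv[OF j] by (intro quad_fold r j fin) auto
      also have "(\<Sum>x\<in>L j. \<Sum>y\<in>L j. (K x (\<theta> j y) + e * N x (\<theta> j y)) * ?s x * ?s y)
         = (\<Sum>x\<in>L j. \<Sum>y\<in>L j. K x (\<theta> j y) * ?s x * ?s y) + e * (\<Sum>x\<in>L j. \<Sum>y\<in>L j. N x (\<theta> j y) * ?s x * ?s y)"
        by (simp add: distrib_right sum.distrib sum_distrib_left mult.assoc)
      finally have eq: "\<Phi> ?a + \<Phi> ?b = 2 * \<Phi> g + 2 * \<dots>" .
      have "0 < (\<Sum>x\<in>L j. \<Sum>y\<in>L j. K x (\<theta> j y) * ?s x * ?s y) + e * (\<Sum>x\<in>L j. \<Sum>y\<in>L j. N x (\<theta> j y) * ?s x * ?s y)"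
        using pos[OF j, of ?s] st e by (intro add_nonneg_pos) auto
      then have gt: "\<Phi> ?a + \<Phi> ?b > 2 * \<Phi> g" unfolding eq by simp
      have "\<Phi> (restrict ?a V) \<le> \<Phi> g" "\<Phi> (restrict ?b V) \<le> \<Phi> g"
        using g(1) \<theta> unfolding F_def by (auto intro!: g(2) simp: F_def PiE_iff)
      moreover have "\<Phi> (restrict ?a V) = \<Phi> ?a" "\<Phi> (restrict ?b V) = \<Phi> ?b"
        unfolding \<Phi>_def by (intro quad_cong; simp)+
      ultimately show False using gt by linarith
    qed
    obtain v where v: "v \<in> V" using ne by blast
    have gc: "quad V K g = 0"
    proof -
      have "quad V K g = (\<Sum>x\<in>V. \<Sum>y\<in>V. K x y * (g v * g v))"
        unfolding quad_def by (intro sum.cong refl) (use const[OF _ v] in auto)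
      then show ?thesis using row by (simp add: sum_distrib_right[symmetric])
    qed
    have "quad V N g = (g v)\<^sup>2 * (\<Sum>x\<in>V. \<Sum>y\<in>V. N x y)"
    proof -
      have "quad V N g = (\<Sum>x\<in>V. \<Sum>y\<in>V. N x y * (g v * g v))"
        unfolding quad_def by (intro sum.cong refl) (use const[OF _ v] in auto)
      then show ?thesis by (simp add: sum_distrib_left power2_eq_square mult_ac)
    qed
    also have "\<dots> \<le> (g v)\<^sup>2 * \<bar>\<Sum>x\<in>V. \<Sum>y\<in>V. N x y\<bar>" by (intro mult_left_mono) auto
    also have "\<dots> \<le> B" unfolding B_def
    proof (intro mult_right_mono)
      have "g v \<in> S" using g(1) v unfolding F_def by auto
      then have "\<bar>g v\<bar> \<le> M" unfolding M_def using finS by auto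
      then show "(g v)\<^sup>2 \<le> M\<^sup>2" by (rule abs_le_square_iff[THEN iffD1, OF order_trans]) auto
    qed auto
    finally have "\<Phi> g \<le> e * B" unfolding \<Phi>_def quad_add using gc e by simp
    moreover have "\<Phi> (restrict h V) = \<Phi> h" unfolding \<Phi>_def by (intro quad_cong) auto
    ultimately have "\<Phi> h \<le> e * B" using g(2)[OF hF] by linarith
    then show ?thesis unfolding \<Phi>_def quad_add by (simp add: algebra_simps)
  qed
  show ?thesis
  proof (rule ccontr)
    assume "\<not> ?thesis"
    then have q: "0 < quad V K h" by simp
    \<comment> \<open>This carries out the limit of small \<open>e\<close>: with
      \<open>e = quad V K h / (2 * T)\<close> the inequality \<open>main\<close> would bound a
      positive number by its half.\<close>
    define T where "T = \<bar>B - quad V N h\<bar> + 1"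
    have T: "0 < T" unfolding T_def by linarith
    have "quad V K h \<le> quad V K h / (2 * T) * (B - quad V N h)" using q T by (intro main) auto
    also have "\<dots> \<le> quad V K h / (2 * T) * T" using q T by (intro mult_left_mono) (auto simp: T_def)
    also have "\<dots> = quad V K h / 2" using T by simp
    finally show False using q by simp
  qed
qed

section \<open>The quadratic form of Gaussian domination\<close>

context dimer_graph
begin

definition D :: "'a \<Rightarrow> 'a \<Rightarrow> real" where "D x y = of_bool (x = y) - w x y"

text \<open>As matrices, \<open>D G0 D - Z D\<close> with \<open>D = 1 - w\<close>. On a joint
  eigenfunction with eigenvalues \<open>a\<close> of \<open>D\<close> and \<open>b\<close> of
  \<open>G0\<close>, nonpositivity of the form reads \<open>a\<^sup>2 * b \<le> Z V * a\<close>; for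
  \<open>a > 0\<close> this is the infrared bound before normalisation.\<close>

definition K :: "'a \<Rightarrow> 'a \<Rightarrow> real" where
  "K x y = (\<Sum>u\<in>V. \<Sum>v\<in>V. D x u * G0 u v * D v y) - Z V * D x y"

lemma K_row:
  assumes "\<And>x. x \<in> V \<Longrightarrow> (\<Sum>y\<in>V. w x y) = 1" "x \<in> V"
  shows "(\<Sum>y\<in>V. K x y) = 0"
proof -
  have d: "(\<Sum>y\<in>V. D v y) = 0" if "v \<in> V" for v
    using assms(1)[OF that] that fin unfolding D_def by (simp add: sum_subtractf of_bool_def)
  have "(\<Sum>y\<in>V. \<Sum>u\<in>V. \<Sum>v\<in>V. D x u * G0 u v * D v y) = (\<Sum>u\<in>V. \<Sum>y\<in>V. \<Sum>v\<in>V. D x u * G0 u v * D v y)"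
    by (rule sum.swap)
  also have "\<dots> = (\<Sum>u\<in>V. \<Sum>v\<in>V. \<Sum>y\<in>V. D x u * G0 u v * D v y)"
    by (intro sum.cong refl sum.swap)
  also have "\<dots> = 0" using d by (simp add: sum_distrib_left[symmetric])
  finally show ?thesis using d[OF assms(2)]
    unfolding K_def by (simp add: sum_subtractf sum_distrib_left[symmetric])
qed

lemma quad_K:
  assumes "\<And>x. x \<in> V \<Longrightarrow> (\<Sum>y\<in>V. D x y * h y) = a * h x"
    and "\<And>x. x \<in> V \<Longrightarrow> (\<Sum>y\<in>V. G0 x y * h y) = b * h x"
  shows "quad V K h = (a\<^sup>2 * b - Z V * a) * (\<Sum>x\<in>V. (h x)\<^sup>2)"
proof -
  have Kh: "(\<Sum>y\<in>V. K x y * h y) = (a\<^sup>2 * b - Z V * a) * h x" if x: "x \<in> V" for x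
  proof -
    have "(\<Sum>y\<in>V. K x y * h y) = (\<Sum>y\<in>V. \<Sum>u\<in>V. \<Sum>v\<in>V. D x u * G0 u v * (D v y * h y)) - Z V * (\<Sum>y\<in>V. D x y * h y)"
    proof -
      have "K x y * h y = (\<Sum>u\<in>V. \<Sum>v\<in>V. D x u * G0 u v * (D v y * h y)) - Z V * (D x y * h y)" for y
        by (simp add: K_def left_diff_distrib sum_distrib_right mult.assoc)
      then show ?thesis by (simp add: sum_subtractf sum_distrib_left)
    qed
    also have "(\<Sum>y\<in>V. \<Sum>u\<in>V. \<Sum>v\<in>V. D x u * G0 u v * (D v y * h y))
        = (\<Sum>u\<in>V. \<Sum>y\<in>V. \<Sum>v\<in>V. D x u * G0 u v * (D v y * h y))"
      by (rule sum.swap)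
    also have "\<dots> = (\<Sum>u\<in>V. \<Sum>v\<in>V. \<Sum>y\<in>V. D x u * G0 u v * (D v y * h y))"
      by (intro sum.cong refl sum.swap)
    also have "\<dots> = (\<Sum>u\<in>V. \<Sum>v\<in>V. D x u * G0 u v * (a * h v))"
      by (simp add: sum_distrib_left[symmetric] assms(1))
    also have "\<dots> = (\<Sum>u\<in>V. D x u * a * (\<Sum>v\<in>V. G0 u v * h v))"
      by (simp add: sum_distrib_left mult_ac)
    also have "\<dots> = (\<Sum>u\<in>V. D x u * a * (b * h u))" by (simp add: assms(2))
    also have "\<dots> = a * b * (\<Sum>u\<in>V. D x u * h u)" by (simp add: sum_distrib_left mult_ac)
    finally show ?thesis using assms(1)[OF x] by (simp add: algebra_simps power2_eq_square)
  qed
  have "quad V K h = (\<Sum>x\<in>V. h x * (\<Sum>y\<in>V. K x y * h y))"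
    unfolding quad_def by (simp add: sum_distrib_left mult_ac)
  also have "\<dots> = (\<Sum>x\<in>V. (a\<^sup>2 * b - Z V * a) * (h x)\<^sup>2)"
  proof (intro sum.cong refl)
    fix x assume x: "x \<in> V"
    show "h x * (\<Sum>y\<in>V. K x y * h y) = (a\<^sup>2 * b - Z V * a) * (h x)\<^sup>2"
      unfolding Kh[OF x] by algebra
  qed
  finally show ?thesis by (simp add: sum_distrib_left)
qed

end

context reflected_graph
begin

lemma reflects: "reflects V \<theta> L"
  unfolding reflects_def using union disj invol by blast

lemma D_\<theta>: "x \<in> V \<Longrightarrow> y \<in> V \<Longrightarrow> D (\<theta> x) (\<theta> y) = D x y"
  unfolding D_def using w_\<theta> \<theta>_inj by (auto simp: inj_on_def)

lemma K_\<theta>: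
  assumes "x \<in> V" "y \<in> V"
  shows "K (\<theta> x) (\<theta> y) = K x y"
proof -
  have bij: "bij_betw \<theta> V V"
    by (rule bij_betw_byWitness[where f' = \<theta>]) (use invol \<theta>_in in auto)
  have "(\<Sum>u\<in>V. \<Sum>v\<in>V. D (\<theta> x) u * G0 u v * D v (\<theta> y))
      = (\<Sum>u\<in>V. \<Sum>v\<in>V. D (\<theta> x) (\<theta> u) * G0 (\<theta> u) v * D v (\<theta> y))"
    by (rule sum.reindex_bij_betw[OF bij, symmetric])
  also have "\<dots> = (\<Sum>u\<in>V. \<Sum>v\<in>V. D (\<theta> x) (\<theta> u) * G0 (\<theta> u) (\<theta> v) * D (\<theta> v) (\<theta> y))"
    by (intro sum.cong refl sum.reindex_bij_betw[OF bij, symmetric])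
  also have "\<dots> = (\<Sum>u\<in>V. \<Sum>v\<in>V. D x u * G0 u v * D v y)"
    using assms by (simp add: D_\<theta> G0_\<theta>)
  finally show ?thesis unfolding K_def using assms by (simp add: D_\<theta>)
qed

text \<open>Applying \<open>D\<close> to a function \<open>s\<close> living on one side gives
  \<open>p\<close> on that side and \<open>-r\<close> on the other. Hence the form across the mirror
  is exactly the one shown to be nonnegative in \<open>reflection_positivity\<close>.\<close>

lemma K_cross_nonneg: "0 \<le> (\<Sum>x\<in>L. \<Sum>y\<in>L. K x (\<theta> y) * s x * s y)"
proof -
  define r where "r = (\<lambda>u. \<Sum>y\<in>L. w u (\<theta> y) * s y)"
  define p where "p = (\<lambda>u. \<Sum>x\<in>L. s x * D x u)"
  have LV: "x \<in> V" "\<theta> x \<in> V" if "x \<in> L" for x using that L_sub \<theta>_in by auto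
  have f0: "(\<Sum>x\<in>L. s x * D x u) = p u" for u
    unfolding p_def by simp
  have f1: "(\<Sum>x\<in>L. s x * D x (\<theta> u)) = - r u" if "u \<in> L" for u
  proof -
    have "s x * D x (\<theta> u) = - (w u (\<theta> x) * s x)" if "x \<in> L" for x
      using psd_sym[OF psd_w that \<open>u \<in> L\<close>] \<theta>_notin[OF \<open>u \<in> L\<close>] that by (auto simp: D_def)
    then show ?thesis unfolding r_def by (simp add: sum_negf)
  qed
  have f2: "(\<Sum>y\<in>L. D v (\<theta> y) * s y) = - r v" if "v \<in> L" for v
  proof -
    have "D v (\<theta> x) * s x = - (w v (\<theta> x) * s x)" if "x \<in> L" for x
      using \<theta>_notin that \<open>v \<in> L\<close> by (auto simp: D_def)
    then show ?thesis unfolding r_def by (simp add: sum_negf)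
  qed
  have f3: "(\<Sum>y\<in>L. D (\<theta> v) (\<theta> y) * s y) = p v" if "v \<in> L" for v
    unfolding p_def
  proof (intro sum.cong refl)
    fix y assume y: "y \<in> L"
    have "D (\<theta> v) (\<theta> y) = D v y" using LV that y by (intro D_\<theta>) auto
    also have "\<dots> = D y v" using sym[of v y] LV that y by (simp add: D_def eq_commute)
    finally show "D (\<theta> v) (\<theta> y) * s y = s y * D y v" by simp
  qed
  have "(\<Sum>x\<in>L. \<Sum>y\<in>L. (\<Sum>u\<in>V. \<Sum>v\<in>V. D x u * G0 u v * D v (\<theta> y)) * s x * s y)
      = (\<Sum>x\<in>L. \<Sum>y\<in>L. \<Sum>u\<in>V. \<Sum>v\<in>V. (s x * D x u) * (D v (\<theta> y) * s y) * G0 u v)"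
    by (simp add: sum_distrib_left sum_distrib_right mult_ac)
  also have "\<dots> = (\<Sum>x\<in>L. \<Sum>u\<in>V. \<Sum>y\<in>L. \<Sum>v\<in>V. (s x * D x u) * (D v (\<theta> y) * s y) * G0 u v)"
    by (intro sum.cong refl sum.swap)
  also have "\<dots> = (\<Sum>u\<in>V. \<Sum>x\<in>L. \<Sum>y\<in>L. \<Sum>v\<in>V. (s x * D x u) * (D v (\<theta> y) * s y) * G0 u v)"
    by (rule sum.swap)
  also have "\<dots> = (\<Sum>u\<in>V. \<Sum>x\<in>L. \<Sum>v\<in>V. \<Sum>y\<in>L. (s x * D x u) * (D v (\<theta> y) * s y) * G0 u v)"
    by (intro sum.cong refl sum.swap)
  also have "\<dots> = (\<Sum>u\<in>V. \<Sum>v\<in>V. \<Sum>x\<in>L. \<Sum>y\<in>L. (s x * D x u) * (D v (\<theta> y) * s y) * G0 u v)"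
    by (intro sum.cong refl sum.swap)
  also have "\<dots> = (\<Sum>u\<in>V. \<Sum>v\<in>V. (\<Sum>x\<in>L. s x * D x u) * (\<Sum>y\<in>L. D v (\<theta> y) * s y) * G0 u v)"
    by (simp only: sum_product_right)
  \<comment> \<open>The last bracket is antisymmetric under exchanging \<open>u\<close> and
    \<open>v\<close> and sums to zero. It merges the two mixed terms into one with factor 2.\<close>
  also have "\<dots> = (\<Sum>u\<in>L. \<Sum>v\<in>L. r u * r v * G0 u (\<theta> v) - 2 * (p u * r v * G0 (\<theta> u) (\<theta> v)) + p u * p v * G0 u (\<theta> v)
       + (p u * r v * G0 (\<theta> u) (\<theta> v) - p v * r u * G0 (\<theta> v) (\<theta> u)))"
    unfolding sum_reflects[OF reflects fin] sum.distrib[symmetric]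
  proof (intro sum.cong refl)
    fix u v assume uv: "u \<in> L" "v \<in> L"
    have g: "G0 u v = G0 (\<theta> u) (\<theta> v)" "G0 (\<theta> u) v = G0 u (\<theta> v)" "G0 (\<theta> v) (\<theta> u) = G0 (\<theta> u) (\<theta> v)"
      using G0_\<theta>[of u v] G0_\<theta>[of u "\<theta> v"] invol LV uv G0_sym by auto
    show "(\<Sum>x\<in>L. s x * D x u) * (\<Sum>y\<in>L. D v (\<theta> y) * s y) * G0 u v +
        (\<Sum>x\<in>L. s x * D x u) * (\<Sum>y\<in>L. D (\<theta> v) (\<theta> y) * s y) * G0 u (\<theta> v) +
        ((\<Sum>x\<in>L. s x * D x (\<theta> u)) * (\<Sum>y\<in>L. D v (\<theta> y) * s y) * G0 (\<theta> u) v +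
         (\<Sum>x\<in>L. s x * D x (\<theta> u)) * (\<Sum>y\<in>L. D (\<theta> v) (\<theta> y) * s y) * G0 (\<theta> u) (\<theta> v)) =
        r u * r v * G0 u (\<theta> v) - 2 * (p u * r v * G0 (\<theta> u) (\<theta> v)) + p u * p v * G0 u (\<theta> v)
       + (p u * r v * G0 (\<theta> u) (\<theta> v) - p v * r u * G0 (\<theta> v) (\<theta> u))"
      unfolding f1[OF uv(1)] f2[OF uv(2)] f3[OF uv(2)] unfolding f0 g
      by (simp add: algebra_simps)
  qed
  also have "\<dots> = (\<Sum>u\<in>L. \<Sum>v\<in>L. r u * r v * G0 u (\<theta> v)) - 2 * (\<Sum>u\<in>L. \<Sum>v\<in>L. p u * r v * G0 (\<theta> u) (\<theta> v))
      + (\<Sum>u\<in>L. \<Sum>v\<in>L. p u * p v * G0 u (\<theta> v))"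
  proof -
    have "(\<Sum>u\<in>L. \<Sum>v\<in>L. p v * r u * G0 (\<theta> v) (\<theta> u)) = (\<Sum>u\<in>L. \<Sum>v\<in>L. p u * r v * G0 (\<theta> u) (\<theta> v))"
      by (rule sum.swap)
    then show ?thesis by (simp only: sum.distrib sum_subtractf sum_distrib_left[symmetric])
  qed
  finally have 1: "(\<Sum>x\<in>L. \<Sum>y\<in>L. (\<Sum>u\<in>V. \<Sum>v\<in>V. D x u * G0 u v * D v (\<theta> y)) * s x * s y) = \<dots>" .
  have 2: "(\<Sum>x\<in>L. \<Sum>y\<in>L. Z V * D x (\<theta> y) * s x * s y) = - (Z V * (\<Sum>x\<in>L. s x * r x))"
  proof -
    have "(\<Sum>x\<in>L. \<Sum>y\<in>L. Z V * D x (\<theta> y) * s x * s y) = Z V * (\<Sum>x\<in>L. s x * (\<Sum>y\<in>L. D x (\<theta> y) * s y))"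
      by (simp add: sum_distrib_left mult_ac)
    then show ?thesis by (simp add: f2 sum_negf)
  qed
  have "(\<Sum>x\<in>L. \<Sum>y\<in>L. K x (\<theta> y) * s x * s y) =
      (\<Sum>x\<in>L. \<Sum>y\<in>L. (\<Sum>u\<in>V. \<Sum>v\<in>V. D x u * G0 u v * D v (\<theta> y)) * s x * s y)
      - (\<Sum>x\<in>L. \<Sum>y\<in>L. Z V * D x (\<theta> y) * s x * s y)"
    unfolding K_def by (simp add: left_diff_distrib sum_subtractf)
  then show ?thesis using reflection_positivity[of s p] unfolding 1 2 r_def by simp
qed

end

section \<open>Loops of the double-dimer model\<close>

lemma measure_point_measure_finite:
  assumes "finite \<Omega>" "A \<subseteq> \<Omega>" "\<And>i. i \<in> \<Omega> \<Longrightarrow> 0 \<le> p i"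
  shows "measure (point_measure \<Omega> (\<lambda>i. ennreal (p i))) A = sum p A"
proof -
  have "emeasure (point_measure \<Omega> (\<lambda>i. ennreal (p i))) A = (\<Sum>i\<in>A. ennreal (p i))"
    by (rule emeasure_point_measure_finite[OF assms(1,2)])
  also have "\<dots> = ennreal (sum p A)" using assms by (intro sum_ennreal) auto
  finally show ?thesis unfolding measure_def using assms by (simp add: sum_nonneg subset_iff)
qed

section \<open>Reduction of the double-dimer model to pairs of dimer coverings\<close>

context dimer_graph
begin

abbreviation "cw \<equiv> cover_weight V w"
abbreviation "full \<equiv> covers V w V \<times> covers V w V"

lemma finite_full: "finite full"
  using finite_covers by simp

lemma finite_dimer_pairs: "finite (dimer_pairs V w)"
  unfolding dimer_pairs_def by (intro finite_cartesian_product finite_PiE finite_edges) auto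

lemma prod_edges: "(\<Prod>e\<in>E. edge_weight w e ^ (m1 e + m2 e)) = cw m1 * cw m2"
  unfolding cover_weight_def by (simp add: power_add prod.distrib)

lemma mdd_weight_zero:
  assumes "\<forall>x\<in>V. w x x = 0" "finite U" "U \<subseteq> V" "x \<in> U" "deg m1 x = 0"
  shows "mdd_weight V w U (m1, m2) = 0"
proof -
  have "(\<Prod>x\<in>U. w x x ^ (1 - deg m1 x)) = 0"
    using assms by (intro prod_zero bexI[of _ x]) auto
  then show ?thesis unfolding mdd_weight_def by simp
qed

lemma mdd_weight_covers:
  assumes "\<And>x. x \<in> U \<Longrightarrow> deg m1 x = 1"
  shows "mdd_weight V w U (m1, m2) = cw m1 * cw m2"
  using assms unfolding mdd_weight_def by (simp add: prod_edges)

text \<open>A monomer at \<open>x\<close> costs the factor \<open>w x x = 0\<close>, so only pairs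
  of full coverings carry weight. The function \<open>f\<close> allows one statement for the
  normalisation, for probabilities and for expectations.\<close>

lemma mdd_sum:
  assumes "\<forall>x\<in>V. w x x = 0"
  shows "(\<Sum>\<omega>\<in>mdd_configs V w. mdd_weight V w V \<omega> * f \<omega>) = (\<Sum>\<omega>\<in>full. cw (fst \<omega>) * cw (snd \<omega>) * f \<omega>)"
proof -
  have sub: "full \<subseteq> mdd_configs V w"
    unfolding covers_def mdd_configs_def dimer_pairs_def by auto
  have fin': "finite (mdd_configs V w)"
    by (rule finite_subset[OF _ finite_dimer_pairs]) (auto simp: mdd_configs_def)
  have "mdd_weight V w V \<omega> = 0" if \<omega>: "\<omega> \<in> mdd_configs V w - full" for \<omega>
  proof -
    obtain m1 m2 where m: "\<omega> = (m1, m2)" by (cases \<omega>)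
    have c: "m1 \<in> E \<rightarrow>\<^sub>E {0, 1}" "m2 \<in> E \<rightarrow>\<^sub>E {0, 1}"
      "\<And>x. x \<in> V \<Longrightarrow> deg m1 x = deg m2 x" "\<And>x. x \<in> V \<Longrightarrow> deg m1 x \<in> {0, 1}"
      using \<omega> unfolding m mdd_configs_def dimer_pairs_def by auto
    have "\<exists>x\<in>V. deg m1 x = 0"
    proof (rule ccontr)
      assume n: "\<not> (\<exists>x\<in>V. deg m1 x = 0)"
      have "deg m1 x = 1" if "x \<in> V" for x using c(4)[OF that] n that by auto
      then have "m1 \<in> covers V w V" "m2 \<in> covers V w V" unfolding covers_def using c by auto
      then show False using \<omega> m by auto
    qed
    then show ?thesis using mdd_weight_zero[OF assms fin] m by auto
  qed
  then have "(\<Sum>\<omega>\<in>mdd_configs V w. mdd_weight V w V \<omega> * f \<omega>) = (\<Sum>\<omega>\<in>full. mdd_weight V w V \<omega> * f \<omega>)"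
    using sub fin' by (intro sum.mono_neutral_right) auto
  also have "\<dots> = (\<Sum>\<omega>\<in>full. cw (fst \<omega>) * cw (snd \<omega>) * f \<omega>)"
  proof (intro sum.cong refl)
    fix \<omega> assume "\<omega> \<in> full"
    then show "mdd_weight V w V \<omega> * f \<omega> = cw (fst \<omega>) * cw (snd \<omega>) * f \<omega>"
      using mdd_weight_covers[of V "fst \<omega>" "snd \<omega>"] by (auto simp: covers_def)
  qed
  finally show ?thesis .
qed

lemma mdd_Z_eq:
  assumes "\<forall>x\<in>V. w x x = 0"
  shows "mdd_Z V w = (Z V)\<^sup>2"
proof -
  have "mdd_Z V w = (\<Sum>\<omega>\<in>full. cw (fst \<omega>) * cw (snd \<omega>))"
    using mdd_sum[OF assms, of "\<lambda>_. 1"] unfolding mdd_Z_def by simp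
  also have "\<dots> = (\<Sum>m1\<in>covers V w V. \<Sum>m2\<in>covers V w V. cw m1 * cw m2)"
    by (simp add: sum.cartesian_product case_prod_unfold)
  also have "\<dots> = (Z V)\<^sup>2" unfolding dimer_Z_def by (simp add: power2_eq_square sum_product)
  finally show ?thesis .
qed

text \<open>The first copy covers \<open>V - {x, y}\<close> and the second all of \<open>V\<close>;
  the numerator factorises, and one of the two factors \<open>Z V\<close> of the normalisation
  cancels.\<close>

lemma mdd_G_eq:
  assumes "\<forall>x\<in>V. w x x = 0" "x \<in> V" "y \<in> V"
  shows "mdd_G V w x y = G0 x y / Z V"
proof (cases "x = y")
  case False
  let ?U = "V - {x, y}"
  let ?A = "covers V w ?U \<times> covers V w V"
  have sub: "?A \<subseteq> mdd_configs2 V w x y"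
    using assms unfolding covers_def mdd_configs2_def dimer_pairs_def by auto
  have fin': "finite (mdd_configs2 V w x y)"
    by (rule finite_subset[OF _ finite_dimer_pairs]) (auto simp: mdd_configs2_def)
  have "mdd_weight V w ?U \<omega> = 0" if \<omega>: "\<omega> \<in> mdd_configs2 V w x y - ?A" for \<omega>
  proof -
    obtain m1 m2 where m: "\<omega> = (m1, m2)" by (cases \<omega>)
    have c: "m1 \<in> E \<rightarrow>\<^sub>E {0, 1}" "m2 \<in> E \<rightarrow>\<^sub>E {0, 1}"
      "\<forall>x\<in>?U. deg m1 x = deg m2 x \<and> deg m1 x \<in> {0, 1}"
      "deg m1 x = 0" "deg m1 y = 0" "deg m2 x = 1" "deg m2 y = 1"
      using \<omega>[THEN DiffD1] unfolding m mdd_configs2_def dimer_pairs_def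
      by (simp only: mem_Collect_eq case_prod_conv mem_Times_iff fst_conv snd_conv, blast)+
    have "\<exists>x\<in>?U. deg m1 x = 0"
    proof (rule ccontr)
      assume n: "\<not> (\<exists>x\<in>?U. deg m1 x = 0)"
      have d: "deg m1 z = 1" if "z \<in> ?U" for z using bspec[OF c(3) that] n that by blast
      have "m1 \<in> covers V w ?U" unfolding covers_def using c(1,4,5) d by auto
      moreover have "deg m2 z = 1" if "z \<in> V" for z
        using d[of z] c(3,6,7) that by (cases "z = x \<or> z = y") auto
      then have "m2 \<in> covers V w V" unfolding covers_def using c(2) by auto
      ultimately show False using \<omega> m by auto
    qed
    then show ?thesis using mdd_weight_zero[OF assms(1), of ?U] fin m by auto
  qed
  then have "(\<Sum>\<omega>\<in>mdd_configs2 V w x y. mdd_weight V w ?U \<omega>) = (\<Sum>\<omega>\<in>?A. mdd_weight V w ?U \<omega>)"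
    using sub fin' by (intro sum.mono_neutral_right) auto
  also have "\<dots> = (\<Sum>\<omega>\<in>?A. cw (fst \<omega>) * cw (snd \<omega>))"
  proof (intro sum.cong refl)
    fix \<omega> assume "\<omega> \<in> ?A"
    then show "mdd_weight V w ?U \<omega> = cw (fst \<omega>) * cw (snd \<omega>)"
      using mdd_weight_covers[of ?U "fst \<omega>" "snd \<omega>"] by (auto simp: covers_def)
  qed
  also have "\<dots> = (\<Sum>m1\<in>covers V w ?U. \<Sum>m2\<in>covers V w V. cw m1 * cw m2)"
    by (simp add: sum.cartesian_product case_prod_unfold)
  also have "\<dots> = Z ?U * Z V" unfolding dimer_Z_def by (simp add: sum_product)
  finally show ?thesis using False unfolding mdd_G_def mdd_Z_eq[OF assms(1)] G0_def
    by (simp add: power2_eq_square)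
qed (simp add: mdd_G_def)

definition visits :: "'a \<Rightarrow> 'a \<Rightarrow> real" where
  "visits x y = (\<Sum>\<omega> | \<omega> \<in> full \<and> y \<in> loop_vertices V w x \<omega>. cw (fst \<omega>) * cw (snd \<omega>))"

lemma mdd_weight_nonneg: "U \<subseteq> V \<Longrightarrow> 0 \<le> mdd_weight V w U \<omega>"
  unfolding mdd_weight_def case_prod_unfold
  by (intro mult_nonneg_nonneg prod_nonneg zero_le_power ballI nonneg less_imp_le[OF edge_weight_pos]) auto

lemma prob_visit:
  assumes "\<forall>x\<in>V. w x x = 0"
  shows "measure (mdd_measure V w) {\<omega> \<in> space (mdd_measure V w). y \<in> loop_vertices V w x \<omega>}
    = visits x y / (Z V)\<^sup>2"
proof -
  have fin': "finite (mdd_configs V w)"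
    by (rule finite_subset[OF _ finite_dimer_pairs]) (auto simp: mdd_configs_def)
  have "measure (mdd_measure V w) {\<omega> \<in> space (mdd_measure V w). y \<in> loop_vertices V w x \<omega>}
      = (\<Sum>\<omega> | \<omega> \<in> mdd_configs V w \<and> y \<in> loop_vertices V w x \<omega>. mdd_weight V w V \<omega> / mdd_Z V w)"
    unfolding mdd_measure_def space_point_measure mdd_Z_eq[OF assms]
    using fin' mdd_weight_nonneg by (intro measure_point_measure_finite) auto
  also have "\<dots> = (\<Sum>\<omega>\<in>mdd_configs V w. mdd_weight V w V \<omega> * of_bool (y \<in> loop_vertices V w x \<omega>)) / (Z V)\<^sup>2"
    using fin' by (simp add: mdd_Z_eq[OF assms] sum_divide_distrib[symmetric] of_bool_def if_distrib sum.If_cases Int_def cong: if_cong)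
  also have "(\<Sum>\<omega>\<in>mdd_configs V w. mdd_weight V w V \<omega> * of_bool (y \<in> loop_vertices V w x \<omega>)) = visits x y"
    unfolding mdd_sum[OF assms] visits_def
    using finite_full by (simp add: of_bool_def if_distrib sum.If_cases Int_def cong: if_cong)
  finally show ?thesis .
qed

lemma expected_length:
  assumes "\<forall>x\<in>V. w x x = 0"
  shows "(\<integral>\<omega>. real (loop_length V w x \<omega>) \<partial>mdd_measure V w)
    = (\<Sum>\<omega>\<in>full. cw (fst \<omega>) * cw (snd \<omega>) * real (loop_length V w x \<omega>)) / (Z V)\<^sup>2"
proof -
  have fin': "finite (mdd_configs V w)"
    by (rule finite_subset[OF _ finite_dimer_pairs]) (auto simp: mdd_configs_def)
  have "(\<integral>\<omega>. real (loop_length V w x \<omega>) \<partial>mdd_measure V w) =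
      (\<Sum>\<omega>\<in>mdd_configs V w. (mdd_weight V w V \<omega> / mdd_Z V w) *\<^sub>R real (loop_length V w x \<omega>))"
    unfolding mdd_measure_def mdd_Z_eq[OF assms]
    using fin' mdd_weight_nonneg by (intro lebesgue_integral_point_measure_finite) auto
  also have "\<dots> = (\<Sum>\<omega>\<in>mdd_configs V w. mdd_weight V w V \<omega> * real (loop_length V w x \<omega>)) / (Z V)\<^sup>2"
    by (simp add: mdd_Z_eq[OF assms] sum_divide_distrib)
  finally show ?thesis unfolding mdd_sum[OF assms] .
qed

section \<open>Connected components of the union of two coverings\<close>

definition comp :: "('a set \<Rightarrow> nat) \<Rightarrow> 'a \<Rightarrow> 'a set" where
  "comp f x = {(u, v). {u, v} \<in> E \<and> 0 < f {u, v}}\<^sup>* `` {x}"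

definition closed_under :: "('a set \<Rightarrow> nat) \<Rightarrow> 'a set \<Rightarrow> bool" where
  "closed_under f S \<longleftrightarrow> (\<forall>u v. u \<in> S \<longrightarrow> {u, v} \<in> E \<longrightarrow> 0 < f {u, v} \<longrightarrow> v \<in> S)"

lemma loop_vertices_eq: "loop_vertices V w x (m1, m2) = comp (\<lambda>e. m1 e + m2 e) x"
  unfolding loop_vertices_def comp_def by simp

lemma comp_self: "x \<in> comp f x"
  unfolding comp_def by auto

lemma comp_closed: "closed_under f (comp f x)"
  unfolding closed_under_def
proof (intro allI impI)
  fix u v assume u: "u \<in> comp f x" and uv: "{u, v} \<in> E" "0 < f {u, v}"
  have "(x, u) \<in> {(u, v). {u, v} \<in> E \<and> 0 < f {u, v}}\<^sup>*" using u unfolding comp_def by simp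
  moreover have "(u, v) \<in> {(u, v). {u, v} \<in> E \<and> 0 < f {u, v}}" using uv by simp
  ultimately show "v \<in> comp f x" unfolding comp_def Image_singleton_iff
    by (rule rtrancl_into_rtrancl)
qed

lemma comp_minimal:
  assumes "closed_under f T" "x \<in> T"
  shows "comp f x \<subseteq> T"
proof
  fix y assume "y \<in> comp f x"
  then have "(x, y) \<in> {(u, v). {u, v} \<in> E \<and> 0 < f {u, v}}\<^sup>*" unfolding comp_def by auto
  then show "y \<in> T"
    by induction (use assms in \<open>auto simp: closed_under_def\<close>)
qed

lemma comp_sub: "x \<in> V \<Longrightarrow> comp f x \<subseteq> V"
  by (rule comp_minimal) (use edge_in in \<open>unfold closed_under_def, blast+\<close>)

lemma closed_edge:
  assumes "closed_under f S" "e \<in> E" "f e \<noteq> 0"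
  shows "e \<subseteq> S \<or> e \<inter> S = {}"
proof -
  obtain u v where "e = {u, v}" using edgeE[OF assms(2)] by metis
  moreover have "{v, u} = {u, v}" by auto
  ultimately show ?thesis using assms unfolding closed_under_def by (metis (no_types) Int_insert_left_if0 Int_empty_left empty_subsetI gr0I insert_subset)
qed

lemma deg_edges: "deg m v = (\<Sum>e | e \<in> E \<and> v \<in> e. m e)"
proof -
  have "bij_betw (\<lambda>u. {v, u}) {u. {v, u} \<in> E} {e \<in> E. v \<in> e}"
  proof (intro bij_betw_imageI)
    show "inj_on (\<lambda>u. {v, u}) {u. {v, u} \<in> E}" by (auto simp: inj_on_def doubleton_eq_iff)
    show "(\<lambda>u. {v, u}) ` {u. {v, u} \<in> E} = {e \<in> E. v \<in> e}"
    proof (intro equalityI subsetI)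
      fix e assume e: "e \<in> {e \<in> E. v \<in> e}"
      then obtain p q where "e = {p, q}" using edgeE by blast
      then show "e \<in> (\<lambda>u. {v, u}) ` {u. {v, u} \<in> E}" using e by (auto simp: insert_commute)
    qed auto
  qed
  from sum.reindex_bij_betw[OF this, of m] show ?thesis
    unfolding dimer_degree_def by simp
qed

lemma sum_deg:
  assumes "finite T"
  shows "(\<Sum>v\<in>T. deg m v) = (\<Sum>e\<in>E. card (e \<inter> T) * m e)"
proof -
  have "(\<Sum>v\<in>T. deg m v) = (\<Sum>v\<in>T. \<Sum>e\<in>E. if v \<in> e then m e else 0)"
    unfolding deg_edges using finite_edges by (simp add: sum.If_cases Int_def)
  also have "\<dots> = (\<Sum>e\<in>E. \<Sum>v\<in>T. if v \<in> e then m e else 0)" by (rule sum.swap)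
  also have "\<dots> = (\<Sum>e\<in>E. card (e \<inter> T) * m e)"
    using assms by (simp add: sum.If_cases Int_def conj_commute)
  finally show ?thesis .
qed

text \<open>Double counting of incidences between \<open>T\<close> and the edges: an edge that
  carries weight but is not inside \<open>S\<close> misses \<open>S\<close> altogether. It is used
  with \<open>T = S\<close> and \<open>k = 2\<close>, and with \<open>T\<close> a colour class of
  \<open>S\<close> and \<open>k = 1\<close>.\<close>

lemma sum_deg_closed:
  assumes "closed_under m S" "finite T" "T \<subseteq> S"
    and "\<And>e. e \<in> E \<Longrightarrow> e \<subseteq> S \<Longrightarrow> card (e \<inter> T) = k"
  shows "(\<Sum>v\<in>T. deg m v) = k * (\<Sum>e | e \<in> E \<and> e \<subseteq> S. m e)"
proof -
  have "(\<Sum>v\<in>T. deg m v) = (\<Sum>e\<in>E. if e \<subseteq> S then k * m e else 0)"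
    unfolding sum_deg[OF assms(2)]
  proof (intro sum.cong refl)
    fix e assume e: "e \<in> E"
    show "card (e \<inter> T) * m e = (if e \<subseteq> S then k * m e else 0)"
    proof (cases "e \<subseteq> S \<or> m e = 0")
      case True
      then show ?thesis using assms(4)[OF e] by auto
    next
      case False
      then have "e \<inter> T = {}" using closed_edge[OF assms(1) e] assms(3) by auto
      then show ?thesis using False by simp
    qed
  qed
  also have "\<dots> = k * (\<Sum>e | e \<in> E \<and> e \<subseteq> S. m e)"
    using finite_edges by (simp add: sum.If_cases Int_def sum_distrib_left)
  finally show ?thesis .
qed

lemma closed_under_mono:
  "closed_under f S \<Longrightarrow> (\<And>e. e \<in> E \<Longrightarrow> g e \<le> f e) \<Longrightarrow> closed_under g S"
  unfolding closed_under_def using less_le_trans by metis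

lemma card_edge: "e \<in> E \<Longrightarrow> card e = 2"
  by (erule edgeE) simp

text \<open>By the handshake identity each of the two coverings has half as many dimers in the loop
  as the loop has vertices. Multiplicities are counted, so a doubled edge fits as well.\<close>

lemma loop_length_ge:
  assumes "\<omega> \<in> full" "x \<in> V"
  shows "card (loop_vertices V w x \<omega>) \<le> loop_length V w x \<omega>"
proof -
  obtain m1 m2 where m: "\<omega> = (m1, m2)" and c: "m1 \<in> covers V w V" "m2 \<in> covers V w V"
    using assms by auto
  let ?S = "comp (\<lambda>e. m1 e + m2 e) x"
  have S: "?S \<subseteq> V" "finite ?S" using comp_sub[OF assms(2)] fin finite_subset by blast+
  have cl: "closed_under m1 ?S" "closed_under m2 ?S"
    by (rule closed_under_mono[OF comp_closed], simp)+
  have k: "card (e \<inter> ?S) = 2" if "e \<in> E" "e \<subseteq> ?S" for e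
    using that card_edge by (simp add: Int_absorb2)
  have d: "(\<Sum>v\<in>?S. deg m v) = card ?S" if "m \<in> covers V w V" for m
    using cover_deg[OF that] S by (simp add: subset_iff)
  have "2 * (\<Sum>e | e \<in> E \<and> e \<subseteq> ?S. m1 e) = card ?S" "2 * (\<Sum>e | e \<in> E \<and> e \<subseteq> ?S. m2 e) = card ?S"
    using sum_deg_closed[OF cl(1) S(2) subset_refl k] sum_deg_closed[OF cl(2) S(2) subset_refl k] d c by auto
  then show ?thesis
    unfolding m loop_length_def loop_vertices_eq prod.case by (simp add: sum.distrib)
qed

lemma expected_length_ge:
  assumes "\<forall>x\<in>V. w x x = 0" "x \<in> V"
  shows "(\<Sum>y\<in>V. visits x y) / (Z V)\<^sup>2 \<le> (\<integral>\<omega>. real (loop_length V w x \<omega>) \<partial>mdd_measure V w)"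
proof -
  have "(\<Sum>y\<in>V. visits x y) = (\<Sum>y\<in>V. \<Sum>\<omega>\<in>full. cw (fst \<omega>) * cw (snd \<omega>) * of_bool (y \<in> loop_vertices V w x \<omega>))"
    unfolding visits_def
    using finite_full by (simp add: of_bool_def if_distrib sum.If_cases Int_def cong: if_cong)
  also have "\<dots> = (\<Sum>\<omega>\<in>full. \<Sum>y\<in>V. cw (fst \<omega>) * cw (snd \<omega>) * of_bool (y \<in> loop_vertices V w x \<omega>))"
    by (rule sum.swap)
  also have "\<dots> = (\<Sum>\<omega>\<in>full. cw (fst \<omega>) * cw (snd \<omega>) * real (card (V \<inter> loop_vertices V w x \<omega>)))"
    using fin by (simp add: sum_distrib_left[symmetric] of_bool_def sum.If_cases)
  also have "\<dots> \<le> (\<Sum>\<omega>\<in>full. cw (fst \<omega>) * cw (snd \<omega>) * real (loop_length V w x \<omega>))"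
  proof (intro sum_mono mult_left_mono)
    fix \<omega> assume \<omega>: "\<omega> \<in> full"
    obtain m1 m2 where "\<omega> = (m1, m2)" by (cases \<omega>)
    then have "V \<inter> loop_vertices V w x \<omega> = loop_vertices V w x \<omega>"
      using comp_sub[OF assms(2)] loop_vertices_eq by auto
    then show "real (card (V \<inter> loop_vertices V w x \<omega>)) \<le> real (loop_length V w x \<omega>)"
      using loop_length_ge[OF \<omega> assms(2)] by simp
  qed (simp add: less_imp_le[OF cover_weight_pos])
  finally have "(\<Sum>y\<in>V. visits x y) / (Z V)\<^sup>2 \<le>
      (\<Sum>\<omega>\<in>full. cw (fst \<omega>) * cw (snd \<omega>) * real (loop_length V w x \<omega>)) / (Z V)\<^sup>2"
    by (rule divide_right_mono) simp
  also have "\<dots> = (\<integral>\<omega>. real (loop_length V w x \<omega>) \<partial>mdd_measure V w)"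
    by (rule expected_length[OF assms(1), symmetric])
  finally show ?thesis .
qed

text \<open>The spanning tree bound. A proper subset of the component that contains \<open>x\<close>
  is not closed, by minimality, so it can be enlarged by one vertex together with a new
  edge.\<close>

lemma card_comp_edges:
  assumes "finite (comp f x)"
  shows "card (comp f x) \<le> Suc (card {e \<in> E. e \<subseteq> comp f x \<and> 0 < f e})"
proof -
  let ?S = "comp f x"
  have "\<exists>T\<subseteq>?S. x \<in> T \<and> card T = Suc n \<and> n \<le> card {e \<in> E. e \<subseteq> T \<and> 0 < f e}" if "n < card ?S" for n
    using that
  proof (induction n)
    case 0
    then show ?case using comp_self by (intro exI[of _ "{x}"]) auto
  next
    case (Suc n)
    then obtain T where T: "T \<subseteq> ?S" "x \<in> T" "card T = Suc n" "n \<le> card {e \<in> E. e \<subseteq> T \<and> 0 < f e}"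
      by auto
    have "\<not> ?S \<subseteq> T" using T Suc.prems by (metis less_irrefl subset_antisym)
    then have "\<not> closed_under f T" using comp_minimal T(2) by blast
    then obtain u v where uv: "u \<in> T" "{u, v} \<in> E" "0 < f {u, v}" "v \<notin> T"
      unfolding closed_under_def by blast
    have "v \<in> ?S" using comp_closed uv T(1) unfolding closed_under_def by blast
    have fT: "finite T" using T(3) card.infinite by fastforce
    have "Suc n \<le> card (insert {u, v} {e \<in> E. e \<subseteq> T \<and> 0 < f e})"
      using uv T(4) finite_edges by (subst card_insert_disjoint) auto
    also have "\<dots> \<le> card {e \<in> E. e \<subseteq> insert v T \<and> 0 < f e}"
      using uv finite_edges by (intro card_mono) auto
    finally show ?case using \<open>v \<in> ?S\<close> T uv fT by (intro exI[of _ "insert v T"]) auto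
  qed
  note steps = this
  have "0 < card ?S" using comp_self assms card_gt_0_iff by blast
  obtain T where T: "T \<subseteq> ?S" "card T = card ?S" "card ?S - 1 \<le> card {e \<in> E. e \<subseteq> T \<and> 0 < f e}"
  proof -
    have "card ?S - 1 < card ?S" "Suc (card ?S - 1) = card ?S" using \<open>0 < card ?S\<close> by auto
    then show ?thesis using that steps[of "card ?S - 1"] by auto
  qed
  then have "T = ?S" using assms card_subset_eq by blast
  then show ?thesis using T by simp
qed

lemma cover_add:
  assumes "m \<in> covers V w S" "{u, v} \<in> E" "u \<notin> S" "S \<subseteq> V"
    and "v \<notin> S"
  shows "m({u, v} := 1) \<in> covers V w (insert u (insert v S))"
proof -
  have uv: "u \<in> V" "v \<in> V" "u \<noteq> v" using assms(2) edge_in by auto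
  have "insert v S - {v} = S" using assms(5) by auto
  then have "m({u, v} := 1) \<in> (\<lambda>m. m({u, v} := 1)) ` covers V w (insert v S - {v})"
    using assms(1) by auto
  then show ?thesis
    using covers_insert[of u "insert v S"] uv assms(2-4) by auto
qed

definition swap :: "'a set \<Rightarrow> ('a set \<Rightarrow> nat) \<Rightarrow> ('a set \<Rightarrow> nat) \<Rightarrow> 'a set \<Rightarrow> nat" where
  "swap S m m' = (\<lambda>e. if e \<subseteq> S then m' e else m e)"

lemma swap_swap: "swap S (swap S m m') (swap S m' m) = m"
  unfolding swap_def by (rule ext) simp

text \<open>Since \<open>S\<close> is closed under both coverings, no dimer straddles its boundary.
  Degrees are therefore those of \<open>m'\<close> inside \<open>S\<close> and those of
  \<open>m\<close> outside.\<close>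

lemma swap_covers:
  assumes "m \<in> covers V w P" "m' \<in> covers V w Q" "closed_under m S" "closed_under m' S"
  shows "swap S m m' \<in> covers V w ((P - S) \<union> (Q \<inter> S))"
proof -
  have "swap S m m' \<in> E \<rightarrow>\<^sub>E {0, 1}"
    using assms(1,2) unfolding covers_def swap_def by (auto simp: PiE_iff extensional_def)
  moreover have "deg (swap S m m') v = of_bool (v \<in> (P - S) \<union> (Q \<inter> S))" if v: "v \<in> V" for v
  proof -
    have "deg (swap S m m') v = (if v \<in> S then deg m' v else deg m v)"
      unfolding dimer_degree_def
    proof (cases "v \<in> S")
      case True
      have "swap S m m' {v, y} = m' {v, y}" if vy: "{v, y} \<in> E" for y
      proof (cases "y \<in> S")
        case False
        have "m {v, y} = 0" "m' {v, y} = 0"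
          using closed_edge[OF assms(3) vy] closed_edge[OF assms(4) vy] True False by blast+
        then show ?thesis using False by (simp add: swap_def)
      qed (use True in \<open>simp add: swap_def\<close>)
      then show "(\<Sum>y | {v, y} \<in> E. swap S m m' {v, y}) =
        (if v \<in> S then \<Sum>y | {v, y} \<in> E. m' {v, y} else \<Sum>y | {v, y} \<in> E. m {v, y})"
        using True by (auto intro!: sum.cong)
    qed (auto simp: swap_def intro!: sum.cong)
    then show ?thesis using cover_deg[OF assms(1) v] cover_deg[OF assms(2) v] by auto
  qed
  ultimately show ?thesis unfolding covers_def by auto
qed

lemma swap_weight: "cw (swap S m m') * cw (swap S m' m) = cw m * cw m'"
  unfolding prod_edges[symmetric] by (intro prod.cong) (auto simp: swap_def add.commute)

text \<open>Adding the dimer \<open>{x, y}\<close> to a covering of \<open>V - {x, y}\<close> puts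
  \<open>y\<close> into the loop of \<open>x\<close>. This serves the pairs of neighbours for which
  the four points of the rewiring are not distinct.\<close>

lemma visits_edge:
  assumes "{x, y} \<in> E"
  shows "w x y * Z (V - {x, y}) * Z V \<le> visits x y"
proof -
  let ?A = "covers V w (V - {x, y}) \<times> covers V w V"
  let ?f = "\<lambda>\<omega>. ((fst \<omega>)({x, y} := 1), snd \<omega>) :: 'a dimer_pair"
  let ?B = "{\<omega> \<in> full. y \<in> loop_vertices V w x \<omega>}"
  have xy: "x \<in> V" "y \<in> V" "x \<noteq> y" using assms edge_in by auto
  have z: "m {x, y} = 0" if "m \<in> covers V w (V - {x, y})" for m
    using cover_in[OF that assms] by auto
  have "w x y * Z (V - {x, y}) * Z V = (\<Sum>m\<in>covers V w (V - {x, y}). \<Sum>m'\<in>covers V w V. w x y * cw m * cw m')"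
  proof -
    have "Z (V - {x, y}) * Z V = (\<Sum>m\<in>covers V w (V - {x, y}). \<Sum>m'\<in>covers V w V. cw m * cw m')"
      by (simp only: dimer_Z_def sum_product)
    then show ?thesis by (simp only: mult.assoc sum_distrib_left)
  qed
  also have "\<dots> = (\<Sum>\<omega>\<in>?A. w x y * cw (fst \<omega>) * cw (snd \<omega>))"
    by (simp add: sum.cartesian_product case_prod_unfold)
  also have "\<dots> = (\<Sum>\<omega>\<in>?A. cw (fst (?f \<omega>)) * cw (snd (?f \<omega>)))"
    using cover_weight_upd[OF assms] z by (intro sum.cong) auto
  also have "\<dots> = (\<Sum>\<omega>\<in>?f ` ?A. cw (fst \<omega>) * cw (snd \<omega>))"
  proof (subst sum.reindex)
    show "inj_on ?f ?A"
    proof (rule inj_onI)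
      fix a b assume ab: "a \<in> ?A" "b \<in> ?A" "?f a = ?f b"
      then have "(fst a)({x, y} := 1, {x, y} := 0) = (fst b)({x, y} := 1, {x, y} := 0)" by simp
      moreover have "fst a {x, y} = 0" "fst b {x, y} = 0" using ab z by auto
      ultimately have "fst a = fst b" by (metis fun_upd_triv fun_upd_upd)
      then show "a = b" using ab by (simp add: prod_eq_iff)
    qed
  qed simp
  also have "\<dots> \<le> visits x y" unfolding visits_def
  proof (rule sum_mono2)
    show "finite ?B" using finite_full by simp
    show "?f ` ?A \<subseteq> ?B"
    proof
      fix \<omega> assume "\<omega> \<in> ?f ` ?A"
      then obtain m m' where m: "m \<in> covers V w (V - {x, y})" "m' \<in> covers V w V"
        "\<omega> = (m({x, y} := 1), m')" by auto
      have "m({x, y} := 1) \<in> covers V w (insert x (insert y (V - {x, y})))"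
        using m assms by (intro cover_add) auto
      moreover have "insert x (insert y (V - {x, y})) = V" using xy by auto
      ultimately have "\<omega> \<in> full" using m by simp
      moreover have "y \<in> comp (\<lambda>e. (m({x, y} := 1)) e + m' e) x"
        by (rule comp_closed[unfolded closed_under_def, rule_format, OF comp_self assms]) simp
      ultimately show "\<omega> \<in> ?B" using m(3) loop_vertices_eq by simp
    qed
  qed (simp add: less_imp_le[OF cover_weight_pos])
  finally show ?thesis .
qed

context
  fixes c :: "'a \<Rightarrow> bool"
  assumes c: "\<And>u v. {u, v} \<in> E \<Longrightarrow> c u \<noteq> c v"
begin

text \<open>An edge inside \<open>S\<close> has exactly one end of each colour, so the dimers inside
  \<open>S\<close> count the covered vertices of either colour.\<close>

lemma card_color:
  assumes "m \<in> covers V w P" "closed_under m S" "S \<subseteq> V"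
  shows "card {v\<in>S. v \<in> P \<and> c v} = (\<Sum>e | e \<in> E \<and> e \<subseteq> S. m e)"
    and "card {v\<in>S. v \<in> P \<and> \<not> c v} = (\<Sum>e | e \<in> E \<and> e \<subseteq> S. m e)"
proof -
  have finS: "finite S" using assms(3) fin finite_subset by blast
  have k: "card (e \<inter> {v\<in>S. c v}) = 1" "card (e \<inter> {v\<in>S. \<not> c v}) = 1" if e: "e \<in> E" "e \<subseteq> S" for e
  proof -
    obtain u v where uv: "e = {u, v}" using edgeE[OF e(1)] by metis
    then have "c u \<noteq> c v" using c e by auto
    then have "e \<inter> {v\<in>S. c v} = {if c u then u else v}" "e \<inter> {v\<in>S. \<not> c v} = {if c u then v else u}"
      using uv e by auto
    then show "card (e \<inter> {v\<in>S. c v}) = 1" "card (e \<inter> {v\<in>S. \<not> c v}) = 1" by auto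
  qed
  have d: "(\<Sum>v\<in>T. deg m v) = card {v\<in>T. v \<in> P}" if "T \<subseteq> S" for T
  proof -
    have "(\<Sum>v\<in>T. deg m v) = (\<Sum>v\<in>T. of_bool (v \<in> P))"
      using that assms(3) cover_deg[OF assms(1)] by (intro sum.cong) auto
    also have "\<dots> = card {v\<in>T. v \<in> P}"
      using finite_subset[OF that finS] by (simp add: of_bool_def sum.If_cases Int_def)
    finally show ?thesis .
  qed
  have "card {v\<in>{v\<in>S. c v}. v \<in> P} = 1 * (\<Sum>e | e \<in> E \<and> e \<subseteq> S. m e)"
    using sum_deg_closed[OF assms(2), of "{v\<in>S. c v}" 1] d[of "{v\<in>S. c v}"] k finS by auto
  moreover have "{v\<in>{v\<in>S. c v}. v \<in> P} = {v\<in>S. v \<in> P \<and> c v}" by auto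
  ultimately show "card {v\<in>S. v \<in> P \<and> c v} = (\<Sum>e | e \<in> E \<and> e \<subseteq> S. m e)" by simp
  have "card {v\<in>{v\<in>S. \<not> c v}. v \<in> P} = 1 * (\<Sum>e | e \<in> E \<and> e \<subseteq> S. m e)"
    using sum_deg_closed[OF assms(2), of "{v\<in>S. \<not> c v}" 1] d[of "{v\<in>S. \<not> c v}"] k finS by auto
  moreover have "{v\<in>{v\<in>S. \<not> c v}. v \<in> P} = {v\<in>S. v \<in> P \<and> \<not> c v}" by auto
  ultimately show "card {v\<in>S. v \<in> P \<and> \<not> c v} = (\<Sum>e | e \<in> E \<and> e \<subseteq> S. m e)" by simp
qed

text \<open>\<open>P\<close> and \<open>Q\<close> stand for the sizes of the colour classes of the
  component, \<open>Px\<close> for the first without \<open>x\<close>, \<open>Qy\<close> for the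
  second without \<open>y\<close>, and so on; \<open>Y\<close>, \<open>A\<close>, \<open>B\<close>
  say whether \<open>y\<close>, \<open>a\<close>, \<open>b\<close> belong to it. If \<open>Y\<close>
  holds, then \<open>P = Q\<close> and the inequality excludes \<open>B\<close>; otherwise
  \<open>P\<close> exceeds \<open>Q\<close> by one, which forces \<open>B\<close> and excludes
  \<open>A\<close>.\<close>

lemma endpoint_cases:
  fixes P Q Px Pb Qy Qa :: nat
  assumes "Px = Qy" "Pb = Qa" "P + Q \<le> Suc (Px + Pb)" "Suc Px = P" "Y \<Longrightarrow> Suc Qy = Q"
    "\<not> Y \<Longrightarrow> Qy = Q" "A \<Longrightarrow> Suc Qa = Q" "\<not> A \<Longrightarrow> Qa = Q" "B \<Longrightarrow> Suc Pb = P" "\<not> B \<Longrightarrow> Pb = P"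
  shows "(Y \<and> \<not> A \<and> \<not> B) \<or> (B \<and> \<not> Y \<and> \<not> A)"
  using assms by (cases Y; cases A; cases B) auto

context
  fixes x y a b
  assumes edges_ab: "{x, a} \<in> E" "{y, b} \<in> E" and distinct: "distinct [x, y, a, b]"
    and col: "c x" "\<not> c y" "\<not> c a" "c b"
begin

lemma xyab_in: "x \<in> V" "y \<in> V" "a \<in> V" "b \<in> V"
  using edges_ab edge_in by auto

lemma card_two_colors:
  assumes "m \<in> covers V w (V - {p, q})" "closed_under m S" "S \<subseteq> V" "c p" "\<not> c q"
  shows "card ({v\<in>S. c v} - {p}) = card ({v\<in>S. \<not> c v} - {q})"
    "card ({v\<in>S. c v} - {p}) = (\<Sum>e | e \<in> E \<and> e \<subseteq> S. m e)"
proof -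
  have "{v\<in>S. v \<in> V - {p, q} \<and> c v} = {v\<in>S. c v} - {p}"
    "{v\<in>S. v \<in> V - {p, q} \<and> \<not> c v} = {v\<in>S. \<not> c v} - {q}" using assms(3-5) by auto
  then show "card ({v\<in>S. c v} - {p}) = card ({v\<in>S. \<not> c v} - {q})"
    "card ({v\<in>S. c v} - {p}) = (\<Sum>e | e \<in> E \<and> e \<subseteq> S. m e)"
    using card_color[OF assms(1-3)] by auto
qed

text \<open>Parity leaves these two cases and the one in which all four endpoints lie in one component. The
  latter has too few edges to be connected, since four of its vertices have degree at most one and the
  others degree two.\<close>

lemma component_cases:
  assumes m: "m \<in> covers V w (V - {x, y})" "m' \<in> covers V w (V - {a, b})"
  defines "S \<equiv> comp (\<lambda>e. m e + m' e) x"
  shows "(y \<in> S \<and> a \<notin> S \<and> b \<notin> S) \<or> (b \<in> S \<and> y \<notin> S \<and> a \<notin> S)"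
proof -
  let ?f = "\<lambda>e. m e + m' e"
  have S: "S \<subseteq> V" "finite S" "x \<in> S"
    unfolding S_def using comp_sub xyab_in(1) comp_self fin finite_subset by blast+
  have cl: "closed_under m S" "closed_under m' S"
    unfolding S_def by (rule closed_under_mono[OF comp_closed], simp)+
  let ?P = "{v\<in>S. c v}" let ?Q = "{v\<in>S. \<not> c v}"
  have m'': "m' \<in> covers V w (V - {b, a})" using m(2) by (simp add: insert_commute)
  have 1: "card (?P - {x}) = card (?Q - {y})" "card (?P - {x}) = (\<Sum>e | e \<in> E \<and> e \<subseteq> S. m e)"
    using card_two_colors[OF m(1) cl(1) S(1)] col by auto
  have 2: "card (?P - {b}) = card (?Q - {a})" "card (?P - {b}) = (\<Sum>e | e \<in> E \<and> e \<subseteq> S. m' e)"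
    using card_two_colors[OF m'' cl(2) S(1)] col by auto
  have pq: "card S = card ?P + card ?Q"
  proof -
    have "card S = card (?P \<union> ?Q)" by (rule arg_cong[of _ _ card]) auto
    also have "\<dots> = card ?P + card ?Q" using S(2) by (intro card_Un_disjoint) auto
    finally show ?thesis .
  qed
  have "card S \<le> Suc (card {e \<in> E. e \<subseteq> S \<and> 0 < ?f e})"
    using card_comp_edges[of ?f x] S(2) unfolding S_def by simp
  also have "card {e \<in> E. e \<subseteq> S \<and> 0 < ?f e} = (\<Sum>e\<in>{e \<in> E. e \<subseteq> S \<and> 0 < ?f e}. 1)" by simp
  also have "\<dots> \<le> (\<Sum>e\<in>{e \<in> E. e \<subseteq> S \<and> 0 < ?f e}. ?f e)" by (intro sum_mono) auto
  also have "\<dots> \<le> (\<Sum>e | e \<in> E \<and> e \<subseteq> S. ?f e)"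
    using finite_edges by (intro sum_mono2) auto
  also have "\<dots> = card (?P - {x}) + card (?P - {b})" using 1(2) 2(2) by (simp add: sum.distrib)
  finally have le: "card ?P + card ?Q \<le> Suc (card (?P - {x}) + card (?P - {b}))" unfolding pq by simp
  have x: "Suc (card (?P - {x})) = card ?P" using S col by (intro card_Suc_Diff1) auto
  have y: "Suc (card (?Q - {y})) = card ?Q" if "y \<in> S" using that S col by (intro card_Suc_Diff1) auto
  have a: "Suc (card (?Q - {a})) = card ?Q" if "a \<in> S" using that S col by (intro card_Suc_Diff1) auto
  have b: "Suc (card (?P - {b})) = card ?P" if "b \<in> S" using that S col by (intro card_Suc_Diff1) auto
  have n: "y \<notin> S \<Longrightarrow> ?Q - {y} = ?Q" "a \<notin> S \<Longrightarrow> ?Q - {a} = ?Q" "b \<notin> S \<Longrightarrow> ?P - {b} = ?P" by auto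
  show ?thesis
    by (rule endpoint_cases[OF 1(1) 2(1) le x]) (use y a b n in \<open>simp_all only: simp_thms\<close>)
qed

text \<open>The added edges put \<open>a\<close> into the component and keep \<open>y\<close> and
  \<open>b\<close> together. If both were absent, \<open>m\<close> would give the colour of
  \<open>x\<close> one vertex more than the other colour, and \<open>m'\<close> one vertex
  less.\<close>

lemma component_contains:
  assumes m: "m \<in> covers V w (V - {x, y})" "m' \<in> covers V w (V - {a, b})"
    and f: "\<And>e. e \<in> E \<Longrightarrow> f e = m e + m' e + of_bool (e = {x, a}) + of_bool (e = {y, b})"
  shows "y \<in> comp f x"
proof -
  define S where "S = comp f x"
  have S: "S \<subseteq> V" "finite S" "x \<in> S"
    unfolding S_def using comp_sub xyab_in(1) comp_self fin finite_subset by blast+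
  have cl0: "closed_under f S" unfolding S_def by (rule comp_closed)
  have cl: "closed_under m S" "closed_under m' S"
    by (rule closed_under_mono[OF cl0], simp add: f)+
  have aS: "a \<in> S" using cl0 S(3) edges_ab(1) f[OF edges_ab(1)] unfolding closed_under_def by auto
  have by': "{b, y} \<in> E" "f {b, y} > 0" "f {y, b} > 0"
    using edges_ab(2) f[OF edges_ab(2)] by (auto simp: insert_commute)
  then have yb: "y \<in> S \<longleftrightarrow> b \<in> S" using cl0 edges_ab(2) unfolding closed_under_def by blast
  let ?P = "{v\<in>S. c v}" let ?Q = "{v\<in>S. \<not> c v}"
  have m'': "m' \<in> covers V w (V - {b, a})" using m(2) by (simp add: insert_commute)
  have 1: "card (?P - {x}) = card (?Q - {y})"
    using card_two_colors[OF m(1) cl(1) S(1)] col by auto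
  have 2: "card (?P - {b}) = card (?Q - {a})"
    using card_two_colors[OF m'' cl(2) S(1)] col by auto
  have x: "Suc (card (?P - {x})) = card ?P" using S col by (intro card_Suc_Diff1) auto
  have a: "Suc (card (?Q - {a})) = card ?Q" using aS S col by (intro card_Suc_Diff1) auto
  have "y \<in> S"
  proof (rule ccontr)
    assume "y \<notin> S"
    then have "?Q - {y} = ?Q" "?P - {b} = ?P" using yb by auto
    then show False using 1 2 x a by simp
  qed
  then show ?thesis unfolding S_def .
qed

text \<open>Exchanging the two coverings on the component of \<open>x\<close> is an involution that preserves the union, so
  \<open>rewire\<close> can be undone once the two cases are told apart, which the edge \<open>{y, b}\<close> of the first
  covering does.\<close>

definition rewire :: "'a dimer_pair \<Rightarrow> 'a dimer_pair" where
  "rewire = (\<lambda>(m, m'). let S = comp (\<lambda>e. m e + m' e) x in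
     if y \<in> S then (swap S m m', (swap S m' m)({x, a} := 1, {y, b} := 1))
     else ((swap S m m')({y, b} := 1), (swap S m' m)({x, a} := 1)))"

definition unwire :: "'a dimer_pair \<Rightarrow> 'a dimer_pair" where
  "unwire = (\<lambda>(p, p').
     let (n, n') = (if p {y, b} = 0 then (p, p'({x, a} := 0, {y, b} := 0)) else (p({y, b} := 0), p'({x, a} := 0)));
         S = comp (\<lambda>e. n e + n' e) x in (swap S n n', swap S n' n))"

lemma rewire:
  assumes m: "m \<in> covers V w (V - {x, y})" "m' \<in> covers V w (V - {a, b})"
  shows "rewire (m, m') \<in> full"
    and "y \<in> loop_vertices V w x (rewire (m, m'))"
    and "cw (fst (rewire (m, m'))) * cw (snd (rewire (m, m'))) = w x a * w y b * (cw m * cw m')"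
    and "unwire (rewire (m, m')) = (m, m')"
proof -
  define S where "S = comp (\<lambda>e. m e + m' e) x"
  define n where "n = swap S m m'"
  define n' where "n' = swap S m' m"
  have xS: "x \<in> S" unfolding S_def by (rule comp_self)
  have cl: "closed_under m S" "closed_under m' S"
    unfolding S_def by (rule closed_under_mono[OF comp_closed], simp)+
  have sum_eq: "n e + n' e = m e + m' e" for e unfolding n_def n'_def swap_def by simp
  have S_n: "comp (\<lambda>e. n e + n' e) x = S" unfolding sum_eq S_def ..
  have swb: "swap S n n' = m" "swap S n' n = m'" unfolding n_def n'_def by (rule swap_swap)+
  have nc: "n \<in> covers V w ((V - {x, y} - S) \<union> ((V - {a, b}) \<inter> S))"
    unfolding n_def by (rule swap_covers[OF m cl])
  have nc': "n' \<in> covers V w ((V - {a, b} - S) \<union> ((V - {x, y}) \<inter> S))"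
    unfolding n'_def by (rule swap_covers[OF m(2,1) cl(2,1)])
  have ne: "{x, a} \<noteq> {y, b}" using distinct by (auto simp: doubleton_eq_iff)
  have d: "x \<noteq> y" "x \<noteq> a" "x \<noteq> b" "y \<noteq> a" "y \<noteq> b" "a \<noteq> b" using distinct by auto
  have conn: "y \<in> loop_vertices V w x (p, p')"
    if "\<And>e. p e + p' e = n e + n' e + of_bool (e = {x, a}) + of_bool (e = {y, b})" for p p'
    unfolding loop_vertices_eq by (rule component_contains[OF m]) (simp add: that sum_eq)
  show "rewire (m, m') \<in> full"
    and "y \<in> loop_vertices V w x (rewire (m, m'))"
    and "cw (fst (rewire (m, m'))) * cw (snd (rewire (m, m'))) = w x a * w y b * (cw m * cw m')"
    and "unwire (rewire (m, m')) = (m, m')"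
  proof (atomize (full), goal_cases)
    case 1
    show ?case
    proof (cases "y \<in> S")
      case True
      \<comment> \<open>Only \<open>x\<close> and \<open>y\<close> lie in the component. After the
        exchange \<open>n\<close> is a full covering while \<open>n'\<close> misses all four points,
        so both new dimers go to \<open>n'\<close>.\<close>
      then have nS: "a \<notin> S" "b \<notin> S" using component_cases[OF m] unfolding S_def by auto
      have "(V - {x, y} - S) \<union> ((V - {a, b}) \<inter> S) = V" using True xS nS xyab_in by auto
      then have c1: "n \<in> covers V w V" using nc by simp
      have "(V - {a, b} - S) \<union> ((V - {x, y}) \<inter> S) = V - {x, y, a, b}" using True xS nS xyab_in by auto
      then have c2: "n' \<in> covers V w (V - {x, y, a, b})" using nc' by simp
      have c3: "n'({x, a} := 1) \<in> covers V w (V - {y, b})"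
      proof -
        have "insert x (insert a (V - {x, y, a, b})) = V - {y, b}" using xyab_in d by auto
        then show ?thesis using cover_add[OF c2 edges_ab(1)] by auto
      qed
      have c4: "n'({x, a} := 1, {y, b} := 1) \<in> covers V w V"
      proof -
        have "insert y (insert b (V - {y, b})) = V" using xyab_in by auto
        then show ?thesis using cover_add[OF c3 edges_ab(2)] by auto
      qed
      have r: "rewire (m, m') = (n, n'({x, a} := 1, {y, b} := 1))"
        using True unfolding rewire_def S_def[symmetric] n_def n'_def by (simp add: Let_def S_def)
      have z1: "n' {x, a} = 0" using cover_in[OF c2 edges_ab(1)] by auto
      have z2: "(n'({x, a} := 1)) {y, b} = 0" by (rule ccontr) (use cover_in[OF c3 edges_ab(2)] in blast)
      have z3: "n {y, b} = 0"
      proof -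
        have "m {y, b} = 0" using cover_in[OF m(1) edges_ab(2)] by auto
        then show ?thesis using nS unfolding n_def swap_def by auto
      qed
      have "cw n * cw (n'({x, a} := 1, {y, b} := 1)) = w x a * w y b * (cw m * cw m')"
        using cover_weight_upd[of y b "n'({x, a} := 1)"] edges_ab z1 z2 cover_weight_upd[of x a n']
          swap_weight[of S m m'] unfolding n_def[symmetric] n'_def[symmetric] by (simp add: mult_ac)
      moreover have "y \<in> loop_vertices V w x (n, n'({x, a} := 1, {y, b} := 1))"
        using z1 z2 ne by (intro conn) auto
      moreover have "unwire (rewire (m, m')) = (m, m')"
      proof -
        have eq: "n'({x, a} := 1, {y, b} := 1, {x, a} := 0, {y, b} := 0) = n'"
          using z1 z2 ne by (auto simp: fun_eq_iff)
        show ?thesis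
          by (simp only: r unwire_def Let_def prod.case z3 if_True eq S_n swb simp_thms)
      qed
      ultimately show ?thesis using c1 c4 unfolding r by simp
    next
      case False
      \<comment> \<open>Only \<open>x\<close> and \<open>b\<close> lie in the component. After the
        exchange \<open>n\<close> misses \<open>y\<close> and \<open>b\<close>, and
        \<open>n'\<close> misses \<open>x\<close> and \<open>a\<close>, so each receives one new
        dimer.\<close>
      then have nS: "b \<in> S" "a \<notin> S" using component_cases[OF m] unfolding S_def by auto
      have "(V - {x, y} - S) \<union> ((V - {a, b}) \<inter> S) = V - {y, b}" using False xS nS xyab_in by auto
      then have c1: "n \<in> covers V w (V - {y, b})" using nc by simp
      have "(V - {a, b} - S) \<union> ((V - {x, y}) \<inter> S) = V - {x, a}" using False xS nS xyab_in by auto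
      then have c2: "n' \<in> covers V w (V - {x, a})" using nc' by simp
      have c3: "n'({x, a} := 1) \<in> covers V w V"
      proof -
        have "insert x (insert a (V - {x, a})) = V" using xyab_in by auto
        then show ?thesis using cover_add[OF c2 edges_ab(1)] by auto
      qed
      have c4: "n({y, b} := 1) \<in> covers V w V"
      proof -
        have "insert y (insert b (V - {y, b})) = V" using xyab_in by auto
        then show ?thesis using cover_add[OF c1 edges_ab(2)] by auto
      qed
      have r: "rewire (m, m') = (n({y, b} := 1), n'({x, a} := 1))"
        using False unfolding rewire_def S_def[symmetric] n_def n'_def by (simp add: Let_def S_def)
      have z1: "n' {x, a} = 0" using cover_in[OF c2 edges_ab(1)] by auto
      have z2: "n {y, b} = 0" using cover_in[OF c1 edges_ab(2)] by auto
      have "cw (n({y, b} := 1)) * cw (n'({x, a} := 1)) = w x a * w y b * (cw m * cw m')"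
        using cover_weight_upd[of y b n] edges_ab z1 z2 cover_weight_upd[of x a n']
          swap_weight[of S m m'] unfolding n_def[symmetric] n'_def[symmetric] by (simp add: mult_ac)
      moreover have "y \<in> loop_vertices V w x (n({y, b} := 1), n'({x, a} := 1))"
        using z1 z2 ne by (intro conn) auto
      moreover have "unwire (rewire (m, m')) = (m, m')"
      proof -
        have eq: "n({y, b} := 1, {y, b} := 0) = n" "n'({x, a} := 1, {x, a} := 0) = n'"
          using z1 z2 by (auto simp: fun_eq_iff)
        have "((n({y, b} := 1)) {y, b} = 0) = False" by simp
        then show ?thesis
          by (simp only: r unwire_def Let_def prod.case if_False eq S_n swb simp_thms)
      qed
      ultimately show ?thesis using c3 c4 unfolding r by simp
    qed
  qed
qed

lemma visits_ge: "w x a * w y b * (Z (V - {x, y}) * Z (V - {a, b})) \<le> visits x y"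
proof -
  let ?A = "covers V w (V - {x, y}) \<times> covers V w (V - {a, b})"
  let ?B = "{\<omega> \<in> full. y \<in> loop_vertices V w x \<omega>}"
  have "w x a * w y b * (Z (V - {x, y}) * Z (V - {a, b})) =
      (\<Sum>m\<in>covers V w (V - {x, y}). \<Sum>m'\<in>covers V w (V - {a, b}). w x a * w y b * (cw m * cw m'))"
    by (simp only: dimer_Z_def sum_product sum_distrib_left[symmetric])
  also have "\<dots> = (\<Sum>\<omega>\<in>?A. w x a * w y b * (cw (fst \<omega>) * cw (snd \<omega>)))"
    by (simp add: sum.cartesian_product case_prod_unfold)
  also have "\<dots> = (\<Sum>\<omega>\<in>?A. cw (fst (rewire \<omega>)) * cw (snd (rewire \<omega>)))"
    using rewire(3) by (intro sum.cong) auto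
  also have "\<dots> = (\<Sum>\<omega>\<in>rewire ` ?A. cw (fst \<omega>) * cw (snd \<omega>))"
  proof (subst sum.reindex)
    show "inj_on rewire ?A"
      by (rule inj_on_inverseI[of _ unwire]) (use rewire(4) in auto)
  qed simp
  also have "\<dots> \<le> visits x y" unfolding visits_def
  proof (rule sum_mono2)
    show "finite ?B" using finite_full by simp
    show "rewire ` ?A \<subseteq> ?B"
    proof
      fix \<omega> assume "\<omega> \<in> rewire ` ?A"
      then obtain m m' where "\<omega> = rewire (m, m')" "m \<in> covers V w (V - {x, y})" "m' \<in> covers V w (V - {a, b})"
        by auto
      then show "\<omega> \<in> ?B" using rewire(1,2)[of m m'] by (simp only: mem_Collect_eq)
    qed
  qed (simp add: less_imp_le[OF cover_weight_pos])
  finally show ?thesis .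
qed

end

end

end

section \<open>Periodised weights on the torus\<close>

lemma box_bij: "bij_betw vec_nth {x :: 'a ^ 'd. \<forall>i. x $ i \<in> A i} (Pi\<^sub>E UNIV A)"
  by (rule bij_betw_byWitness[where f' = vec_lambda]) (auto simp: PiE_iff)

lemma finite_box: "(\<And>i. finite (A i)) \<Longrightarrow> finite {x :: 'a ^ 'd::finite. \<forall>i. x $ i \<in> A i}"
  using bij_betw_finite[OF box_bij, of A] by (simp add: finite_PiE)

lemma card_box: "card {x :: 'a ^ 'd::finite. \<forall>i. x $ i \<in> A i} = (\<Prod>i\<in>UNIV. card (A i))"
  using bij_betw_same_card[OF box_bij, of A] by (simp add: card_PiE)

lemma torus_box: "torus L = {x. \<forall>i. x $ i \<in> {0..<int L}}"
  unfolding torus_def by auto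

lemma finite_torus [simp]: "finite (torus L)"
  unfolding torus_box by (rule finite_box) auto

lemma card_torus: "card (torus L :: (int ^ 'd::finite) set) = L ^ CARD('d)"
  unfolding torus_box card_box by simp

lemma to_torus_nth [simp]: "to_torus L x $ i = x $ i mod int L"
  unfolding to_torus_def by simp

lemma to_torus_in: "0 < L \<Longrightarrow> to_torus L x \<in> torus L"
  unfolding torus_def by auto

lemma to_torus_id: "x \<in> torus L \<Longrightarrow> to_torus L x = x"
  unfolding torus_def by (auto simp: vec_eq_iff)

lemma to_torus_add1 [simp]: "to_torus L (to_torus L x + y) = to_torus L (x + y)"
  by (simp add: vec_eq_iff mod_simps)

lemma to_torus_add2 [simp]: "to_torus L (y + to_torus L x) = to_torus L (y + x)"
  by (simp add: vec_eq_iff mod_simps)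

lemma to_torus_diff1 [simp]: "to_torus L (to_torus L x - y) = to_torus L (x - y)"
  by (simp add: vec_eq_iff mod_simps)

lemma to_torus_diff2 [simp]: "to_torus L (y - to_torus L x) = to_torus L (y - x)"
  by (simp add: vec_eq_iff mod_simps)

lemma to_torus_minus [simp]: "to_torus L (- to_torus L x) = to_torus L (- x)"
  by (simp add: vec_eq_iff mod_simps)

lemma to_torus_idem [simp]: "to_torus L (to_torus L x) = to_torus L x"
  by (simp add: vec_eq_iff)

lemma to_torus_smult [simp]: "to_torus L (x + int L *s z) = to_torus L x"
  by (simp add: vec_eq_iff)

lemma zero_in_torus: "0 < L \<Longrightarrow> 0 \<in> torus L"
  unfolding torus_def by auto

lemma to_torus_quot: "to_torus L x = x + int L *s (\<chi> i. - (x $ i div int L))"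
  by (simp add: vec_eq_iff minus_mult_div_eq_mod)

definition periodic :: "nat \<Rightarrow> (int ^ 'd::finite \<Rightarrow> 'b) \<Rightarrow> bool" where
  "periodic L f \<longleftrightarrow> (\<forall>x. f (to_torus L x) = f x)"

lemma periodicD: "periodic L f \<Longrightarrow> f (to_torus L x) = f x"
  unfolding periodic_def by blast

lemma periodic_eq: "periodic L f \<Longrightarrow> to_torus L x = to_torus L y \<Longrightarrow> f x = f y"
  by (metis periodicD)

lemma periodicI: "(\<And>x z. f (x + int L *s z) = f x) \<Longrightarrow> periodic L f"
  unfolding periodic_def to_torus_quot by blast

lemma bij_torus_shift: "0 < L \<Longrightarrow> bij_betw (\<lambda>x. to_torus L (x + a)) (torus L) (torus L)"
  by (rule bij_betw_byWitness[where f' = "\<lambda>x. to_torus L (x - a)"])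
     (auto simp: to_torus_in to_torus_id)

lemma bij_torus_minus: "0 < L \<Longrightarrow> bij_betw (\<lambda>x. to_torus L (- x)) (torus L) (torus L)"
  by (rule bij_betw_byWitness[where f' = "\<lambda>x. to_torus L (- x)"])
     (auto simp: to_torus_in to_torus_id)

lemma sum_torus_shift:
  assumes "0 < L" "periodic L f"
  shows "(\<Sum>x\<in>torus L. f (x + a)) = (\<Sum>x\<in>torus L. f x)"
  using sum.reindex_bij_betw[OF bij_torus_shift[OF assms(1), of a], of f] periodicD[OF assms(2)] by simp

lemma sum_torus_minus:
  assumes "0 < L" "periodic L f"
  shows "(\<Sum>x\<in>torus L. f (- x)) = (\<Sum>x\<in>torus L. f x)"
  using sum.reindex_bij_betw[OF bij_torus_minus[OF assms(1)], of f] periodicD[OF assms(2)] by simp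

lemma torus_cosets: "0 < L \<Longrightarrow> bij_betw (\<lambda>(x, z). x + int L *s z) (torus L \<times> UNIV) UNIV"
proof (rule bij_betw_byWitness[where f' = "\<lambda>x. (to_torus L x, \<chi> i. x $ i div int L)"])
  assume L: "0 < L"
  show "\<forall>a\<in>torus L \<times> UNIV. (\<lambda>x. (to_torus L x, \<chi> i. x $ i div int L)) (case a of (x, z) \<Rightarrow> x + int L *s z) = a"
    using L by (auto simp: to_torus_id vec_eq_iff torus_def)
  show "\<forall>a'\<in>UNIV. (case (to_torus L a', \<chi> i. a' $ i div int L) of (x, z) \<Rightarrow> x + int L *s z) = a'"
    by (auto simp: vec_eq_iff)
  show "range (\<lambda>x. (to_torus L x, \<chi> i. x $ i div int L)) \<subseteq> torus L \<times> UNIV"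
    using L to_torus_in by auto
qed auto

lemma infsum_cosets:
  fixes f :: "int ^ 'd::finite \<Rightarrow> 'b::banach"
  assumes "0 < L" "f summable_on UNIV"
  shows "infsum f UNIV = (\<Sum>x\<in>torus L. \<Sum>\<^sub>\<infinity>z. f (x + int L *s z))"
proof -
  have "infsum f UNIV = (\<Sum>\<^sub>\<infinity>(x, z)\<in>torus L \<times> UNIV. f (x + int L *s z))"
    using infsum_reindex_bij_betw[OF torus_cosets[OF assms(1)], of f] by (simp add: case_prod_unfold)
  also have "\<dots> = (\<Sum>\<^sub>\<infinity>x\<in>torus L. \<Sum>\<^sub>\<infinity>z. f (x + int L *s z))"
  proof (rule infsum_Sigma'_banach[symmetric])
    show "(\<lambda>(x, z). f (x + int L *s z)) summable_on torus L \<times> UNIV"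
      using summable_on_reindex_bij_betw[OF torus_cosets[OF assms(1)], of f] assms(2)
      by (simp add: case_prod_unfold)
  qed
  finally show ?thesis by simp
qed

lemma even_to_infinity_iff:
  "(\<forall>\<^sub>F L in even_to_infinity. P L) \<longleftrightarrow> (\<forall>\<^sub>F L in sequentially. even L \<longrightarrow> P L)"
  unfolding even_to_infinity_def eventually_inf_principal by simp

definition flip :: "'d::finite \<Rightarrow> int ^ 'd \<Rightarrow> int ^ 'd" where
  "flip i x = (\<chi> j. if j = i then - x $ j else x $ j)"

lemma flip_nth [simp]: "flip i x $ j = (if j = i then - x $ j else x $ j)"
  unfolding flip_def by simp

lemma reflection_nth [simp]: "reflection i x $ j = (if j = i then 1 - x $ j else x $ j)"
  unfolding reflection_def by (simp add: axis_def)

lemma even_sum_iff: "finite A \<Longrightarrow> even (\<Sum>i\<in>A. \<bar>f i :: int\<bar>) \<longleftrightarrow> even (\<Sum>i\<in>A. f i)"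
  by (induction rule: finite_induct) auto

definition coord_sum :: "int ^ 'd::finite \<Rightarrow> int" where
  "coord_sum x = (\<Sum>i\<in>UNIV. x $ i)"

lemma even_one_norm: "even (one_norm x) \<longleftrightarrow> even (coord_sum x)"
  unfolding one_norm_def coord_sum_def by (rule even_sum_iff) simp

lemma coord_sum_add: "coord_sum (x + y) = coord_sum x + coord_sum y"
  unfolding coord_sum_def by (simp add: sum.distrib)

lemma coord_sum_diff: "coord_sum (x - y) = coord_sum x - coord_sum y"
  unfolding coord_sum_def by (simp add: sum_subtractf)

lemma coord_sum_smult: "coord_sum (c *s x) = c * coord_sum x"
  unfolding coord_sum_def by (simp add: sum_distrib_left)

lemma coord_sum_axis [simp]: "coord_sum (axis i a) = a"
  unfolding coord_sum_def by (simp add: axis_def)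

lemma even_coord_sum_torus: "even L \<Longrightarrow> even (coord_sum (to_torus L x)) \<longleftrightarrow> even (coord_sum x)"
  unfolding to_torus_quot by (simp add: coord_sum_add coord_sum_smult)

section \<open>Consequences of admissibility on the infinite lattice\<close>

locale admissible_weight =
  fixes w :: "int ^ 'd::finite \<Rightarrow> int ^ 'd \<Rightarrow> real"
  assumes admissible: "admissible w"
begin

abbreviation "u \<equiv> w 0"

lemma w_nonneg: "0 \<le> w x y" and w_sym: "w x y = w y x" and w_shift: "w (x + z) (y + z) = w x y"
  and closure: "group_closure {x. u x > 0} = UNIV" and has_sum_u: "(u has_sum 1) UNIV"
  and OS: "OS_positive w"
  using admissible unfolding admissible_def by auto

lemma w_diff: "w x y = u (y - x)"
  using w_shift[of 0 x "y - x"] by simp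

lemma u_minus: "u (- x) = u x"
  using w_diff[of x 0] w_sym[of x 0] by simp

lemma u_nonneg: "0 \<le> u x" by (rule w_nonneg)

lemma u_summable: "u summable_on A"
  using has_sum_u summable_on_subset_banach[of u UNIV A] has_sum_imp_summable by blast

lemma OS_complex:
  assumes "finite F" "F \<subseteq> half_space i"
  shows "(\<Sum>x\<in>F. \<Sum>y\<in>F. cnj (f x) * complex_of_real (w x (reflection i y)) * f y) \<in> \<real>\<^sub>\<ge>\<^sub>0"
proof -
  define g where "g = (\<lambda>x. if x \<in> F then f x else 0)"
  let ?G = "{x \<in> half_space i. g x \<noteq> 0}"
  have G: "?G \<subseteq> F" by (auto simp: g_def split: if_splits)
  then have "finite ?G" using assms(1) finite_subset by blast
  then have "(\<Sum>x\<in>?G. \<Sum>y\<in>?G. cnj (g x) * complex_of_real (w x (reflection i y)) * g y) \<in> \<real>\<^sub>\<ge>\<^sub>0"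
    using OS unfolding OS_positive_def by blast
  also have "(\<Sum>x\<in>?G. \<Sum>y\<in>?G. cnj (g x) * complex_of_real (w x (reflection i y)) * g y)
      = (\<Sum>x\<in>F. \<Sum>y\<in>?G. cnj (g x) * complex_of_real (w x (reflection i y)) * g y)"
    using G assms by (intro sum.mono_neutral_left) auto
  also have "\<dots> = (\<Sum>x\<in>F. \<Sum>y\<in>F. cnj (g x) * complex_of_real (w x (reflection i y)) * g y)"
    using G assms by (intro sum.cong refl sum.mono_neutral_left) auto
  finally show ?thesis by (simp add: g_def cong: sum.cong)
qed

lemma OS_real:
  fixes f :: "int ^ 'd \<Rightarrow> real"
  assumes "finite F" "F \<subseteq> half_space i"
  shows "0 \<le> (\<Sum>x\<in>F. \<Sum>y\<in>F. f x * f y * w x (reflection i y))"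
proof -
  have "complex_of_real (\<Sum>x\<in>F. \<Sum>y\<in>F. f x * f y * w x (reflection i y)) =
      (\<Sum>x\<in>F. \<Sum>y\<in>F. cnj (complex_of_real (f x)) * complex_of_real (w x (reflection i y)) * complex_of_real (f y))"
    by (simp add: mult_ac)
  also have "\<dots> \<in> \<real>\<^sub>\<ge>\<^sub>0" by (rule OS_complex[OF assms])
  finally show ?thesis by (simp only: nonneg_Reals_of_real_iff)
qed

text \<open>Complex test functions force the kernel to be Hermitian: with the values 1 and
  \<open>\<i>\<close> at two points, the imaginary part of the form is the difference of the two
  entries.\<close>

lemma OS_sym:
  assumes "x \<in> half_space i" "y \<in> half_space i"
  shows "w x (reflection i y) = w y (reflection i x)"
proof (cases "x = y")
  case False
  have "(\<Sum>p\<in>{x, y}. \<Sum>q\<in>{x, y}. cnj (if p = x then 1 else \<i>) * complex_of_real (w p (reflection i q)) *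
      (if q = x then 1 else \<i>)) \<in> \<real>\<^sub>\<ge>\<^sub>0" (is "?s \<in> _")
    using assms by (intro OS_complex) auto
  moreover have "Im ?s = w x (reflection i y) - w y (reflection i x)"
    using False by simp
  ultimately show ?thesis by (simp add: complex_nonneg_Reals_iff)
qed simp

text \<open>Symmetry under a single coordinate reflection is not an axiom of admissibility; it comes
  from \<open>OS_sym\<close>. For \<open>x $ i < 0\<close> there are points \<open>p\<close>,
  \<open>q\<close> of the half space whose two kernel entries are \<open>u x\<close> and
  \<open>u (flip i x)\<close>; the other signs follow from \<open>u_minus\<close>.\<close>

lemma u_flip: "u (flip i x) = u x"
proof -
  have neg: "u (flip i x) = u x" if x: "x $ i < 0" for x
  proof -
    define p where "p = (\<chi> j. if j = i then 1 else - x $ j)"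
    define q where "q = (\<chi> j. if j = i then - x $ i else 0)"
    have pq: "p \<in> half_space i" "q \<in> half_space i" using x by (auto simp: half_space_def p_def q_def)
    have 1: "reflection i q - p = x" by (auto simp: vec_eq_iff p_def q_def)
    have 2: "reflection i p - q = - flip i x" by (auto simp: vec_eq_iff p_def q_def)
    show ?thesis using OS_sym[OF pq] unfolding w_diff[of p] w_diff[of q] 1 2 u_minus by simp
  qed
  consider "x $ i < 0" | "x $ i = 0" | "x $ i > 0" by linarith
  then show ?thesis
  proof cases
    case 2
    then have "flip i x = x" by (auto simp: vec_eq_iff)
    then show ?thesis by simp
  next
    case 3
    then have "u (flip i (- x)) = u (- x)" by (intro neg) auto
    moreover have "flip i (- x) = - flip i x" by (auto simp: vec_eq_iff)
    ultimately show ?thesis by (simp add: u_minus)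
  qed (rule neg)
qed

text \<open>If this weight vanished, so would the diagonal entry at each point next to the plane,
  and hence the whole row of that point, since the form would be affine in its coefficient. Then all
  weights would live on the hyperplane \<open>x $ i = 0\<close> and could not generate the
  lattice.\<close>

lemma u_axis_pos: "0 < u (axis i 1)"
proof (rule ccontr)
  assume "\<not> 0 < u (axis i 1)"
  then have z: "u (axis i 1) = 0" using u_nonneg[of "axis i 1"] by linarith
  have zero: "u x = 0" if x: "x $ i > 0" for x
  proof -
    define p where "p = (\<chi> j. if j = i then 1 else x $ j)"
    define q where "q = (\<chi> j. if j = i then x $ i else 0)"
    have pq: "p \<in> half_space i" "q \<in> half_space i" using x by (auto simp: half_space_def p_def q_def)
    have pp: "w p (reflection i p) = 0"
    proof -
      have "reflection i p - p = - axis i 1" by (auto simp: vec_eq_iff p_def axis_def)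
      then show ?thesis using z u_minus[of "axis i 1"] by (simp add: w_diff[of p])
    qed
    have pq': "w p (reflection i q) = u x"
    proof -
      have "reflection i q - p = - x" by (auto simp: vec_eq_iff p_def q_def)
      then show ?thesis by (simp add: w_diff[of p] u_minus)
    qed
    have qp: "w q (reflection i p) = u x" using OS_sym[OF pq] pq' by simp
    show ?thesis
    proof (cases "p = q")
      case True
      then show ?thesis using pp pq' by simp
    next
      case False
      define B where "B = w q (reflection i q)"
      have form: "0 \<le> 2 * t * u x + B" for t
      proof -
        have "0 \<le> (\<Sum>a\<in>{p, q}. \<Sum>b\<in>{p, q}. (if a = p then t else 1) * (if b = p then t else 1) * w a (reflection i b))"
          using pq by (intro OS_real) auto
        then show ?thesis using False pp pq' qp by (simp add: B_def)
      qed
      show ?thesis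
      proof (rule ccontr)
        assume n: "u x \<noteq> 0"
        show False using form[of "- (B + 1) / (2 * u x)"] n by (simp add: field_simps)
      qed
    qed
  qed
  have zero': "x $ i = 0" if "u x > 0" for x
    using zero[of x] zero[of "- x"] u_minus[of x] that by (metis neg_0_less_iff_less linorder_neqE less_irrefl vector_uminus_component)
  have "x $ i = 0" if "x \<in> group_closure {x. u x > 0}" for x
    using that by (induction rule: group_closure.induct) (auto simp: zero')
  then have "(axis i 1 :: int ^ 'd) $ i = 0" using closure by blast
  then show False by (simp add: axis_def)
qed

lemma summable_coset: "(\<lambda>z. u (x + int L *s z)) summable_on A" if "0 < L"
proof -
  have inj: "inj_on (\<lambda>z. x + int L *s z) A" using that by (auto simp: inj_on_def vec_eq_iff)
  have "u summable_on (\<lambda>z. x + int L *s z) ` A" by (rule u_summable)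
  then show ?thesis using summable_on_reindex[OF inj, of u] by (simp add: o_def)
qed

end

locale torus_weight = admissible_weight w for w :: "int ^ 'd::finite \<Rightarrow> int ^ 'd \<Rightarrow> real" +
  fixes L :: nat
  assumes L_pos: "0 < L" and L_even: "even L" and bip: "bipartite w"
begin

abbreviation "T \<equiv> to_torus L"
abbreviation "V \<equiv> torus L :: (int ^ 'd) set"

definition p :: "int ^ 'd \<Rightarrow> real" where
  "p x = (\<Sum>\<^sub>\<infinity>z. u (x + int L *s z))"

lemma periodised_eq: "periodised L w x y = p (y - x)"
  unfolding periodised_def p_def by (simp add: w_diff[of x] algebra_simps)

lemma p_nonneg: "0 \<le> p x"
  unfolding p_def by (intro infsum_nonneg u_nonneg)

lemma p_ge: "u x \<le> p x"
proof -
  have "(\<Sum>\<^sub>\<infinity>z\<in>{0}. u (x + int L *s z)) \<le> p x" unfolding p_def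
    by (rule infsum_mono_neutral) (use summable_coset[OF L_pos] u_nonneg in auto)
  then show ?thesis by simp
qed

lemma p_periodic: "periodic L p"
proof (rule periodicI)
  fix x z0 :: "int ^ 'd"
  have bij: "bij_betw (\<lambda>z. z + z0) UNIV UNIV"
    by (rule bij_betw_byWitness[where f' = "\<lambda>z. z - z0"]) auto
  have eq: "x + int L *s z0 + int L *s z = x + int L *s (z + z0)" for z
    by (simp add: vec_eq_iff algebra_simps)
  show "p (x + int L *s z0) = p x"
    unfolding p_def eq using infsum_reindex_bij_betw[OF bij, of "\<lambda>z. u (x + int L *s z)"] by simp
qed

lemma p_T [simp]: "p (T x) = p x"
  using periodicD[OF p_periodic] .

lemma p_minus [simp]: "p (- x) = p x"
proof -
  have bij: "bij_betw uminus UNIV (UNIV :: (int ^ 'd) set)"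
    by (rule bij_betw_byWitness[where f' = uminus]) auto
  have "p (- x) = (\<Sum>\<^sub>\<infinity>z. u (x + int L *s (- z)))" unfolding p_def
  proof (intro infsum_cong)
    fix z
    have "- x + int L *s z = - (x + int L *s (- z))" by (simp add: vec_eq_iff)
    then show "u (- x + int L *s z) = u (x + int L *s (- z))" using u_minus by metis
  qed
  then show ?thesis
    unfolding p_def using infsum_reindex_bij_betw[OF bij, of "\<lambda>z. u (x + int L *s z)"] by simp
qed

lemma p_flip: "p (flip i x) = p x"
proof -
  have bij: "bij_betw (flip i) UNIV UNIV"
    by (rule bij_betw_byWitness[where f' = "flip i"]) (auto simp: vec_eq_iff)
  have "p (flip i x) = (\<Sum>\<^sub>\<infinity>z. u (x + int L *s (flip i z)))" unfolding p_def
  proof (intro infsum_cong)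
    fix z
    have "flip i x + int L *s z = flip i (x + int L *s (flip i z))" by (simp add: vec_eq_iff)
    then show "u (flip i x + int L *s z) = u (x + int L *s (flip i z))" using u_flip by metis
  qed
  then show ?thesis
    unfolding p_def using infsum_reindex_bij_betw[OF bij, of "\<lambda>z. u (x + int L *s z)"] by simp
qed

lemma p_even: "even (coord_sum x) \<Longrightarrow> p x = 0"
  unfolding p_def
  by (rule infsum_0) (use bip L_even in \<open>auto simp: bipartite_def even_one_norm coord_sum_add coord_sum_smult\<close>)

lemma sum_p: "(\<Sum>x\<in>V. p x) = 1"
  using infsum_cosets[OF L_pos u_summable] has_sum_u infsumI unfolding p_def by force

lemma p_axis_pos: "0 < p (axis i 1)"
  using u_axis_pos p_ge less_le_trans by blast

end

section \<open>Reflection positivity of the periodised weights\<close>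

lemma has_sum_finite_sum:
  fixes f :: "'j \<Rightarrow> 'a \<Rightarrow> real"
  assumes "finite J" "\<And>j. j \<in> J \<Longrightarrow> (f j has_sum s j) A"
  shows "((\<lambda>x. \<Sum>j\<in>J. f j x) has_sum (\<Sum>j\<in>J. s j)) A"
  using assms by (induction J rule: finite_induct) (auto intro!: has_sum_add)

definition hyperplane :: "'d::finite \<Rightarrow> (int ^ 'd) set" where
  "hyperplane i = {z. z $ i = 0}"

definition slab :: "'d::finite \<Rightarrow> nat \<Rightarrow> (int ^ 'd) set" where
  "slab i N = {z. \<forall>j. z $ j \<in> (if j = i then {0} else {0..<int N})}"

lemma finite_slab: "finite (slab i N)"
  unfolding slab_def by (rule finite_box) auto

lemma slab_hyperplane: "z \<in> slab i N \<Longrightarrow> z \<in> hyperplane i"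
  unfolding slab_def hyperplane_def by (auto dest: spec[of _ i])

lemma card_slab: "card (slab i N :: (int ^ 'd::finite) set) = (\<Prod>j\<in>UNIV. if j = i then 1 else N)"
  unfolding slab_def card_box by (rule prod.cong) auto

lemma card_slab_overlap:
  assumes "v \<in> hyperplane i"
  shows "card {z \<in> slab i N. z + v \<in> slab i N} = (\<Prod>j\<in>UNIV. if j = i then 1 else nat (int N - \<bar>v $ j\<bar>))"
proof -
  have "{z \<in> slab i N. z + v \<in> slab i N} =
      {z. \<forall>j. z $ j \<in> (if j = i then {0} else {max 0 (- v $ j)..<min (int N) (int N - v $ j)})}"
  proof (rule Collect_cong)
    fix z
    have "z $ j \<in> (if j = i then {0} else {0..<int N}) \<and> (z + v) $ j \<in> (if j = i then {0} else {0..<int N})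
        \<longleftrightarrow> z $ j \<in> (if j = i then {0} else {max 0 (- v $ j)..<min (int N) (int N - v $ j)})" for j
      using assms by (cases "j = i") (auto simp: hyperplane_def)
    then show "z \<in> slab i N \<and> z + v \<in> slab i N \<longleftrightarrow>
        (\<forall>j. z $ j \<in> (if j = i then {0} else {max 0 (- v $ j)..<min (int N) (int N - v $ j)}))"
      unfolding slab_def mem_Collect_eq by blast
  qed
  also have "card \<dots> = (\<Prod>j\<in>UNIV. if j = i then 1 else nat (int N - \<bar>v $ j\<bar>))"
    unfolding card_box by (rule prod.cong) (auto simp: abs_if min_def max_def)
  finally show ?thesis .
qed

lemma overlap_ratio:
  assumes "v \<in> hyperplane i"
  shows "(\<lambda>N. real (card {z \<in> slab i (Suc N). z + v \<in> slab i (Suc N)}) / real (card (slab i (Suc N)))) \<longlonglongrightarrow> 1"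
proof -
  have one: "(\<lambda>N. real (nat (int (Suc N) - \<bar>a\<bar>)) / real (Suc N)) \<longlonglongrightarrow> 1" for a :: int
  proof -
    have "(\<lambda>N. 1 - real_of_int \<bar>a\<bar> / real (Suc N)) \<longlonglongrightarrow> 1 - 0"
      by (intro tendsto_diff tendsto_const LIMSEQ_Suc[OF lim_const_over_n])
    moreover have "\<forall>\<^sub>F N in sequentially. 1 - real_of_int \<bar>a\<bar> / real (Suc N) = real (nat (int (Suc N) - \<bar>a\<bar>)) / real (Suc N)"
    proof (rule eventually_sequentiallyI[of "nat \<bar>a\<bar>"])
      fix N assume "nat \<bar>a\<bar> \<le> N"
      then show "1 - real_of_int \<bar>a\<bar> / real (Suc N) = real (nat (int (Suc N) - \<bar>a\<bar>)) / real (Suc N)"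
        by (simp add: field_simps)
    qed
    ultimately show ?thesis by (simp add: tendsto_cong)
  qed
  have "(\<lambda>N. \<Prod>j\<in>UNIV. if j = i then 1 else real (nat (int (Suc N) - \<bar>v $ j\<bar>)) / real (Suc N))
      \<longlonglongrightarrow> (\<Prod>j\<in>(UNIV :: 'a set). 1)"
  proof (intro tendsto_prod)
    fix j :: 'a
    show "(\<lambda>N. if j = i then 1 else real (nat (int (Suc N) - \<bar>v $ j\<bar>)) / real (Suc N)) \<longlonglongrightarrow> 1"
      using one[of "v $ j"] by (cases "j = i") auto
  qed
  moreover have "real (card {z \<in> slab i (Suc N). z + v \<in> slab i (Suc N)}) / real (card (slab i (Suc N)))
      = (\<Prod>j\<in>UNIV. if j = i then 1 else real (nat (int (Suc N) - \<bar>v $ j\<bar>)) / real (Suc N))" for N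
    unfolding card_slab_overlap[OF assms] card_slab of_nat_prod prod_dividef[symmetric]
    by (rule prod.cong) auto
  ultimately show ?thesis by simp
qed

text \<open>Pairs of points of a large box at a given offset are asymptotically as many as points of the box, so
  the averaged double sums converge to the sum over the hyperplane.\<close>

lemma infsum_nonneg_averages:
  fixes e :: "int ^ 'd::finite \<Rightarrow> real"
  assumes sm: "e summable_on hyperplane i"
    and pos: "\<And>N. 0 \<le> (\<Sum>z\<in>slab i N. \<Sum>z'\<in>slab i N. e (z' - z))"
  shows "0 \<le> infsum e (hyperplane i)"
proof -
  let ?H = "hyperplane i"
  define \<kappa> where "\<kappa> = (\<lambda>N v. real (card {z \<in> slab i (Suc N). z + v \<in> slab i (Suc N)}) / real (card (slab i (Suc N))))"
  have abs: "Infinite_Set_Sum.abs_summable_on e ?H"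
    using sm summable_on_iff_abs_summable_on_real abs_summable_equivalent by blast
  then have int: "integrable (count_space ?H) e" unfolding abs_summable_on_def .
  have kb: "0 \<le> \<kappa> N v" "\<kappa> N v \<le> 1" for N v
    unfolding \<kappa>_def using finite_slab by (auto intro!: divide_le_eq_1[THEN iffD2] card_mono simp: card_gt_0_iff divide_le_eq_1)
  have lim: "(\<lambda>N. integral\<^sup>L (count_space ?H) (\<lambda>v. e v * \<kappa> N v)) \<longlonglongrightarrow> integral\<^sup>L (count_space ?H) e"
  proof (rule integral_dominated_convergence[where w = "\<lambda>v. \<bar>e v\<bar>"])
    show "integrable (count_space ?H) (\<lambda>v. \<bar>e v\<bar>)" using int by (rule integrable_abs)
    show "AE v in count_space ?H. (\<lambda>N. e v * \<kappa> N v) \<longlonglongrightarrow> e v"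
    proof (rule AE_I2)
      fix v assume "v \<in> space (count_space ?H)"
      then have "(\<lambda>N. \<kappa> N v) \<longlonglongrightarrow> 1" using overlap_ratio[of v i] unfolding \<kappa>_def by simp
      from tendsto_mult[OF tendsto_const[of "e v"] this] show "(\<lambda>N. e v * \<kappa> N v) \<longlonglongrightarrow> e v" by simp
    qed
    show "AE v in count_space ?H. norm (e v * \<kappa> N v) \<le> \<bar>e v\<bar>" for N
      using kb[of N] by (intro AE_I2) (auto simp: abs_mult mult_left_le)
  qed auto
  have nn: "0 \<le> integral\<^sup>L (count_space ?H) (\<lambda>v. e v * \<kappa> N v)" for N
  proof -
    let ?B = "slab i (Suc N)"
    define D where "D = (\<lambda>(z, z'). z' - z) ` (?B \<times> ?B)"
    have finD: "finite D" unfolding D_def using finite_slab by blast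
    have DH: "D \<subseteq> ?H" unfolding D_def by (auto simp: hyperplane_def dest!: slab_hyperplane)
    have out: "\<kappa> N v = 0" if "v \<notin> D" for v
    proof -
      have "z + v \<in> ?B \<Longrightarrow> z \<in> ?B \<Longrightarrow> False" for z
        using that unfolding D_def by (auto intro!: image_eqI[of _ _ "(z, z + v)"])
      then have none: "{z \<in> ?B. z + v \<in> ?B} = {}" by auto
      show ?thesis unfolding \<kappa>_def none by simp
    qed
    have "integral\<^sup>L (count_space ?H) (\<lambda>v. e v * \<kappa> N v) = (\<Sum>v | v \<in> ?H \<and> e v * \<kappa> N v \<noteq> 0. e v * \<kappa> N v)"
      by (rule lebesgue_integral_count_space_finite_support) (rule finite_subset[OF _ finD], use out in auto)
    also have "\<dots> = (\<Sum>v\<in>D. e v * \<kappa> N v)"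
      using finD DH out by (intro sum.mono_neutral_left) auto
    also have "\<dots> = (\<Sum>v\<in>D. \<Sum>z\<in>?B. e v * of_bool (z + v \<in> ?B)) / real (card ?B)"
      unfolding \<kappa>_def
      by (simp add: finite_slab sum_divide_distrib sum_distrib_left[symmetric] of_bool_def sum.If_cases Int_def)
    also have "(\<Sum>v\<in>D. \<Sum>z\<in>?B. e v * of_bool (z + v \<in> ?B)) = (\<Sum>z\<in>?B. \<Sum>v\<in>D. e v * of_bool (z + v \<in> ?B))"
      by (rule sum.swap)
    also have "\<dots> = (\<Sum>z\<in>?B. \<Sum>z'\<in>?B. e (z' - z))"
    proof (rule sum.cong[OF refl])
      fix z assume z: "z \<in> ?B"
      have "(\<Sum>v\<in>D. e v * of_bool (z + v \<in> ?B)) = (\<Sum>v\<in>(\<lambda>z'. z' - z) ` ?B. e v * of_bool (z + v \<in> ?B))"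
      proof (rule sum.mono_neutral_right[OF finD])
        show "(\<lambda>z'. z' - z) ` ?B \<subseteq> D" using z unfolding D_def by (auto intro!: image_eqI[of _ _ "(z, _)"])
        show "\<forall>v\<in>D - (\<lambda>z'. z' - z) ` ?B. e v * of_bool (z + v \<in> ?B) = 0"
        proof
          fix v assume v: "v \<in> D - (\<lambda>z'. z' - z) ` ?B"
          have "z + v \<notin> ?B"
          proof
            assume "z + v \<in> ?B"
            then have "(z + v) - z \<in> (\<lambda>z'. z' - z) ` ?B" by (rule imageI)
            then show False using v by simp
          qed
          then show "e v * of_bool (z + v \<in> ?B) = 0" by simp
        qed
      qed
      also have "\<dots> = (\<Sum>z'\<in>?B. e (z' - z) * of_bool (z + (z' - z) \<in> ?B))"
        by (subst sum.reindex) (auto simp: inj_on_def)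
      also have "\<dots> = (\<Sum>z'\<in>?B. e (z' - z))" by (rule sum.cong) auto
      finally show "(\<Sum>v\<in>D. e v * of_bool (z + v \<in> ?B)) = (\<Sum>z'\<in>?B. e (z' - z))" .
    qed
    finally show ?thesis using pos[of "Suc N"] by simp
  qed
  have "0 \<le> integral\<^sup>L (count_space ?H) e"
    by (rule LIMSEQ_le_const[OF lim]) (use nn in auto)
  also have "\<dots> = infsum e ?H"
    using infsetsum_infsum[OF abs] unfolding infsetsum_def by simp
  finally show ?thesis .
qed

context admissible_weight
begin

lemma OS_family:
  fixes c :: "'j \<Rightarrow> real"
  assumes "finite J" "\<And>j. j \<in> J \<Longrightarrow> X j \<in> half_space i"
  shows "0 \<le> (\<Sum>j\<in>J. \<Sum>k\<in>J. c j * c k * u (reflection i (X k) - X j))"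
proof -
  have F: "X ` J \<subseteq> half_space i" "finite (X ` J)" using assms by auto
  have "psd (X ` J) (\<lambda>x y. w x (reflection i y))"
    unfolding psd_def using OS_real[OF F(2,1)] OS_sym F(1) by blast
  from psd_push[OF this assms(1) F(2) subset_refl]
  have "psd J (\<lambda>j k. w (X j) (reflection i (X k)))" .
  from psd_form[OF this] show ?thesis by (simp only: w_diff[of "X _"])
qed

text \<open>OS-positivity is applied to all translates of the points by \<open>L\<close> times the
  points of a box in the hyperplane. The reflection commutes with these translations, so the entries
  depend only on the difference of two of them, and averaging over boxes yields the full
  sum.\<close>

lemma OS_hyperplane:
  fixes c :: "'j \<Rightarrow> real"
  assumes J: "finite J" "\<And>j. j \<in> J \<Longrightarrow> X j \<in> half_space i" and L: "0 < L"
  shows "0 \<le> (\<Sum>j\<in>J. \<Sum>k\<in>J. c j * c k * (\<Sum>\<^sub>\<infinity>z\<in>hyperplane i. u (reflection i (X k) - X j + int L *s z)))"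
proof -
  define e where "e = (\<lambda>z. \<Sum>j\<in>J. \<Sum>k\<in>J. c j * c k * u (reflection i (X k) - X j + int L *s z))"
  have hs: "(e has_sum (\<Sum>j\<in>J. \<Sum>k\<in>J. c j * c k * (\<Sum>\<^sub>\<infinity>z\<in>hyperplane i. u (reflection i (X k) - X j + int L *s z)))) (hyperplane i)"
    unfolding e_def
    by (intro has_sum_finite_sum J has_sum_cmult_right has_sum_infsum summable_coset L)
  have "0 \<le> infsum e (hyperplane i)"
  proof (rule infsum_nonneg_averages)
    show "e summable_on hyperplane i" using hs has_sum_imp_summable by blast
    fix N
    let ?B = "slab i N"
    let ?J = "J \<times> ?B"
    let ?X = "\<lambda>(j, z). X j + int L *s z"
    have "?X q \<in> half_space i" if "q \<in> ?J" for q
    proof -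
      obtain j z where q: "q = (j, z)" "j \<in> J" "z \<in> ?B" using \<open>q \<in> ?J\<close> by blast
      then have "z $ i = 0" using slab_hyperplane unfolding hyperplane_def by blast
      then show ?thesis using q J(2)[of j] by (simp add: half_space_def)
    qed
    then have "0 \<le> (\<Sum>q\<in>?J. \<Sum>r\<in>?J. c (fst q) * c (fst r) * u (reflection i (?X r) - ?X q))"
      using J(1) by (intro OS_family) (auto simp: finite_slab)
    also have "\<dots> = (\<Sum>j\<in>J. \<Sum>z\<in>?B. \<Sum>k\<in>J. \<Sum>z'\<in>?B. c j * c k * u (reflection i (?X (k, z')) - ?X (j, z)))"
      by (simp add: sum.cartesian_product')
    also have "\<dots> = (\<Sum>j\<in>J. \<Sum>z\<in>?B. \<Sum>k\<in>J. \<Sum>z'\<in>?B. c j * c k * u (reflection i (X k) - X j + int L *s (z' - z)))"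
    proof (intro sum.cong refl)
      fix j z k z' assume "z \<in> ?B" "z' \<in> ?B"
      then have "z $ i = 0" "z' $ i = 0" using slab_hyperplane unfolding hyperplane_def by blast+
      then have "reflection i (?X (k, z')) - ?X (j, z) = reflection i (X k) - X j + int L *s (z' - z)"
        by (auto simp: vec_eq_iff algebra_simps)
      then show "c j * c k * u (reflection i (?X (k, z')) - ?X (j, z)) =
        c j * c k * u (reflection i (X k) - X j + int L *s (z' - z))" by (simp only:)
    qed
    also have "\<dots> = (\<Sum>z\<in>?B. \<Sum>z'\<in>?B. e (z' - z))"
    proof -
      let ?f = "\<lambda>j z k z'. c j * c k * u (reflection i (X k) - X j + int L *s (z' - z))"
      have "(\<Sum>j\<in>J. \<Sum>z\<in>?B. \<Sum>k\<in>J. \<Sum>z'\<in>?B. ?f j z k z') = (\<Sum>z\<in>?B. \<Sum>j\<in>J. \<Sum>k\<in>J. \<Sum>z'\<in>?B. ?f j z k z')"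
        by (rule sum.swap)
      also have "\<dots> = (\<Sum>z\<in>?B. \<Sum>j\<in>J. \<Sum>z'\<in>?B. \<Sum>k\<in>J. ?f j z k z')"
        by (intro sum.cong refl sum.swap)
      also have "\<dots> = (\<Sum>z\<in>?B. \<Sum>z'\<in>?B. \<Sum>j\<in>J. \<Sum>k\<in>J. ?f j z k z')"
        by (intro sum.cong refl sum.swap)
      finally show ?thesis unfolding e_def .
    qed
    finally show "0 \<le> (\<Sum>z\<in>?B. \<Sum>z'\<in>?B. e (z' - z))" .
  qed
  then show ?thesis using infsumI[OF hs] by simp
qed

end

context torus_weight
begin

lemma hyperplane_bij: "bij_betw (\<lambda>(n, z). z + axis i n) (UNIV \<times> hyperplane i) (UNIV :: (int ^ 'd) set)"
  by (rule bij_betw_byWitness[where f' = "\<lambda>x. (x $ i, x - axis i (x $ i))"])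
     (auto simp: hyperplane_def axis_def vec_eq_iff)

lemma p_slices:
  "((\<lambda>n. \<Sum>\<^sub>\<infinity>z\<in>hyperplane i. u (x + int L *s (z + axis i n))) has_sum p x) UNIV"
proof -
  let ?f = "\<lambda>(n, z). u (x + int L *s (z + axis i n))"
  have sm: "?f summable_on UNIV \<times> hyperplane i"
    using summable_on_reindex_bij_betw[OF hyperplane_bij, of "\<lambda>z. u (x + int L *s z)" i]
      summable_coset[OF L_pos, of x UNIV] by (simp add: case_prod_unfold)
  have "(\<Sum>\<^sub>\<infinity>n. \<Sum>\<^sub>\<infinity>z\<in>hyperplane i. u (x + int L *s (z + axis i n))) = infsum ?f (UNIV \<times> hyperplane i)"
    using infsum_Sigma'_banach[OF sm] by simp
  also have "\<dots> = p x" unfolding p_def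
    using infsum_reindex_bij_betw[OF hyperplane_bij, of "\<lambda>z. u (x + int L *s z)" i]
    by (simp add: case_prod_unfold)
  moreover have "(\<lambda>n. \<Sum>\<^sub>\<infinity>z\<in>hyperplane i. u (x + int L *s (z + axis i n))) summable_on UNIV"
    using summable_on_Sigma_banach[OF sm] by simp
  ultimately show ?thesis using has_sum_infsum by metis
qed

text \<open>Periodisation is split into slices by the image number \<open>n\<close> in direction
  \<open>i\<close>. With \<open>L = 2 l\<close>, slice \<open>n\<close> is the reflection in the
  plane at \<open>l n + 1 / 2\<close>; the points lie to the right of it for
  \<open>n \<le> 0\<close> and to the left of it for \<open>n > 0\<close>. Each slice is nonnegative
  separately.\<close>

lemma OS_p:
  fixes c :: "'j \<Rightarrow> real"
  assumes J: "finite J" "\<And>j. j \<in> J \<Longrightarrow> 1 \<le> X j $ i \<and> 2 * X j $ i \<le> int L"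
  shows "0 \<le> (\<Sum>j\<in>J. \<Sum>k\<in>J. c j * c k * p (reflection i (X k) - X j))"
proof -
  obtain l where l: "int L = 2 * l" using L_even by (metis dvd_def even_of_nat)
  let ?g = "\<lambda>n j k. \<Sum>\<^sub>\<infinity>z\<in>hyperplane i. u (reflection i (X k) - X j + int L *s (z + axis i n))"
  have hs: "((\<lambda>n. \<Sum>j\<in>J. \<Sum>k\<in>J. c j * c k * ?g n j k) has_sum
      (\<Sum>j\<in>J. \<Sum>k\<in>J. c j * c k * p (reflection i (X k) - X j))) UNIV"
    by (intro has_sum_finite_sum J(1) has_sum_cmult_right p_slices)
  have "0 \<le> (\<Sum>j\<in>J. \<Sum>k\<in>J. c j * c k * ?g n j k)" for n
  proof (cases "n \<le> 0")
    case True
    define Y where "Y = (\<lambda>j. X j + axis i (l * - n))"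
    have "Y j \<in> half_space i" if "j \<in> J" for j
    proof -
      have "0 \<le> l * - n" using l True by (intro mult_nonneg_nonneg) auto
      then show ?thesis using J(2)[OF that] by (simp add: Y_def half_space_def axis_def)
    qed
    then have "0 \<le> (\<Sum>j\<in>J. \<Sum>k\<in>J. c j * c k * (\<Sum>\<^sub>\<infinity>z\<in>hyperplane i. u (reflection i (Y k) - Y j + int L *s z)))"
      by (rule OS_hyperplane[OF J(1) _ L_pos])
    moreover have "reflection i (Y k) - Y j + int L *s z = reflection i (X k) - X j + int L *s (z + axis i n)" for j k z
      by (auto simp: vec_eq_iff Y_def axis_def l algebra_simps)
    ultimately show ?thesis by simp
  next
    case False
    \<comment> \<open>For positive \<open>n\<close> the points are mirrored to the positive side of
      their plane; \<open>u_flip\<close> undoes the reversed sign. The upper bound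
      \<open>2 * X j $ i \<le> int L\<close> makes the new coordinate positive.\<close>
    define Y where "Y = (\<lambda>j. \<chi> q. if q = i then l * n + 1 - X j $ i else X j $ q)"
    have "Y j \<in> half_space i" if "j \<in> J" for j
    proof -
      have "l * 1 \<le> l * n" using l False by (intro mult_left_mono) auto
      moreover have "X j $ i \<le> l" using J(2)[OF that] l by linarith
      ultimately show ?thesis by (simp add: Y_def half_space_def)
    qed
    then have "0 \<le> (\<Sum>j\<in>J. \<Sum>k\<in>J. c j * c k * (\<Sum>\<^sub>\<infinity>z\<in>hyperplane i. u (reflection i (Y k) - Y j + int L *s z)))"
      by (rule OS_hyperplane[OF J(1) _ L_pos])
    moreover have "(\<Sum>\<^sub>\<infinity>z\<in>hyperplane i. u (reflection i (Y k) - Y j + int L *s z)) = ?g n j k" for j k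
    proof (rule infsum_cong)
      fix z :: "int ^ 'd" assume "z \<in> hyperplane i"
      then have "flip i (reflection i (Y k) - Y j + int L *s z) = reflection i (X k) - X j + int L *s (z + axis i n)"
        by (auto simp: vec_eq_iff Y_def axis_def l hyperplane_def algebra_simps)
      then show "u (reflection i (Y k) - Y j + int L *s z) = u (reflection i (X k) - X j + int L *s (z + axis i n))"
        using u_flip by metis
    qed
    ultimately show ?thesis by simp
  qed
  then have "0 \<le> (\<Sum>\<^sub>\<infinity>n. \<Sum>j\<in>J. \<Sum>k\<in>J. c j * c k * ?g n j k)" by (intro infsum_nonneg) auto
  then show ?thesis using infsumI[OF hs] by simp
qed

end

section \<open>The two-point function on the torus\<close>

lemma shift_invariant_const:
  fixes H :: "int ^ 'd::finite \<Rightarrow> 'b"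
  assumes "\<And>x j. H (x + axis j 1) = H x"
  shows "H x = H 0"
proof -
  have step: "H (x + axis j n) = H x" for x j and n :: int
  proof (induction n rule: int_induct[where k = 0])
    case base
    have "x + axis j 0 = x" by (simp add: vec_eq_iff axis_def)
    then show ?case by (simp only:)
  next
    case (step1 n)
    have "x + axis j (n + 1) = (x + axis j n) + axis j 1" by (simp add: vec_eq_iff axis_def)
    then show ?case using step1 by (simp only: assms)
  next
    case (step2 n)
    have "x + axis j n = (x + axis j (n - 1)) + axis j 1" by (simp add: vec_eq_iff axis_def)
    then have "H (x + axis j n) = H (x + axis j (n - 1))" by (simp only: assms)
    then show ?case using step2 by metis
  qed
  have "H (\<Sum>j\<in>A. axis j (x $ j)) = H 0" if "finite A" for A
    using that
  proof (induction A rule: finite_induct)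
    case (insert j A)
    have "(\<Sum>j\<in>insert j A. axis j (x $ j)) = (\<Sum>j\<in>A. axis j (x $ j)) + axis j (x $ j)"
      using insert by (simp add: add.commute)
    then show ?case by (simp only: step insert)
  qed simp
  moreover have "(\<Sum>j\<in>UNIV. axis j (x $ j)) = x" by (simp add: vec_eq_iff axis_def)
  ultimately show ?thesis using finite_class.finite_UNIV by metis
qed

lemma minus_one_minus_mod:
  assumes "0 < (m :: int)"
  shows "(- a - 1) mod m = m - 1 - a mod m"
proof -
  have "- a - 1 = (m - 1 - a mod m) + m * (- (a div m) - 1)"
    using mult_div_mod_eq[of m a] by (simp add: algebra_simps)
  then have "(- a - 1) mod m = (m - 1 - a mod m) mod m" by (metis mod_mult_self2)
  also have "\<dots> = m - 1 - a mod m" using assms pos_mod_bound[OF assms, of a] pos_mod_sign[OF assms, of a]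
    by (intro mod_pos_pos_trivial) auto
  finally show ?thesis .
qed

context torus_weight
begin

lemma L_ge2: "2 \<le> L" using L_pos L_even by presburger

lemma T_in [simp]: "T x \<in> V" using to_torus_in[OF L_pos] .

lemma zero_in [simp]: "0 \<in> V" using zero_in_torus[OF L_pos] .

abbreviation "P \<equiv> periodised L w"

sublocale D: dimer_graph V P
  by unfold_locales (auto simp: periodised_eq p_nonneg, metis minus_diff_eq p_minus)

lemma P_row: "(\<Sum>y\<in>V. P x y) = 1"
  using sum_torus_shift[OF L_pos p_periodic, of "- x"] sum_p unfolding periodised_eq by simp

lemma P_self: "\<forall>x\<in>V. P x x = 0"
  unfolding periodised_eq using p_even[of 0] by (simp add: coord_sum_def)

lemma axis_in_V: "axis i 1 \<in> V"
  using L_ge2 by (auto simp: torus_def axis_def)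

lemma Z_pos: "0 < D.Z V"
proof -
  fix i :: 'd
  \<comment> \<open>Exchanges the coordinate values \<open>2 a\<close> and \<open>2 a + 1\<close> in
    one direction, which tiles the torus by dimers because \<open>L\<close> is even.\<close>
  define f where "f = (\<lambda>x :: int ^ 'd. x + axis i (if even (x $ i) then 1 else - 1))"
  show ?thesis
  proof (rule D.Z_pos_involution[of _ f])
    fix x :: "int ^ 'd" assume x: "x \<in> V"
    then have xi: "0 \<le> x $ i" "x $ i < int L" unfolding torus_def by auto
    have fi: "0 \<le> f x $ i \<and> f x $ i < int L"
    proof (cases "even (x $ i)")
      case True
      then have "x $ i + 1 \<noteq> int L" using L_even by (metis even_add even_of_nat odd_one)
      then show ?thesis using True xi by (simp add: f_def axis_def)
    next
      case False
      then have "x $ i \<noteq> 0" by (metis even_zero)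
      then show ?thesis using False xi by (simp add: f_def axis_def)
    qed
    have "f x \<in> V" unfolding torus_def
    proof (intro CollectI allI)
      fix j
      show "0 \<le> f x $ j \<and> f x $ j < int L"
        using fi x by (cases "j = i") (auto simp: f_def torus_def axis_def)
    qed
    moreover have "f x \<noteq> x" by (auto simp: f_def vec_eq_iff axis_def)
    moreover have "f (f x) = x" by (auto simp: f_def vec_eq_iff axis_def)
    moreover have "0 < P x (f x)"
    proof -
      have "f x - x = axis i 1 \<or> f x - x = - axis i 1" by (auto simp: f_def vec_eq_iff axis_def)
      then show ?thesis unfolding periodised_eq using p_axis_pos[of i] p_minus[of "axis i 1"] by auto
    qed
    ultimately show "f x \<in> V \<and> f x \<noteq> x \<and> f (f x) = x \<and> 0 < P x (f x)" by blast
  qed simp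
qed

definition \<gamma> :: "int ^ 'd \<Rightarrow> real" where "\<gamma> v = D.G0 0 (T v) / D.Z V"

lemma torus_G_eq: "torus_G L w v = \<gamma> v"
  unfolding torus_G_def \<gamma>_def by (rule D.mdd_G_eq[OF P_self zero_in T_in])

lemma \<gamma>_periodic: "periodic L \<gamma>"
  unfolding periodic_def \<gamma>_def by simp

lemma \<gamma>_T [simp]: "\<gamma> (T x) = \<gamma> x"
  using periodicD[OF \<gamma>_periodic] .

lemma G0_eq: "D.G0 x y = D.Z V * \<gamma> (y - x)" if "x \<in> V" "y \<in> V"
proof -
  let ?f = "\<lambda>v. T (v + (- x))"
  have "inj_on ?f V" "?f ` V \<subseteq> V"
    using bij_torus_shift[OF L_pos, of "- x"] unfolding bij_betw_def by blast+
  moreover have "P (?f a) (?f b) = P a b" for a b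
    unfolding periodised_eq using p_T[of "?f b - ?f a"] p_T[of "b - a"] by simp
  ultimately have "D.G0 (?f x) (?f y) = D.G0 x y" using that by (intro D.G0_image) auto
  moreover have "?f x = 0" using L_pos by (simp add: vec_eq_iff)
  ultimately show ?thesis using Z_pos unfolding \<gamma>_def by simp
qed

lemma \<gamma>_minus [simp]: "\<gamma> (- v) = \<gamma> v"
proof -
  have "D.Z V * \<gamma> (- v) = D.Z V * \<gamma> (0 - T v)" using \<gamma>_T[of "- T v"] \<gamma>_T[of "- v"] by simp
  also have "\<dots> = D.G0 (T v) 0" using G0_eq[of "T v" 0] T_in zero_in by simp
  also have "\<dots> = D.Z V * \<gamma> v" unfolding \<gamma>_def using Z_pos by (simp add: D.G0_sym)
  finally show ?thesis using Z_pos by simp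
qed

lemma \<gamma>_nonneg: "0 \<le> \<gamma> v"
  unfolding \<gamma>_def using Z_pos D.G0_nonneg by simp

lemma \<gamma>_even: "even (coord_sum v) \<Longrightarrow> \<gamma> v = 0"
  unfolding \<gamma>_def
  using D.G0_bipartite[of "\<lambda>x. even (coord_sum x)" 0 "T v"] Z_pos zero_in T_in
  by (simp add: periodised_eq p_even coord_sum_diff even_coord_sum_torus[OF L_even]) (simp add: coord_sum_def)

text \<open>\<open>p v * \<gamma> v\<close> is the probability that the origin is joined to
  \<open>v\<close> in one random covering, and the origin has exactly one partner.\<close>

lemma sum_p_\<gamma>: "(\<Sum>v\<in>V. p v * \<gamma> v) = 1"
proof -
  have "D.Z V = (\<Sum>v\<in>V. P 0 v * D.G0 0 v)" by (rule D.Z_remove) (rule zero_in)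
  also have "\<dots> = (\<Sum>v\<in>V. p v * (D.Z V * \<gamma> v))"
    by (intro sum.cong refl) (simp add: periodised_eq G0_eq zero_in)
  also have "\<dots> = D.Z V * (\<Sum>v\<in>V. p v * \<gamma> v)" by (simp add: sum_distrib_left mult_ac)
  finally show ?thesis using Z_pos by simp
qed

lemma p_\<gamma>_le: "p v * \<gamma> v \<le> 1"
proof -
  have "p (T v) * \<gamma> (T v) \<le> (\<Sum>v\<in>V. p v * \<gamma> v)"
    using T_in p_nonneg \<gamma>_nonneg by (intro member_le_sum) auto
  then show ?thesis using sum_p_\<gamma> by simp
qed

text \<open>The reflection \<open>mirror i c\<close> is the one through the plane \<open>x\<^sub>i = c + 1 / 2\<close>, and \<open>half i c\<close> is the
  side \<open>c < x\<^sub>i \<le> c + L / 2\<close> of it.\<close>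

definition half :: "'d \<Rightarrow> int \<Rightarrow> (int ^ 'd) set" where
  "half i c = {x \<in> V. 2 * ((x $ i - c - 1) mod int L) < int L}"

text \<open>The reflection before projection to the torus, so that identities between coordinates
  can be checked without residues.\<close>

definition mirror_lift :: "'d \<Rightarrow> int \<Rightarrow> int ^ 'd \<Rightarrow> int ^ 'd" where
  "mirror_lift i c x = (\<chi> j. if j = i then 2 * c + 1 - x $ j else x $ j)"

definition mirror :: "'d \<Rightarrow> int \<Rightarrow> int ^ 'd \<Rightarrow> int ^ 'd" where
  "mirror i c x = T (mirror_lift i c x)"

lemma mirror_lift_nth [simp]: "mirror_lift i c x $ j = (if j = i then 2 * c + 1 - x $ j else x $ j)"
  unfolding mirror_lift_def by simp

lemma mirror_T [simp]: "mirror i c (T x) = mirror i c x"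
  unfolding mirror_def by (simp add: vec_eq_iff mod_simps)

lemma mirror_in: "mirror i c x \<in> V"
  unfolding mirror_def using L_pos by (rule to_torus_in)

lemma mirror_mirror: "x \<in> V \<Longrightarrow> mirror i c (mirror i c x) = x"
proof -
  assume x: "x \<in> V"
  have "mirror i c (mirror i c x) = mirror i c (mirror_lift i c x)" unfolding mirror_def[of i c x] by simp
  also have "\<dots> = T x" unfolding mirror_def by (rule arg_cong[of _ _ T]) (simp add: vec_eq_iff)
  finally show ?thesis using to_torus_id[OF x] by simp
qed

lemma mirror_half:
  assumes "x \<in> V"
  shows "mirror i c x \<in> half i c \<longleftrightarrow> x \<notin> half i c"
proof -
  have L: "0 < int L" using L_pos by simp
  have "(mirror i c x $ i - c - 1) mod int L = (- (x $ i - c - 1) - 1) mod int L"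
    unfolding mirror_def by (simp add: mod_simps algebra_simps)
  also have "\<dots> = int L - 1 - (x $ i - c - 1) mod int L" by (rule minus_one_minus_mod[OF L])
  finally show ?thesis using assms mirror_in L_even unfolding half_def by auto
qed

text \<open>The map \<open>X\<close> moves coordinate \<open>i\<close> of \<open>half i c\<close>
  into the range from 1 to \<open>L / 2\<close>. Up to multiples of \<open>L\<close> the mirror then
  becomes the standard reflection, to which \<open>OS_p\<close> applies.\<close>

lemma OS_mirror: "psd (half i c) (\<lambda>x y. P x (mirror i c y))"
proof -
  define X where "X = (\<lambda>x :: int ^ 'd. \<chi> j. if j = i then (x $ i - c - 1) mod int L + 1 else x $ j)"
  have eq: "P x (mirror i c y) = p (mirror_lift i c y - x)" for x y
    unfolding periodised_eq mirror_def using p_T[of "T (mirror_lift i c y) - x"] p_T[of "mirror_lift i c y - x"] by simp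
  have eq': "p (mirror_lift i c y - x) = p (reflection i (X y) - X x)" for x y
  proof (rule periodic_eq[OF p_periodic])
    show "T (mirror_lift i c y - x) = T (reflection i (X y) - X x)"
      unfolding vec_eq_iff to_torus_nth
    proof
      fix j
      show "(mirror_lift i c y - x) $ j mod int L = (reflection i (X y) - X x) $ j mod int L"
      proof (cases "j = i")
        case True
        have "(reflection i (X y) - X x) $ j mod int L
            = (1 - ((y $ i - c - 1) mod int L + 1) - ((x $ i - c - 1) mod int L + 1)) mod int L"
          using True by (simp add: X_def)
        also have "\<dots> = (1 - ((y $ i - c - 1) + 1) - ((x $ i - c - 1) + 1)) mod int L"
          by (intro mod_diff_cong mod_add_cong) simp_all
        finally show ?thesis using True by (simp add: algebra_simps)
      qed (simp add: X_def)
    qed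
  qed
  have sym: "p (mirror_lift i c y - x) = p (mirror_lift i c x - y)" for x y
  proof -
    have "mirror_lift i c x - y = - flip i (mirror_lift i c y - x)" by (simp add: vec_eq_iff)
    then show ?thesis by (simp add: p_flip)
  qed
  have fin: "finite (half i c)" unfolding half_def by simp
  have pos: "0 \<le> (\<Sum>x\<in>half i c. \<Sum>y\<in>half i c. s x * s y * p (reflection i (X y) - X x))" for s
  proof (rule OS_p[OF fin])
    fix x assume "x \<in> half i c"
    then show "1 \<le> X x $ i \<and> 2 * X x $ i \<le> int L"
      using L_even L_pos unfolding half_def X_def by auto
  qed
  show ?thesis unfolding psd_def eq using sym pos unfolding eq' by blast
qed

lemma reflected: "reflected_graph V P (mirror i c) (half i c)"
proof -
  have U: "V = half i c \<union> mirror i c ` half i c"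
  proof (intro equalityI subsetI)
    fix x assume x: "x \<in> V"
    show "x \<in> half i c \<union> mirror i c ` half i c"
    proof (cases "x \<in> half i c")
      case False
      then have "mirror i c x \<in> half i c" using mirror_half[OF x] by blast
      then show ?thesis using mirror_mirror[OF x] by (metis UnI2 imageI)
    qed simp
  qed (auto simp: half_def mirror_in)
  moreover have "half i c \<inter> mirror i c ` half i c = {}"
    using mirror_half by (auto simp: half_def)
  moreover have "P (mirror i c x) (mirror i c y) = P x y" for x y
  proof -
    have "p (mirror i c y - mirror i c x) = p (mirror_lift i c y - mirror_lift i c x)"
      unfolding mirror_def using p_T[of "T (mirror_lift i c y) - T (mirror_lift i c x)"] p_T[of "mirror_lift i c y - mirror_lift i c x"] by simp
    moreover have "mirror_lift i c y - mirror_lift i c x = flip i (y - x)" by (simp add: vec_eq_iff)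
    ultimately show ?thesis unfolding periodised_eq by (simp add: p_flip)
  qed
  ultimately show ?thesis
    using mirror_mirror OS_mirror D.dimer_graph_axioms
    by (intro reflected_graph.intro reflected_graph_axioms.intro) auto
qed

text \<open>Nearest neighbours on the torus. This relation is the perturbation \<open>N\<close> in
  Gaussian domination: it detects any jump of a nonconstant function.\<close>

definition adj :: "int ^ 'd \<Rightarrow> int ^ 'd \<Rightarrow> bool" where
  "adj x y \<longleftrightarrow> (\<exists>j. y = T (x + axis j 1) \<or> x = T (y + axis j 1))"

lemma mirror_step:
  "mirror i c (T (x + axis j 1)) = (if j = i then T (mirror i c x - axis i 1) else T (mirror i c x + axis j 1))"
  unfolding mirror_def by (auto simp: vec_eq_iff axis_def mod_simps intro: arg_cong[of _ _ "\<lambda>a. a mod int L"])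

lemma adj_mirror1:
  assumes "x \<in> V" "y \<in> V" "adj x y"
  shows "adj (mirror i c x) (mirror i c y)"
proof -
  have "adj (mirror i c x) (mirror i c (T (x + axis j 1)))" "adj (mirror i c (T (x + axis j 1))) (mirror i c x)"
    if "x \<in> V" for x j
  proof -
    have "adj (mirror i c x) (mirror i c (T (x + axis j 1))) \<and> adj (mirror i c (T (x + axis j 1))) (mirror i c x)"
    proof (cases "j = i")
      case True
      have "mirror i c x = T (T (mirror i c x - axis i 1) + axis i 1)"
        using to_torus_id[OF mirror_in, of i c x] by simp
      then show ?thesis unfolding adj_def mirror_step if_P[OF True] by blast
    next
      case False
      then show ?thesis unfolding mirror_step adj_def by auto
    qed
    then show "adj (mirror i c x) (mirror i c (T (x + axis j 1)))" "adj (mirror i c (T (x + axis j 1))) (mirror i c x)" by auto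
  qed
  then show ?thesis using assms unfolding adj_def[of x y] by auto
qed

lemma adj_mirror:
  assumes "x \<in> V" "y \<in> V"
  shows "adj (mirror i c x) (mirror i c y) \<longleftrightarrow> adj x y"
  using adj_mirror1[OF assms] adj_mirror1[OF mirror_in mirror_in, of i c x i c y i c] mirror_mirror assms by auto

text \<open>With \<open>a\<close> and \<open>b\<close> the numbers of steps from the plane, the
  points \<open>x\<close> and \<open>mirror i c y\<close> differ by \<open>a + b + 1\<close> modulo
  \<open>L\<close> in direction \<open>i\<close>. This lies strictly between 0 and \<open>L\<close>,
  so adjacency forces both points to be next to the plane, or both next to the opposite plane; the
  other coordinates agree.\<close>

lemma adj_cross:
  assumes x: "x \<in> half i c" and y: "y \<in> half i c" and a: "adj x (mirror i c y)"
  shows "x = y"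
proof -
  have V: "x \<in> V" "y \<in> V" using x y unfolding half_def by auto
  define a where "a = (x $ i - c - 1) mod int L"
  define b where "b = (y $ i - c - 1) mod int L"
  have L: "0 < int L" using L_pos by simp
  have ab: "0 \<le> a" "0 \<le> b" "2 * a < int L" "2 * b < int L"
    using x y L unfolding half_def a_def b_def by auto
  have key: "\<exists>j e. (e = 1 \<or> e = -1) \<and> (\<forall>q. (mirror_lift i c y $ q - x $ q - (if q = j then e else 0)) mod int L = 0)"
  proof -
    obtain j where "mirror i c y = T (x + axis j 1) \<or> x = T (mirror i c y + axis j 1)" using a unfolding adj_def by blast
    then show ?thesis
    proof
      assume h: "mirror i c y = T (x + axis j 1)"
      have "(mirror_lift i c y $ q - x $ q - (if q = j then 1 else 0)) mod int L = 0" for q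
      proof -
        have "mirror_lift i c y $ q mod int L = (x + axis j 1) $ q mod int L"
          using h unfolding mirror_def vec_eq_iff to_torus_nth by blast
        then have "(mirror_lift i c y $ q - (x + axis j 1) $ q) mod int L = 0"
          by (simp only: mod_eq_dvd_iff dvd_eq_mod_eq_0[symmetric])
        then show ?thesis by (simp add: axis_def algebra_simps split: if_splits)
      qed
      then show ?thesis by (intro exI[of _ j] exI[of _ 1]) auto
    next
      assume "x = T (mirror i c y + axis j 1)"
      then have h: "x = T (mirror_lift i c y + axis j 1)" unfolding mirror_def by simp
      have "(mirror_lift i c y $ q - x $ q - (if q = j then - 1 else 0)) mod int L = 0" for q
      proof -
        have "x $ q mod int L = (mirror_lift i c y + axis j 1) $ q mod int L"
          using arg_cong[OF h, of "\<lambda>v. v $ q mod int L"] by simp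
        then have "((mirror_lift i c y + axis j 1) $ q - x $ q) mod int L = 0"
          by (metis mod_eq_dvd_iff dvd_eq_mod_eq_0)
        then show ?thesis by (simp add: axis_def algebra_simps split: if_splits)
      qed
      then show ?thesis by (intro exI[of _ j] exI[of _ "-1"]) auto
    qed
  qed
  then obtain j e where e: "e = 1 \<or> e = -1"
    and k: "\<And>q. int L dvd mirror_lift i c y $ q - x $ q - (if q = j then e else 0)"
    unfolding dvd_eq_mod_eq_0 by blast
  have d: "int L dvd a - (x $ i - c - 1)" "int L dvd b - (y $ i - c - 1)"
    unfolding a_def b_def by (simp_all add: mod_eq_dvd_iff[symmetric])
  have "int L dvd (mirror_lift i c y $ i - x $ i - (if i = j then e else 0))
      + (- 1) * ((a - (x $ i - c - 1)) + (b - (y $ i - c - 1)))"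
    by (rule dvd_add[OF k[of i] dvd_mult[OF dvd_add[OF d]]])
  also have "(mirror_lift i c y $ i - x $ i - (if i = j then e else 0))
      + (- 1) * ((a - (x $ i - c - 1)) + (b - (y $ i - c - 1))) = - (a + b + 1 + (if i = j then e else 0))"
    by simp
  finally have dv: "int L dvd a + b + 1 + (if i = j then e else 0)" by (simp only: dvd_minus_iff)
  have bd: "a + b + 1 < int L" using ab L_even by presburger
  have ij: "i = j"
  proof (rule ccontr)
    assume "i \<noteq> j"
    then have "int L dvd a + b + 1" using dv by simp
    then show False using zdvd_imp_le[of "int L" "a + b + 1"] bd ab by simp
  qed
  have "a = b"
  proof (cases "e = 1")
    case True
    then have "int L dvd a + b + 2" using dv ij by (simp add: algebra_simps)
    then have "int L \<le> a + b + 2" using zdvd_imp_le ab by simp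
    then show ?thesis using ab L_even by presburger
  next
    case False
    then have "int L dvd a + b" using dv ij e by simp
    then have "a + b = 0" using zdvd_imp_le[of "int L" "a + b"] ab bd by fastforce
    then show ?thesis using ab by simp
  qed
  have rng: "0 \<le> x $ q" "x $ q < int L" "0 \<le> y $ q" "y $ q < int L" for q
    using V unfolding torus_def by auto
  have "x $ q = y $ q" for q
  proof (cases "q = i")
    case True
    have "(x $ i - c - 1) mod int L = (y $ i - c - 1) mod int L" using \<open>a = b\<close> unfolding a_def b_def .
    then have "int L dvd (x $ i - c - 1) - (y $ i - c - 1)" by (simp only: mod_eq_dvd_iff)
    then have "int L dvd x $ i - y $ i" by simp
    then have "x $ i mod int L = y $ i mod int L" by (simp only: mod_eq_dvd_iff)
    then show ?thesis using True rng[of i] by simp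
  next
    case False
    then have "int L dvd y $ q - x $ q" using k[of q] ij by simp
    then have "y $ q mod int L = x $ q mod int L" by (simp only: mod_eq_dvd_iff)
    then show ?thesis using rng[of q] by simp
  qed
  then show ?thesis by (simp add: vec_eq_iff)
qed

text \<open>A nonconstant function jumps across some nearest-neighbour edge. For the mirror that
  bisects this edge, \<open>adj_cross\<close> turns the form of \<open>adj\<close> into a sum of
  squares of jumps, one of which is positive.\<close>

theorem quad_K_nonpos: "quad V D.K h \<le> 0"
proof (rule quad_nonpos[where J = UNIV and \<theta> = "\<lambda>(i, c). mirror i c" and L = "\<lambda>(i, c). half i c"
      and N = "\<lambda>x y. of_bool (adj x y)"])
  note R = reflected_graph.reflects[OF reflected] reflected_graph.K_\<theta>[OF reflected]
    reflected_graph.K_cross_nonneg[OF reflected]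
  show "finite V" by simp
  show "V \<noteq> {}" using zero_in by blast
  show "reflects V ((\<lambda>(i, c). mirror i c) q) ((\<lambda>(i, c). half i c) q)" for q :: "'d \<times> int"
    by (cases q) (simp add: R)
  show "D.K ((\<lambda>(i, c). mirror i c) q x) ((\<lambda>(i, c). mirror i c) q y) = D.K x y"
    if "x \<in> V" "y \<in> V" for q :: "'d \<times> int" and x y
    using that by (cases q) (simp add: R)
  show "of_bool (adj ((\<lambda>(i, c). mirror i c) q x) ((\<lambda>(i, c). mirror i c) q y)) = (of_bool (adj x y) :: real)"
    if "x \<in> V" "y \<in> V" for q :: "'d \<times> int" and x y
    using that by (cases q) (simp add: adj_mirror)
  show "0 \<le> (\<Sum>x\<in>(\<lambda>(i, c). half i c) q. \<Sum>y\<in>(\<lambda>(i, c). half i c) q. D.K x ((\<lambda>(i, c). mirror i c) q y) * s x * s y)"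
    for q :: "'d \<times> int" and s
    by (cases q) (simp add: R)
  show "(\<Sum>y\<in>V. D.K x y) = 0" if "x \<in> V" for x
    using that P_row by (intro D.K_row) auto
next
  fix g :: "int ^ 'd \<Rightarrow> real"
  assume nc: "\<exists>x\<in>V. \<exists>y\<in>V. g x \<noteq> g y"
  have "\<exists>x\<in>V. \<exists>j. g (T (x + axis j 1)) \<noteq> g x"
  proof (rule ccontr)
    assume "\<not> ?thesis"
    then have n: "g (T (x + axis j 1)) = g x" if "x \<in> V" for x j using that by blast
    have "g (T (x + axis j 1)) = g (T x)" for x j
      using n[OF T_in, of x j] by simp
    then have "g (T x) = g (T 0)" for x
      using shift_invariant_const[of "\<lambda>x. g (T x)"] by blast
    then show False using nc to_torus_id by metis
  qed
  then obtain x i where x: "x \<in> V" "g (T (x + axis i 1)) \<noteq> g x" by blast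
  define c where "c = x $ i"
  define y where "y = T (x + axis i 1)"
  have yV: "y \<in> V" unfolding y_def by (rule T_in)
  have yh: "y \<in> half i c"
  proof -
    have "((x $ i + 1) mod int L - (x $ i + 1)) mod int L = 0" by (simp only: mod_diff_left_eq) simp
    moreover have "y $ i - c - 1 = (x $ i + 1) mod int L - (x $ i + 1)"
      unfolding y_def c_def by (simp add: axis_def)
    ultimately have "(y $ i - c - 1) mod int L = 0" by (simp only:)
    then show ?thesis using yV L_pos unfolding half_def mem_Collect_eq by (simp only: mult_zero_right of_nat_0_less_iff simp_thms)
  qed
  have "mirror i c y = mirror i c (x + axis i 1)" unfolding y_def by simp
  also have "\<dots> = T x" unfolding mirror_def c_def by (rule arg_cong[of _ _ T]) (simp add: vec_eq_iff axis_def)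
  finally have my: "mirror i c y = x" using to_torus_id[OF x(1)] by simp
  have ad: "adj y (mirror i c y)" unfolding my adj_def using y_def by blast
  let ?s = "\<lambda>x. g x - g (mirror i c x)"
  have fin: "finite (half i c)" unfolding half_def by simp
  have "(\<Sum>a\<in>half i c. \<Sum>b\<in>half i c. of_bool (adj a (mirror i c b)) * ?s a * ?s b)
      = (\<Sum>a\<in>half i c. \<Sum>b\<in>half i c. if b = a then of_bool (adj a (mirror i c a)) * (?s a)\<^sup>2 else 0)"
    by (intro sum.cong refl) (use adj_cross in \<open>auto simp: power2_eq_square\<close>)
  also have "\<dots> = (\<Sum>a\<in>half i c. of_bool (adj a (mirror i c a)) * (?s a)\<^sup>2)" using fin by simp
  also have "\<dots> > 0"
  proof (rule sum_pos2[OF fin yh])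
    show "0 < of_bool (adj y (mirror i c y)) * (?s y)\<^sup>2" using ad x(2) my by (simp add: y_def)
  qed auto
  finally show "\<exists>q\<in>UNIV. 0 < (\<Sum>x\<in>(\<lambda>(i, c). half i c) q. \<Sum>y\<in>(\<lambda>(i, c). half i c) q.
      of_bool (adj x ((\<lambda>(i, c). mirror i c) q y)) * (g x - g ((\<lambda>(i, c). mirror i c) q x)) * (g y - g ((\<lambda>(i, c). mirror i c) q y)))"
    by (intro bexI[of _ "(i, c)"]) auto
qed

text \<open>Cauchy-Schwarz for \<open>psd_G0\<close> at the plane \<open>-1 / 2\<close>. The points
  are chosen with coordinates \<open>a - 1\<close> and \<open>b - 1\<close> in direction
  \<open>i\<close>, so that they are \<open>2 * a - 1\<close> and \<open>2 * b - 1\<close> away from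
  their own images. All transverse components of \<open>v\<close> are put into one point and
  disappear on the right.\<close>

lemma \<gamma>_cauchy:
  assumes "1 \<le> a" "2 * a \<le> int L" "1 \<le> b" "2 * b \<le> int L" "v $ i = a + b - 1"
  shows "(\<gamma> v)\<^sup>2 \<le> \<gamma> (axis i (2 * a - 1)) * \<gamma> (axis i (2 * b - 1))"
proof -
  define x where "x = T (axis i (a - 1))"
  define y where "y = T (\<chi> j. if j = i then b - 1 else - v $ j)"
  have fin: "finite (half i (-1))" unfolding half_def by simp
  have V: "x \<in> V" "y \<in> V" unfolding x_def y_def using T_in by blast+
  have h: "x \<in> half i (-1)" "y \<in> half i (-1)"
    using V assms unfolding half_def x_def y_def by (auto simp: axis_def)
  have G: "D.G0 q (mirror i (-1) r) = D.Z V * \<gamma> (mirror_lift i (-1) r - q)" if "q \<in> V" "r \<in> V" for q r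
    using G0_eq[OF that(1) mirror_in] \<gamma>_T[of "mirror i (-1) r - q"] \<gamma>_T[of "mirror_lift i (-1) r - q"]
    unfolding mirror_def by simp
  have g: "\<gamma> (mirror_lift i (-1) y - x) = \<gamma> v" "\<gamma> (mirror_lift i (-1) x - x) = \<gamma> (axis i (2 * a - 1))"
    "\<gamma> (mirror_lift i (-1) y - y) = \<gamma> (axis i (2 * b - 1))"
  proof -
    have ab: "(a - 1) mod int L = a - 1" "(b - 1) mod int L = b - 1"
      using assms by (auto intro!: mod_pos_pos_trivial)
    have "T (mirror_lift i (-1) y - x) = T (- v)" using assms(5) ab
      by (auto simp: vec_eq_iff x_def y_def axis_def mod_simps intro: arg_cong[of _ _ "\<lambda>a. a mod int L"])
    then show "\<gamma> (mirror_lift i (-1) y - x) = \<gamma> v" using periodic_eq[OF \<gamma>_periodic] \<gamma>_minus by metis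
    have "T (mirror_lift i (-1) x - x) = T (- axis i (2 * a - 1))"
      using ab by (auto simp: vec_eq_iff x_def axis_def mod_simps intro: arg_cong[of _ _ "\<lambda>a. a mod int L"])
    then show "\<gamma> (mirror_lift i (-1) x - x) = \<gamma> (axis i (2 * a - 1))" using periodic_eq[OF \<gamma>_periodic] \<gamma>_minus by metis
    have "T (mirror_lift i (-1) y - y) = T (- axis i (2 * b - 1))"
      using ab by (auto simp: vec_eq_iff y_def axis_def mod_simps intro: arg_cong[of _ _ "\<lambda>a. a mod int L"])
    then show "\<gamma> (mirror_lift i (-1) y - y) = \<gamma> (axis i (2 * b - 1))" using periodic_eq[OF \<gamma>_periodic] \<gamma>_minus by metis
  qed
  have "(D.G0 x (mirror i (-1) y))\<^sup>2 \<le> D.G0 x (mirror i (-1) x) * D.G0 y (mirror i (-1) y)"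
    using psd_cauchy(1)[OF reflected_graph.psd_G0[OF reflected] fin h] .
  then have "(D.Z V)\<^sup>2 * (\<gamma> v)\<^sup>2 \<le> (D.Z V)\<^sup>2 * (\<gamma> (axis i (2 * a - 1)) * \<gamma> (axis i (2 * b - 1)))"
    unfolding G[OF V(1,2)] G[OF V(1,1)] G[OF V(2,2)] g by (simp add: power2_eq_square mult_ac)
  then show ?thesis using Z_pos by simp
qed

lemma \<gamma>_axis_reflect: "\<gamma> (axis i (int L - n)) = \<gamma> (axis i n)"
proof -
  have "T (axis i (int L - n)) = T (- axis i n)" by (simp add: vec_eq_iff axis_def mod_simps)
  then show ?thesis using periodic_eq[OF \<gamma>_periodic] \<gamma>_minus by metis
qed

text \<open>Log-convexity on odd integers and the symmetry \<open>n \<mapsto> L - n\<close> place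
  the maximum over the symmetric interval at its ends. At the smallest maximiser, if it were
  interior, the left factor in \<open>\<gamma>_cauchy\<close> would be strictly below the
  maximum.\<close>

lemma \<gamma>_axis_le:
  assumes "odd n0" "1 \<le> n0" "odd n" "n0 \<le> n" "n \<le> int L - n0"
  shows "\<gamma> (axis i n) \<le> \<gamma> (axis i n0)"
proof -
  let ?A = "\<lambda>n. \<gamma> (axis i n)"
  let ?S = "{n \<in> {n0..int L - n0}. odd n}"
  define M where "M = Max (?A ` ?S)"
  have fin: "finite ?S" by (rule finite_subset[of _ "{n0..int L - n0}"]) auto
  have nS: "n \<in> ?S" using assms by simp
  have le: "?A m \<le> M" if "m \<in> ?S" for m unfolding M_def using that fin by simp
  have "M \<in> ?A ` ?S" unfolding M_def using nS fin by (intro Max_in) auto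
  then have ne: "{m \<in> ?S. ?A m = M} \<noteq> {}" by blast
  define m where "m = Min {m \<in> ?S. ?A m = M}"
  have fin': "finite {m \<in> ?S. ?A m = M}" by (rule finite_subset[OF _ fin]) auto
  have "m \<in> {m \<in> ?S. ?A m = M}" unfolding m_def by (rule Min_in[OF fin' ne])
  then have m: "m \<in> ?S" "?A m = M" by auto
  have min: "m \<le> k" if "k \<in> ?S" "?A k = M" for k unfolding m_def using that by (intro Min_le[OF fin']) blast
  have "m = n0"
  proof (rule ccontr)
    assume "m \<noteq> n0"
    then have gt: "n0 + 2 \<le> m" using m(1) assms(1) by auto presburger
    have n0S: "n0 \<in> ?S" using assms by auto
    have "m \<noteq> int L - n0"
    proof
      assume "m = int L - n0"
      then have "?A n0 = M" using \<gamma>_axis_reflect[of i n0] m(2) by simp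
      then show False using min[OF n0S] gt by linarith
    qed
    then have up: "m + 2 \<le> int L - n0" using m(1) assms(1) L_even by auto presburger
    have S': "m - 2 \<in> ?S" "m + 2 \<in> ?S" using gt up m(1) by auto
    obtain a where a: "m = 2 * a + 1" using m(1) by (auto elim: oddE)
    have "(?A m)\<^sup>2 \<le> \<gamma> (axis i (2 * a - 1)) * \<gamma> (axis i (2 * (a + 2) - 1))"
      using gt up assms(2) a by (intro \<gamma>_cauchy) (auto simp: axis_def)
    also have "2 * a - 1 = m - 2" using a by simp
    also have "2 * (a + 2) - 1 = m + 2" using a by simp
    finally have c: "M\<^sup>2 \<le> ?A (m - 2) * ?A (m + 2)" using m(2) by simp
    have lt: "?A (m - 2) < M" using le[OF S'(1)] min[OF S'(1)] by fastforce
    have "?A (m - 2) * ?A (m + 2) \<le> ?A (m - 2) * M" using le[OF S'(2)] \<gamma>_nonneg by (intro mult_left_mono)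
    also have "\<dots> < M * M" using lt \<gamma>_nonneg[of "axis i (m - 2)"] by (intro mult_strict_right_mono) auto
    finally show False using c by (simp add: power2_eq_square)
  qed
  then show ?thesis using le[OF nS] m(2) by simp
qed

text \<open>For odd \<open>v $ i\<close> both factors of \<open>\<gamma>_cauchy\<close> sit at
  distance \<open>v $ i\<close>. For even \<open>v $ i\<close> they sit at the two odd neighbours,
  which is why one more unit of room is required at each end.\<close>

lemma \<gamma>_le_axis:
  assumes "odd n0" "1 \<le> n0" "n0 + 1 \<le> v $ i \<or> (odd (v $ i) \<and> n0 \<le> v $ i)"
    "v $ i \<le> int L - n0 - 1 \<or> (odd (v $ i) \<and> v $ i \<le> int L - n0)"
  shows "\<gamma> v \<le> \<gamma> (axis i n0)"
proof (cases "odd (v $ i)")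
  case True
  then obtain a where a: "v $ i = 2 * a + 1" by (elim oddE)
  have b: "n0 \<le> v $ i" "v $ i \<le> int L - n0" using assms by auto
  have "(\<gamma> v)\<^sup>2 \<le> \<gamma> (axis i (2 * (a + 1) - 1)) * \<gamma> (axis i (2 * (a + 1) - 1))"
    using a b assms(2) L_even by (intro \<gamma>_cauchy) auto
  also have "2 * (a + 1) - 1 = v $ i" using a by simp
  finally have "(\<gamma> v)\<^sup>2 \<le> (\<gamma> (axis i (v $ i)))\<^sup>2" by (simp add: power2_eq_square)
  then have "\<gamma> v \<le> \<gamma> (axis i (v $ i))" using \<gamma>_nonneg power2_le_imp_le by blast
  also have "\<dots> \<le> \<gamma> (axis i n0)" using True b assms by (intro \<gamma>_axis_le) auto
  finally show ?thesis .
next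
  case False
  then obtain a where a: "v $ i = 2 * a" by (auto elim: evenE)
  have b: "n0 + 1 \<le> v $ i" "v $ i \<le> int L - n0 - 1" using assms False by auto
  have "(\<gamma> v)\<^sup>2 \<le> \<gamma> (axis i (2 * a - 1)) * \<gamma> (axis i (2 * (a + 1) - 1))"
    using a b assms(2) L_even by (intro \<gamma>_cauchy) auto
  also have "\<dots> \<le> \<gamma> (axis i n0) * \<gamma> (axis i n0)"
    using a b assms \<gamma>_nonneg by (intro mult_mono \<gamma>_axis_le) auto
  finally have "(\<gamma> v)\<^sup>2 \<le> (\<gamma> (axis i n0))\<^sup>2" by (simp add: power2_eq_square)
  then show ?thesis using \<gamma>_nonneg power2_le_imp_le by blast
qed

end

section \<open>Infrared bound\<close>

definition dot :: "int ^ 'd::finite \<Rightarrow> int ^ 'd \<Rightarrow> int" where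
  "dot k x = (\<Sum>i\<in>UNIV. k $ i * x $ i)"

lemma dot_commute: "dot k x = dot x k"
  unfolding dot_def by (simp add: mult.commute)

lemma dot_add: "dot k (x + y) = dot k x + dot k y"
  unfolding dot_def by (simp add: distrib_left sum.distrib)

lemma dot_smult: "dot k (c *s x) = c * dot k x"
  unfolding dot_def by (simp add: sum_distrib_left mult_ac)

lemma dot_minus: "dot k (- x) = - dot k x"
  unfolding dot_def by (simp add: sum_negf)

lemma dot_axis: "dot k (axis i 1) = k $ i"
  unfolding dot_def by (simp add: axis_def if_distrib cong: if_cong)

lemma cos_sin_2pi_int:
  fixes a :: real
  shows "cos (a + of_int n * (2 * pi)) = cos a" "sin (a + of_int n * (2 * pi)) = sin a"
  using cos_int_2pin[of n] sin_int_2pin[of n] by (simp_all add: cos_add sin_add mult.commute)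

lemma recip_one_minus_square:
  fixes a :: real
  assumes "a < 1" "- a < 1"
  shows "1 / (1 - a\<^sup>2) = (1 / (1 - a) + 1 / (1 - - a)) / 2"
proof -
  have "1 - a \<noteq> 0" "1 + a \<noteq> 0" using assms by auto
  moreover have "1 - a\<^sup>2 = (1 - a) * (1 + a)" by (simp add: power2_eq_square algebra_simps)
  ultimately show ?thesis by (simp add: add_frac_eq)
qed

text \<open>Expanding by \<open>1 + a\<close> turns \<open>a / (1 - a)\<close> into a quotient over
  \<open>1 - a\<^sup>2\<close>, whose average over modes is controlled. The remaining linear term is
  absorbed by the square of \<open>a - 1 / 2\<close>.\<close>

lemma infrared_real:
  fixes a G :: real
  assumes "0 \<le> a" "a < 1" "G \<le> 1 / (1 - a)"
  shows "a * G \<le> 9 / 4 / (1 - a\<^sup>2) - 2"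
proof -
  have a2: "a\<^sup>2 < 1" using assms by (simp add: power_strict_mono abs_square_less_1)
  have "a * G \<le> a * (1 / (1 - a))" using assms by (intro mult_left_mono) auto
  also have "\<dots> = (a + a\<^sup>2) / (1 - a\<^sup>2)"
    using assms a2 by (simp add: divide_simps power2_eq_square) (simp add: algebra_simps)
  also have "\<dots> \<le> (2 * a\<^sup>2 + 1 / 4) / (1 - a\<^sup>2)"
  proof (intro divide_right_mono)
    have "0 \<le> (a - 1 / 2)\<^sup>2" by simp
    then show "a + a\<^sup>2 \<le> 2 * a\<^sup>2 + 1 / 4" by (simp add: power2_eq_square algebra_simps)
  qed (use a2 in simp)
  also have "\<dots> = 9 / 4 / (1 - a\<^sup>2) - 2" using a2 by (simp add: field_simps)
  finally show ?thesis .
qed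

section \<open>Finite Fourier analysis on the torus\<close>

context torus_weight
begin

lemma T_id: "x \<in> V \<Longrightarrow> T x = x"
  by (rule to_torus_id)

definition ang :: "int ^ 'd \<Rightarrow> int ^ 'd \<Rightarrow> real" where
  "ang k x = 2 * pi * real_of_int (dot k x) / real L"

lemma ang_add: "ang k (x + y) = ang k x + ang k y"
  unfolding ang_def by (simp add: dot_add distrib_left add_divide_distrib)

lemma ang_minus: "ang k (- x) = - ang k x"
  unfolding ang_def by (simp add: dot_minus)

lemma ang_commute: "ang k x = ang x k"
  unfolding ang_def by (simp add: dot_commute)

lemma ang_period: "ang k (x + int L *s z) = ang k x + of_int (dot k z) * (2 * pi)"
  unfolding ang_add unfolding ang_def using L_pos by (simp add: dot_smult)

lemma cos_periodic: "periodic L (\<lambda>x. cos (ang k x))"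
  by (rule periodicI) (simp only: ang_period cos_sin_2pi_int)

lemma sin_periodic: "periodic L (\<lambda>x. sin (ang k x))"
  by (rule periodicI) (simp only: ang_period cos_sin_2pi_int)

lemma cos_T: "cos (ang k (T x)) = cos (ang k x)" "sin (ang k (T x)) = sin (ang k x)"
  "cos (ang (T k) x) = cos (ang k x)"
  using periodicD[OF cos_periodic] periodicD[OF sin_periodic] ang_commute by metis+

text \<open>The integer vector \<open>k\<close> stands for the momentum \<open>2 * pi / L\<close>
  times \<open>k\<close>. For the even functions \<open>p\<close> and \<open>\<gamma>\<close> the
  sine part cancels, so the cosine sum is the whole Fourier transform.\<close>

definition ft :: "(int ^ 'd \<Rightarrow> real) \<Rightarrow> int ^ 'd \<Rightarrow> real" where
  "ft f k = (\<Sum>v\<in>V. f v * cos (ang k v))"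

lemma ft_T: "ft f (T k) = ft f k"
  unfolding ft_def by (simp add: cos_T)

lemma sum_sin_zero:
  assumes "periodic L f" "\<And>x. f (- x) = f x"
  shows "(\<Sum>v\<in>V. f v * sin (ang k v)) = 0"
proof -
  have "periodic L (\<lambda>v. f v * sin (ang k v))"
    using periodicD[OF assms(1)] cos_T(2) unfolding periodic_def by simp
  from sum_torus_minus[OF L_pos this] have "(\<Sum>v\<in>V. f v * sin (ang k v)) = - (\<Sum>v\<in>V. f v * sin (ang k v))"
    by (simp add: assms(2) ang_minus sum_negf)
  then show ?thesis by simp
qed

lemma conv_eigen:
  assumes "periodic L f" "\<And>x. f (- x) = f x"
  shows "(\<Sum>y\<in>V. f (y - x) * cos (ang k y)) = ft f k * cos (ang k x)"
proof -
  have "periodic L (\<lambda>y. f (y - x) * cos (ang k y))"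
    unfolding periodic_def
  proof
    fix y
    have "f (T y - x) = f (y - x)" by (rule periodic_eq[OF assms(1)]) simp
    then show "f (T y - x) * cos (ang k (T y)) = f (y - x) * cos (ang k y)" by (simp add: cos_T)
  qed
  from sum_torus_shift[OF L_pos this, of x]
  have "(\<Sum>y\<in>V. f (y - x) * cos (ang k y)) = (\<Sum>y\<in>V. f y * cos (ang k y + ang k x))"
    by (simp add: ang_add)
  also have "\<dots> = (\<Sum>y\<in>V. (f y * cos (ang k y)) * cos (ang k x) - (f y * sin (ang k y)) * sin (ang k x))"
    by (simp add: cos_add algebra_simps)
  also have "\<dots> = ft f k * cos (ang k x) - (\<Sum>v\<in>V. f v * sin (ang k v)) * sin (ang k x)"
    unfolding ft_def by (simp add: sum_subtractf sum_distrib_right)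
  finally show ?thesis using sum_sin_zero[OF assms] by simp
qed

text \<open>The cosine is a joint eigenfunction of \<open>D.D\<close> and \<open>D.G0\<close>, with
  eigenvalues \<open>1 - ft p k\<close> and \<open>D.Z V * ft \<gamma> k\<close>. Nonpositivity of
  the form is then divided by the positive number \<open>D.Z V * (1 - ft p k)\<close>.\<close>

lemma infrared_bound:
  assumes "ft p k < 1"
  shows "ft \<gamma> k \<le> 1 / (1 - ft p k)"
proof -
  let ?h = "\<lambda>x. cos (ang k x)"
  have D: "(\<Sum>y\<in>V. D.D x y * ?h y) = (1 - ft p k) * ?h x" if "x \<in> V" for x
  proof -
    have "(\<Sum>y\<in>V. D.D x y * ?h y) = (\<Sum>y\<in>V. (if y = x then ?h y else 0)) - (\<Sum>y\<in>V. p (y - x) * ?h y)"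
      unfolding D.D_def periodised_eq sum_subtractf[symmetric]
      by (intro sum.cong) (auto simp: algebra_simps)
    then show ?thesis using conv_eigen[OF p_periodic, of x k] that by (simp add: algebra_simps)
  qed
  have G: "(\<Sum>y\<in>V. D.G0 x y * ?h y) = (D.Z V * ft \<gamma> k) * ?h x" if "x \<in> V" for x
  proof -
    have "(\<Sum>y\<in>V. D.G0 x y * ?h y) = D.Z V * (\<Sum>y\<in>V. \<gamma> (y - x) * ?h y)"
      unfolding sum_distrib_left by (intro sum.cong refl) (simp add: G0_eq that)
    then show ?thesis using conv_eigen[OF \<gamma>_periodic, of x k] by simp
  qed
  have "((1 - ft p k)\<^sup>2 * (D.Z V * ft \<gamma> k) - D.Z V * (1 - ft p k)) * (\<Sum>x\<in>V. (?h x)\<^sup>2) \<le> 0"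
  proof -
    have "quad V D.K ?h = ((1 - ft p k)\<^sup>2 * (D.Z V * ft \<gamma> k) - D.Z V * (1 - ft p k)) * (\<Sum>x\<in>V. (?h x)\<^sup>2)"
      by (rule D.quad_K[OF D G])
    then show ?thesis using quad_K_nonpos[of ?h] by simp
  qed
  moreover have "0 < (\<Sum>x\<in>V. (?h x)\<^sup>2)"
  proof (rule sum_pos2[OF finite_torus zero_in])
    show "0 < (?h 0)\<^sup>2" by (simp add: ang_def dot_def)
  qed auto
  ultimately have "(1 - ft p k)\<^sup>2 * (D.Z V * ft \<gamma> k) - D.Z V * (1 - ft p k) \<le> 0"
    by (simp add: mult_le_0_iff)
  then have "D.Z V * (1 - ft p k) * ((1 - ft p k) * ft \<gamma> k - 1) \<le> 0"
    by (simp add: power2_eq_square algebra_simps)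
  moreover have "0 < D.Z V * (1 - ft p k)" using Z_pos assms by simp
  ultimately have "(1 - ft p k) * ft \<gamma> k \<le> 1"
    using mult_pos_pos[of "D.Z V * (1 - ft p k)" "(1 - ft p k) * ft \<gamma> k - 1"] by linarith
  then show ?thesis using assms by (simp add: field_simps)
qed

lemma cos_eq_1: "cos (2 * pi * real_of_int a / real L) = 1 \<Longrightarrow> a mod int L = 0"
proof -
  assume "cos (2 * pi * real_of_int a / real L) = 1"
  then obtain n :: int where "2 * pi * real_of_int a / real L = real_of_int n * 2 * pi"
    unfolding cos_one_2pi_int by blast
  then have "real_of_int a = real_of_int (n * int L)" using L_pos by (simp add: field_simps)
  then have "a = n * int L" by (simp only: of_int_eq_iff)
  then show ?thesis by simp
qed

text \<open>Shifting \<open>k\<close> by a unit vector rotates the pair of cosine and sine sums by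
  the angle \<open>t\<close>. As the sums do not change, a nontrivial rotation fixes the pair, so it
  is zero.\<close>

lemma orthogonality: "(\<Sum>k\<in>V. cos (ang k v)) = (if T v = 0 then real L ^ CARD('d) else 0)"
proof (cases "T v = 0")
  case True
  have "cos (ang k v) = 1" for k using cos_T(1)[of k v] True by (simp add: ang_def dot_def)
  then show ?thesis using True by (simp add: card_torus)
next
  case False
  then obtain i where i: "v $ i mod int L \<noteq> 0" by (auto simp: vec_eq_iff)
  define t where "t = 2 * pi * real_of_int (v $ i) / real L"
  have t: "ang (k + axis i 1) v = ang k v + t" for k
    unfolding ang_commute[of _ v] ang_add by (simp add: t_def ang_def dot_axis)
  let ?c = "\<Sum>k\<in>V. cos (ang k v)" let ?s = "\<Sum>k\<in>V. sin (ang k v)"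
  have pc: "periodic L (\<lambda>k. cos (ang k v))" "periodic L (\<lambda>k. sin (ang k v))"
    using cos_periodic[of v] sin_periodic[of v] unfolding ang_commute[of _ v] by blast+
  have c: "?c = cos t * ?c - sin t * ?s"
  proof -
    have "?c = (\<Sum>k\<in>V. cos (ang (k + axis i 1) v))" using sum_torus_shift[OF L_pos pc(1)] by simp
    also have "\<dots> = cos t * ?c - sin t * ?s"
      unfolding t cos_add by (simp add: sum_subtractf sum_distrib_left mult.commute)
    finally show ?thesis .
  qed
  have s: "?s = sin t * ?c + cos t * ?s"
  proof -
    have "?s = (\<Sum>k\<in>V. sin (ang (k + axis i 1) v))" using sum_torus_shift[OF L_pos pc(2)] by simp
    also have "\<dots> = sin t * ?c + cos t * ?s"
      unfolding t sin_add by (simp add: sum.distrib sum_distrib_left mult.commute)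
    finally show ?thesis .
  qed
  have n: "cos t \<noteq> 1" using cos_eq_1[of "v $ i"] i unfolding t_def by blast
  have "(1 - cos t)\<^sup>2 * ?c + (sin t)\<^sup>2 * ?c = 0"
  proof -
    have 1: "(1 - cos t) * ?c = - sin t * ?s" "(1 - cos t) * ?s = sin t * ?c" using c s by algebra+
    have "(1 - cos t)\<^sup>2 * ?c = - sin t * ((1 - cos t) * ?s)" using 1(1) by algebra
    then show ?thesis unfolding 1(2) by (simp add: power2_eq_square)
  qed
  then have "((1 - cos t)\<^sup>2 + (sin t)\<^sup>2) * ?c = 0" by (simp add: algebra_simps)
  moreover have "(1 - cos t)\<^sup>2 + (sin t)\<^sup>2 > 0" using n by (intro add_pos_nonneg) auto
  ultimately have "?c = 0" by (metis less_irrefl mult_eq_0_iff)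
  then show ?thesis using False by simp
qed

text \<open>The product formula for cosines gives the two contributions \<open>y = x\<close> and
  \<open>y = - x\<close>, each with weight one half; evenness of \<open>g\<close> makes them
  equal.\<close>

lemma parseval:
  assumes "periodic L g" "\<And>x. g (- x) = g x"
  shows "(\<Sum>k\<in>V. ft f k * ft g k) = real L ^ CARD('d) * (\<Sum>x\<in>V. f x * g x)"
proof -
  let ?N = "real L ^ CARD('d)"
  have "(\<Sum>k\<in>V. ft f k * ft g k) = (\<Sum>k\<in>V. \<Sum>x\<in>V. \<Sum>y\<in>V. f x * g y * ((cos (ang k (x - y)) + cos (ang k (x + y))) / 2))"
  proof (intro sum.cong refl)
    fix k
    have "ang k (x - y) = ang k x - ang k y" for x y
      using ang_add[of k x "- y"] ang_minus by simp
    then show "ft f k * ft g k = (\<Sum>x\<in>V. \<Sum>y\<in>V. f x * g y * ((cos (ang k (x - y)) + cos (ang k (x + y))) / 2))"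
      unfolding ft_def sum_product by (intro sum.cong refl) (simp add: ang_add cos_add cos_diff)
  qed
  also have "\<dots> = (\<Sum>x\<in>V. \<Sum>k\<in>V. \<Sum>y\<in>V. f x * g y * ((cos (ang k (x - y)) + cos (ang k (x + y))) / 2))"
    by (rule sum.swap)
  also have "\<dots> = (\<Sum>x\<in>V. \<Sum>y\<in>V. \<Sum>k\<in>V. f x * g y * ((cos (ang k (x - y)) + cos (ang k (x + y))) / 2))"
    by (intro sum.cong refl sum.swap)
  also have "\<dots> = (\<Sum>x\<in>V. \<Sum>y\<in>V. f x * g y * (((if T (x - y) = 0 then ?N else 0) + (if T (x + y) = 0 then ?N else 0)) / 2))"
    by (simp add: sum_distrib_left[symmetric] sum_divide_distrib[symmetric] sum.distrib orthogonality)
  also have "\<dots> = (\<Sum>x\<in>V. ?N * (f x * g x))"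
  proof (intro sum.cong refl)
    fix x assume x: "x \<in> V"
    have 1: "T (x - y) = 0 \<longleftrightarrow> y = x" if "y \<in> V" for y
    proof
      assume "T (x - y) = 0"
      then have "T (y + T (x - y)) = T y" by simp
      then show "y = x" using T_id x that by simp
    qed (use L_pos in \<open>simp add: vec_eq_iff\<close>)
    have 2: "T (x + y) = 0 \<longleftrightarrow> y = T (- x)" if "y \<in> V" for y
    proof
      assume "T (x + y) = 0"
      then have "T (T (x + y) - x) = T (- x)" by simp
      then show "y = T (- x)" using T_id that by simp
    next
      assume "y = T (- x)"
      then have "T (x + y) = T (x + - x)" by (simp only: to_torus_add2)
      then show "T (x + y) = 0" by (simp add: vec_eq_iff)
    qed
    have "(\<Sum>y\<in>V. f x * g y * (((if T (x - y) = 0 then ?N else 0) + (if T (x + y) = 0 then ?N else 0)) / 2))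
       = (\<Sum>y\<in>V. (if y = x then f x * g y * ?N / 2 else 0) + (if y = T (- x) then f x * g y * ?N / 2 else 0))"
    proof (intro sum.cong refl)
      fix y assume y: "y \<in> V"
      show "f x * g y * (((if T (x - y) = 0 then ?N else 0) + (if T (x + y) = 0 then ?N else 0)) / 2)
        = (if y = x then f x * g y * ?N / 2 else 0) + (if y = T (- x) then f x * g y * ?N / 2 else 0)"
        unfolding 1[OF y] 2[OF y] by (simp add: distrib_left)
    qed
    also have "\<dots> = f x * g x * ?N / 2 + f x * g (T (- x)) * ?N / 2"
      using x by (simp add: sum.distrib)
    also have "g (T (- x)) = g x" using periodicD[OF assms(1)] assms(2) by simp
    finally show "(\<Sum>y\<in>V. f x * g y * (((if T (x - y) = 0 then ?N else 0) + (if T (x + y) = 0 then ?N else 0)) / 2))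
      = ?N * (f x * g x)" by (simp add: field_simps)
  qed
  finally show ?thesis by (simp add: sum_distrib_left)
qed

definition half_momentum :: "int ^ 'd" where "half_momentum = (\<chi> i. int (L div 2))"

lemma half_momentum_in: "half_momentum \<in> V" and half_momentum_nz: "half_momentum \<noteq> 0"
  using L_ge2 unfolding half_momentum_def torus_def by (auto simp: vec_eq_iff)

lemma T_half_momentum2: "T (k + half_momentum + half_momentum) = T k"
proof -
  have "k + half_momentum + half_momentum = k + int L *s (\<chi> i. 1)"
    using L_even by (auto simp: vec_eq_iff half_momentum_def)
  then show ?thesis by (simp only: to_torus_smult)
qed

lemma ang_half_momentum: "ang half_momentum x = pi * real_of_int (coord_sum x)"
proof -
  have "dot half_momentum x = int (L div 2) * coord_sum x"
    unfolding dot_def half_momentum_def coord_sum_def by (simp add: sum_distrib_left)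
  moreover have "real L = 2 * real (L div 2)" using L_even by auto
  ultimately show ?thesis using L_pos unfolding ang_def by (simp add: field_simps)
qed

lemma ft_half_momentum:
  assumes "\<And>x. even (coord_sum x) \<Longrightarrow> f x = 0"
  shows "ft f (k + half_momentum) = - ft f k"
  unfolding ft_def sum_negf[symmetric]
proof (intro sum.cong refl)
  fix x
  show "f x * cos (ang (k + half_momentum) x) = - (f x * cos (ang k x))"
  proof (cases "even (coord_sum x)")
    case False
    then obtain m where m: "coord_sum x = 2 * m + 1" by (elim oddE)
    have "ang (k + half_momentum) x = ang k x + ang half_momentum x" using ang_add[of x k half_momentum] by (simp add: ang_commute)
    also have "\<dots> = ang k x + pi + of_int m * (2 * pi)" unfolding ang_half_momentum m by (simp add: algebra_simps)
    finally have e: "ang (k + half_momentum) x = ang k x + pi + of_int m * (2 * pi)" .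
    have "cos (ang (k + half_momentum) x) = cos (ang k x + pi)" unfolding e by (simp only: cos_sin_2pi_int)
    then show ?thesis by simp
  qed (simp add: assms)
qed

lemma ft_p_zero: "ft p 0 = 1"
  unfolding ft_def using sum_p by (simp add: ang_def dot_def)

lemma ft_\<gamma>_zero: "ft \<gamma> 0 = (\<Sum>v\<in>V. \<gamma> v)"
  unfolding ft_def by (simp add: ang_def dot_def)

text \<open>Strictness comes from the positive weight of the unit vector in a direction where
  \<open>k\<close> is nonzero modulo \<open>L\<close>.\<close>

lemma ft_p_less: "ft p k < 1" if k: "T k \<noteq> 0"
proof -
  obtain i where i: "k $ i mod int L \<noteq> 0" using k by (auto simp: vec_eq_iff)
  have "ang k (axis i 1) = 2 * pi * real_of_int (k $ i) / real L"
    unfolding ang_def by (simp add: dot_axis)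
  then have "cos (ang k (axis i 1)) \<noteq> 1" using cos_eq_1 i by metis
  then have c: "cos (ang k (axis i 1)) < 1" using cos_le_one le_less by blast
  have "0 < (\<Sum>v\<in>V. p v * (1 - cos (ang k v)))"
    by (rule sum_pos2[OF finite_torus axis_in_V[of i]]) (use c p_axis_pos p_nonneg in auto)
  also have "\<dots> = 1 - ft p k"
    unfolding ft_def by (simp add: right_diff_distrib sum_subtractf sum_p)
  finally show ?thesis by simp
qed

definition torus_green where "torus_green = (\<Sum>k\<in>V - {0}. 1 / (1 - ft p k))"

text \<open>Parseval applied to \<open>sum_p_\<gamma>\<close>. The modes 0 and
  \<open>half_momentum\<close> contribute the sum of \<open>\<gamma>\<close> once each, and every
  other mode is bounded by the infrared estimate.\<close>

lemma main_inequality: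
  "real L ^ CARD('d) \<le> 2 * (\<Sum>v\<in>V. \<gamma> v) + 9 / 4 * (torus_green - 1 / 2) - 2 * (real L ^ CARD('d) - 2)"
proof -
  let ?\<omega> = "ft p" let ?\<Gamma> = "ft \<gamma>"
  let ?rest = "V - {0, half_momentum}"
  have ph: "?\<omega> (k + half_momentum) = - ?\<omega> k" "?\<Gamma> (k + half_momentum) = - ?\<Gamma> k" for k
    using ft_half_momentum p_even \<gamma>_even by blast+
  have nz: "T k \<noteq> 0" "T (k + half_momentum) \<noteq> 0" if "k \<in> ?rest" for k
  proof -
    show "T k \<noteq> 0" using that T_id by auto
    show "T (k + half_momentum) \<noteq> 0"
    proof
      assume "T (k + half_momentum) = 0"
      then have "T (T (k + half_momentum) + half_momentum) = T half_momentum" by simp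
      then have "T k = T half_momentum" using T_half_momentum2[of k] by simp
      then show False using that T_id half_momentum_in by auto
    qed
  qed
  have bd: "?\<omega> k < 1" "- ?\<omega> k < 1" if "k \<in> ?rest" for k
    using ft_p_less[OF nz(1)[OF that]] ft_p_less[OF nz(2)[OF that]] ph by auto
  have each: "?\<omega> k * ?\<Gamma> k \<le> 9 / 4 * (1 / (1 - (?\<omega> k)\<^sup>2)) - 2" if k: "k \<in> ?rest" for k
  proof (cases "0 \<le> ?\<omega> k")
    case True
    then show ?thesis using infrared_real[OF True bd(1)[OF k] infrared_bound[OF bd(1)[OF k]]] by simp
  next
    \<comment> \<open>For a negative transform of \<open>p\<close> the bound is used at the shifted
      momentum, where both transforms have changed sign.\<close>
    case False
    have "- ?\<Gamma> k \<le> 1 / (1 - (- ?\<omega> k))"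
      using infrared_bound[of "k + half_momentum"] bd(2)[OF k] unfolding ph by simp
    then show ?thesis using infrared_real[of "- ?\<omega> k" "- ?\<Gamma> k"] bd(2)[OF k] False by simp
  qed
  have split: "sum f V = f 0 + f half_momentum + sum f ?rest" for f :: "int ^ 'd \<Rightarrow> real"
  proof -
    have "sum f V = sum f {0, half_momentum} + sum f ?rest"
      using half_momentum_in zero_in by (intro sum.subset_diff[THEN trans, OF _ _ add.commute]) auto
    then show ?thesis using half_momentum_nz by simp
  qed
  have h: "?\<omega> half_momentum = - 1" "?\<Gamma> half_momentum = - (\<Sum>v\<in>V. \<gamma> v)"
    using ph[of 0] ft_p_zero ft_\<gamma>_zero by auto
  have card: "real (card ?rest) = real L ^ CARD('d) - 2"
  proof -
    have "real (card ?rest) = (\<Sum>k\<in>V. 1) - 2" using split[of "\<lambda>_. 1"] by simp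
    then show ?thesis by (simp add: card_torus)
  qed
  \<comment> \<open>The summand \<open>1 / 2\<close> is the mode \<open>half_momentum\<close>, where
    the transform of \<open>p\<close> equals \<open>-1\<close>.\<close>
  have torus_green_eq: "torus_green = (\<Sum>k\<in>?rest. 1 / (1 - ?\<omega> k)) + 1 / 2"
  proof -
    have "V - {0} = insert half_momentum ?rest" using half_momentum_in half_momentum_nz by auto
    then have "torus_green = (\<Sum>k\<in>insert half_momentum ?rest. 1 / (1 - ?\<omega> k))" unfolding torus_green_def by (simp only:)
    also have "\<dots> = 1 / (1 - ?\<omega> half_momentum) + (\<Sum>k\<in>?rest. 1 / (1 - ?\<omega> k))"
      by (rule sum.insert) auto
    finally show ?thesis using h by simp
  qed
  have "real L ^ CARD('d) = (\<Sum>k\<in>V. ?\<omega> k * ?\<Gamma> k)"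
    using parseval[OF \<gamma>_periodic \<gamma>_minus, of p] sum_p_\<gamma> by simp
  also have "\<dots> = 2 * (\<Sum>v\<in>V. \<gamma> v) + (\<Sum>k\<in>?rest. ?\<omega> k * ?\<Gamma> k)"
    unfolding split h ft_p_zero ft_\<gamma>_zero by simp
  also have "(\<Sum>k\<in>?rest. ?\<omega> k * ?\<Gamma> k) \<le> (\<Sum>k\<in>?rest. 9 / 4 * (1 / (1 - (?\<omega> k)\<^sup>2)) - 2)"
    by (intro sum_mono each)
  also have "\<dots> = 9 / 4 * (\<Sum>k\<in>?rest. 1 / (1 - (?\<omega> k)\<^sup>2)) - 2 * (real L ^ CARD('d) - 2)"
    using card by (simp add: sum_subtractf sum_distrib_left)
  \<comment> \<open>The function \<open>1 / (1 - a\<^sup>2)\<close> is the mean of its two partial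
    fractions, and the shift by \<open>half_momentum\<close> permutes the remaining modes and
    exchanges these fractions.\<close>
  also have "(\<Sum>k\<in>?rest. 1 / (1 - (?\<omega> k)\<^sup>2)) = torus_green - 1 / 2"
  proof -
    have "(\<Sum>k\<in>?rest. 1 / (1 - (?\<omega> k)\<^sup>2)) = (\<Sum>k\<in>?rest. (1 / (1 - ?\<omega> k) + 1 / (1 - ?\<omega> (k + half_momentum))) / 2)"
    proof (intro sum.cong refl)
      fix k assume k: "k \<in> ?rest"
      show "1 / (1 - (?\<omega> k)\<^sup>2) = (1 / (1 - ?\<omega> k) + 1 / (1 - ?\<omega> (k + half_momentum))) / 2"
        using recip_one_minus_square[OF bd[OF k]] unfolding ph .
    qed
    also have "\<dots> = ((\<Sum>k\<in>?rest. 1 / (1 - ?\<omega> k)) + (\<Sum>k\<in>?rest. 1 / (1 - ?\<omega> (k + half_momentum)))) / 2"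
      by (simp add: sum.distrib sum_divide_distrib[symmetric])
    also have "(\<Sum>k\<in>?rest. 1 / (1 - ?\<omega> (k + half_momentum))) = (\<Sum>k\<in>?rest. 1 / (1 - ?\<omega> k))"
    proof -
      have maps: "T (k + half_momentum) \<in> ?rest" if "k \<in> ?rest" for k
      proof -
        have "T (k + half_momentum) \<noteq> half_momentum"
        proof
          assume "T (k + half_momentum) = half_momentum"
          then have "T (T (k + half_momentum) - half_momentum) = T (half_momentum - half_momentum)" by simp
          then have "T k = 0" using L_pos by (simp add: vec_eq_iff)
          then show False using nz(1)[OF that] by simp
        qed
        then show ?thesis using nz(2)[OF that] by simp
      qed
      have "bij_betw (\<lambda>k. T (k + half_momentum)) ?rest ?rest"
      proof (rule bij_betw_byWitness[where f' = "\<lambda>k. T (k + half_momentum)"])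
        show "\<forall>k\<in>?rest. T (T (k + half_momentum) + half_momentum) = k"
          by (simp only: to_torus_add1 T_half_momentum2) (simp add: T_id)
        then show "\<forall>k\<in>?rest. T (T (k + half_momentum) + half_momentum) = k" .
      qed (rule image_subsetI, rule maps, assumption)+
      from sum.reindex_bij_betw[OF this, of "\<lambda>k. 1 / (1 - ?\<omega> k)"] show ?thesis by (simp add: ft_T)
    qed
    also have "((\<Sum>k\<in>?rest. 1 / (1 - ?\<omega> k)) + (\<Sum>k\<in>?rest. 1 / (1 - ?\<omega> k))) / 2 = torus_green - 1 / 2"
      unfolding torus_green_eq by simp
    finally show ?thesis .
  qed
  finally show ?thesis by simp
qed

section \<open>Identification of integer momenta with the dual torus\<close>

definition centred :: "int ^ 'd \<Rightarrow> int ^ 'd" where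
  "centred k = (\<chi> i. if 2 * k $ i \<le> int L then k $ i else k $ i - int L)"

lemma T_centred: "k \<in> V \<Longrightarrow> T (centred k) = k"
  unfolding centred_def torus_def by (auto simp: vec_eq_iff)

lemma centred_T:
  assumes "\<And>i. - int L < 2 * j $ i \<and> 2 * j $ i \<le> int L"
  shows "centred (T j) = j"
proof -
  have "centred (T j) $ i = j $ i" for i
  proof (cases "0 \<le> j $ i")
    case True
    then have "j $ i mod int L = j $ i" using assms[of i] L_pos by (intro mod_pos_pos_trivial) auto
    then show ?thesis using assms[of i] by (simp add: centred_def)
  next
    case False
    have "j $ i mod int L = (j $ i + int L) mod int L" by simp
    also have "\<dots> = j $ i + int L" using assms[of i] False by (intro mod_pos_pos_trivial) auto
    finally show ?thesis using assms[of i] by (simp add: centred_def)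
  qed
  then show ?thesis by (simp add: vec_eq_iff)
qed

definition momentum :: "int ^ 'd \<Rightarrow> real ^ 'd" where
  "momentum j = (\<chi> i. 2 * pi / real L * real_of_int (j $ i))"

lemma momentum_inj: "momentum j = momentum k \<Longrightarrow> j = k"
  using L_pos by (simp add: momentum_def vec_eq_iff)

lemma momentum_in_dual:
  "momentum j \<in> dual_torus L \<longleftrightarrow> (\<forall>i. - int L < 2 * j $ i \<and> 2 * j $ i \<le> int L)"
proof -
  have "(- pi < momentum j $ i \<and> momentum j $ i \<le> pi) \<longleftrightarrow> (- int L < 2 * j $ i \<and> 2 * j $ i \<le> int L)" for i
  proof -
    have "- pi < momentum j $ i \<longleftrightarrow> pi * (- real L) < pi * (2 * real_of_int (j $ i))"
      using L_pos by (simp add: momentum_def field_simps)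
    also have "\<dots> \<longleftrightarrow> - real L < 2 * real_of_int (j $ i)" by (simp only: mult_less_cancel_left_pos pi_gt_zero)
    also have "\<dots> \<longleftrightarrow> - int L < 2 * j $ i" by linarith
    finally have 1: "- pi < momentum j $ i \<longleftrightarrow> - int L < 2 * j $ i" .
    have "momentum j $ i \<le> pi \<longleftrightarrow> pi * (2 * real_of_int (j $ i)) \<le> pi * real L"
      using L_pos by (simp add: momentum_def field_simps)
    also have "\<dots> \<longleftrightarrow> 2 * real_of_int (j $ i) \<le> real L" by (simp only: mult_le_cancel_left_pos pi_gt_zero)
    also have "\<dots> \<longleftrightarrow> 2 * j $ i \<le> int L" by linarith
    finally show ?thesis using 1 by simp
  qed
  then show ?thesis unfolding dual_torus_def by (auto simp: momentum_def)
qed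

lemma centred_range: "k \<in> V \<Longrightarrow> - int L < 2 * centred k $ i \<and> 2 * centred k $ i \<le> int L"
proof -
  assume "k \<in> V"
  then have "0 \<le> k $ i" "k $ i < int L" unfolding torus_def by auto
  then show ?thesis by (simp add: centred_def)
qed

lemma bij_dual: "bij_betw (\<lambda>k. momentum (centred k)) (V - {0}) (dual_torus L - {0})"
proof (rule bij_betw_imageI)
  show "inj_on (\<lambda>k. momentum (centred k)) (V - {0})"
    by (rule inj_onI) (metis DiffD1 T_centred momentum_inj)
  have z: "momentum 0 = 0" by (simp add: momentum_def vec_eq_iff)
  have cz: "centred 0 = 0" by (simp add: centred_def vec_eq_iff)
  show "(\<lambda>k. momentum (centred k)) ` (V - {0}) = dual_torus L - {0}"
  proof (intro equalityI subsetI)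
    fix q assume "q \<in> (\<lambda>k. momentum (centred k)) ` (V - {0})"
    then obtain k where k: "k \<in> V" "k \<noteq> 0" "q = momentum (centred k)" by auto
    have "q \<in> dual_torus L" using centred_range[OF k(1)] k(3) momentum_in_dual by blast
    moreover have "q \<noteq> 0"
    proof
      assume "q = 0"
      then have "centred k = 0" using momentum_inj[of "centred k" 0] k(3) z by simp
      then have "T (centred k) = 0" using L_pos by (simp add: vec_eq_iff)
      then show False using T_centred[OF k(1)] k(2) by simp
    qed
    ultimately show "q \<in> dual_torus L - {0}" by simp
  next
    fix q :: "real ^ 'd" assume q: "q \<in> dual_torus L - {0}"
    then have "\<forall>i. \<exists>j::int. q $ i = 2 * pi / real L * real_of_int j" unfolding dual_torus_def by blast
    then obtain j where j: "\<And>i. q $ i = 2 * pi / real L * real_of_int (j i)" by metis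
    define k where "k = (\<chi> i. j i)"
    have qk: "q = momentum k" using j by (simp add: momentum_def k_def vec_eq_iff)
    then have "centred (T k) = k" using q momentum_in_dual by (intro centred_T) blast
    then have "q = momentum (centred (T k))" "T k \<noteq> 0" using qk q z cz by auto
    then show "q \<in> (\<lambda>k. momentum (centred k)) ` (V - {0})" by auto
  qed
qed

text \<open>At these momenta the exponential has period \<open>L\<close> in each coordinate, so
  summing over cosets replaces \<open>u\<close> by \<open>p\<close>; the imaginary part vanishes
  because \<open>p\<close> is even.\<close>

lemma fourier_momentum: "fourier w (momentum k) = complex_of_real (ft p k)"
proof -
  have arg: "(\<Sum>i\<in>UNIV. momentum k $ i * real_of_int (x $ i)) = ang k x" for x
    unfolding momentum_def ang_def dot_def by (simp add: sum_distrib_left sum_divide_distrib mult_ac)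
  have cisT: "cis (ang k (x + int L *s z)) = cis (ang k x)" for x z
    unfolding ang_period complex_eq_iff cis.sel by (simp only: cos_sin_2pi_int simp_thms)
  have sm: "(\<lambda>x. complex_of_real (u x) * cis (ang k x)) summable_on UNIV"
  proof (rule abs_summable_summable)
    show "(\<lambda>x. norm (complex_of_real (u x) * cis (ang k x))) summable_on UNIV"
      using u_summable[of UNIV] by (simp add: norm_mult u_nonneg)
  qed
  have "fourier w (momentum k) = (\<Sum>\<^sub>\<infinity>x. complex_of_real (u x) * cis (ang k x))"
    unfolding fourier_def arg ..
  also have "\<dots> = (\<Sum>x\<in>V. \<Sum>\<^sub>\<infinity>z. complex_of_real (u (x + int L *s z)) * cis (ang k (x + int L *s z)))"
    by (rule infsum_cosets[OF L_pos sm])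
  also have "\<dots> = (\<Sum>x\<in>V. complex_of_real (p x) * cis (ang k x))"
  proof (intro sum.cong refl)
    fix x
    have "((\<lambda>z. u (x + int L *s z)) has_sum p x) UNIV"
      unfolding p_def by (intro has_sum_infsum summable_coset L_pos)
    then have "((\<lambda>z. complex_of_real (u (x + int L *s z))) has_sum complex_of_real (p x)) UNIV"
      by (simp only: has_sum_of_real_iff)
    then have "((\<lambda>z. complex_of_real (u (x + int L *s z)) * cis (ang k x)) has_sum complex_of_real (p x) * cis (ang k x)) UNIV"
      by (rule has_sum_cmult_left)
    then show "(\<Sum>\<^sub>\<infinity>z. complex_of_real (u (x + int L *s z)) * cis (ang k (x + int L *s z))) = complex_of_real (p x) * cis (ang k x)"
      unfolding cisT by (rule infsumI)
  qed
  also have "\<dots> = complex_of_real (ft p k)"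
    using sum_sin_zero[OF p_periodic, of k] by (simp add: complex_eq_iff ft_def)
  finally show ?thesis .
qed

lemma dual_sum:
  "(\<Sum>k\<in>dual_torus L - {0}. 1 / (1 - fourier w k)) = complex_of_real torus_green"
proof -
  have "(\<Sum>k\<in>dual_torus L - {0}. 1 / (1 - fourier w k)) = (\<Sum>k\<in>V - {0}. 1 / (1 - fourier w (momentum (centred k))))"
    by (rule sum.reindex_bij_betw[OF bij_dual, symmetric])
  also have "\<dots> = (\<Sum>k\<in>V - {0}. complex_of_real (1 / (1 - ft p k)))"
  proof (intro sum.cong refl)
    fix k assume "k \<in> V - {0}"
    then have "ft p (centred k) = ft p k" using ft_T[of p "centred k"] T_centred by simp
    then show "1 / (1 - fourier w (momentum (centred k))) = complex_of_real (1 / (1 - ft p k))"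
      by (simp add: fourier_momentum)
  qed
  finally show ?thesis unfolding torus_green_def by simp
qed

end

section \<open>Macroscopic loops\<close>

text \<open>The factor \<open>L\<close> on the left avoids the exponent
  \<open>CARD('d) - 1\<close>.\<close>

lemma card_torus_slice:
  "card {v \<in> torus L :: (int ^ 'd::finite) set. v $ i \<in> A} * L = card (A \<inter> {0..<int L}) * L ^ CARD('d)"
proof -
  have eq: "{v \<in> torus L. v $ i \<in> A} = {v :: int ^ 'd. \<forall>j. v $ j \<in> (if j = i then A \<inter> {0..<int L} else {0..<int L})}"
    unfolding torus_def by (auto split: if_splits)
  have "card {v \<in> torus L :: (int ^ 'd) set. v $ i \<in> A}
      = (\<Prod>j\<in>UNIV. card (if j = i then A \<inter> {0..<int L} else {0..<int L}))"
    unfolding eq by (rule card_box)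
  also have "\<dots> = card (A \<inter> {0..<int L}) * (\<Prod>j\<in>UNIV - {i}. card (if j = i then A \<inter> {0..<int L} else {0..<int L}))"
    by (subst prod.remove[of _ i]) auto
  also have "(\<Prod>j\<in>UNIV - {i}. card (if j = i then A \<inter> {0..<int L} else {0..<int L})) = (\<Prod>j\<in>UNIV - {i}. L)"
    by (rule prod.cong) auto
  also have "\<dots> = L ^ (CARD('d) - 1)" by (simp add: card_Diff_singleton)
  finally have "card {v \<in> torus L :: (int ^ 'd) set. v $ i \<in> A} * L
      = card (A \<inter> {0..<int L}) * (L ^ (CARD('d) - 1) * L)"
    by (simp only: mult.assoc)
  also have "L ^ (CARD('d) - 1) * L = L ^ CARD('d)" by (rule power_minus_mult) simp
  finally show ?thesis .
qed

context torus_weight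
begin

definition M :: real where "M = (\<Sum>v\<in>V. \<gamma> v) / real L ^ CARD('d)"

lemma torus_M_eq: "torus_M L w = M"
  unfolding torus_M_def M_def by (simp add: torus_G_eq)

lemma M_ge: "3 - 9 / 4 * (torus_green / real L ^ CARD('d)) - 3 / real L ^ CARD('d) \<le> 2 * M"
proof -
  let ?N = "real L ^ CARD('d)"
  have N: "0 < ?N" using L_pos by simp
  have "(3 * ?N - 9 / 4 * torus_green - 3) / ?N \<le> (2 * (\<Sum>v\<in>V. \<gamma> v)) / ?N"
  proof (rule divide_right_mono)
    \<comment> \<open>The constant terms of \<open>main_inequality\<close> add up to
      \<open>4 - 9 / 8\<close>, which is rounded up to 3.\<close>
    show "3 * ?N - 9 / 4 * torus_green - 3 \<le> 2 * (\<Sum>v\<in>V. \<gamma> v)" using main_inequality by argo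
  qed (use N in simp)
  then show ?thesis using N unfolding M_def by (simp add: diff_divide_distrib)
qed

text \<open>At an odd point some coordinate is odd, so \<open>\<gamma>_le_axis\<close> compares with
  a nearest neighbour, where \<open>p * \<gamma> \<le> 1\<close>. The bound does not depend on
  \<open>L\<close>.\<close>

lemma \<gamma>_bound: "\<gamma> v \<le> (\<Sum>i\<in>UNIV. 1 / u (axis i 1))"
proof (cases "even (coord_sum (T v))")
  case True
  then have "\<gamma> v = 0" using \<gamma>_even[OF True] by simp
  then show ?thesis using u_axis_pos by (simp add: sum_nonneg less_imp_le)
next
  case False
  have "\<exists>i. odd (T v $ i)"
  proof (rule ccontr)
    assume "\<not> (\<exists>i. odd (T v $ i))"
    then have "even (coord_sum (T v))" unfolding coord_sum_def by (intro dvd_sum) blast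
    then show False using False by simp
  qed
  then obtain i where i: "odd (T v $ i)" by blast
  have r: "0 \<le> T v $ i" "T v $ i < int L" using T_in[of v] unfolding torus_def by blast+
  have "T v $ i \<noteq> 0" using i by (metis even_zero)
  then have "\<gamma> (T v) \<le> \<gamma> (axis i 1)" using r i by (intro \<gamma>_le_axis) auto
  also have "\<gamma> (axis i 1) \<le> 1 / u (axis i 1)"
  proof -
    have "u (axis i 1) * \<gamma> (axis i 1) \<le> p (axis i 1) * \<gamma> (axis i 1)"
      using p_ge \<gamma>_nonneg by (intro mult_right_mono)
    also have "\<dots> \<le> 1" by (rule p_\<gamma>_le)
    finally show ?thesis using u_axis_pos[of i] by (simp add: field_simps)
  qed
  also have "\<dots> \<le> (\<Sum>i\<in>UNIV. 1 / u (axis i 1))"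
    using u_axis_pos less_imp_le by (intro member_le_sum) auto
  finally show ?thesis by simp
qed

text \<open>Points whose coordinate \<open>i\<close> is at distance more than \<open>n\<close> from
  0 on the circle are controlled by \<open>\<gamma> (axis i n)\<close>. The others make up a
  fraction of at most \<open>(2 n + 1) / L\<close> of the torus and are controlled by
  \<open>\<gamma>_bound\<close>.\<close>

lemma M_le:
  assumes "odd n" "1 \<le> n"
  shows "M \<le> \<gamma> (axis i n) + (\<Sum>i\<in>UNIV. 1 / u (axis i 1)) * (2 * real_of_int n + 1) / real L"
proof -
  let ?K = "\<Sum>i\<in>UNIV. 1 / u (axis i 1)"
  let ?N = "real L ^ CARD('d)"
  let ?A = "{0..n} \<union> {int L - n..<int L}"
  let ?B = "{v \<in> V. v $ i \<in> ?A}"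
  have N: "0 < ?N" using L_pos by simp
  have K: "0 \<le> ?K" by (intro sum_nonneg) (simp add: less_imp_le u_axis_pos)
  have mid: "\<gamma> v \<le> \<gamma> (axis i n)" if "v \<in> V - ?B" for v
  proof -
    have "0 \<le> v $ i" "v $ i < int L" using that unfolding torus_def by auto
    then have "n + 1 \<le> v $ i" "v $ i \<le> int L - n - 1" using that by auto
    then show ?thesis using assms by (intro \<gamma>_le_axis) auto
  qed
  have "real (card ?B) * real L = real (card (?A \<inter> {0..<int L})) * ?N"
    using arg_cong[OF card_torus_slice[of L i ?A], of real] by (simp only: of_nat_mult of_nat_power)
  also have "\<dots> \<le> (2 * real_of_int n + 1) * ?N"
  proof -
    have "card (?A \<inter> {0..<int L}) \<le> card ?A" by (intro card_mono) auto
    also have "\<dots> \<le> card {0..n} + card {int L - n..<int L}" by (rule card_Un_le)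
    finally have "card (?A \<inter> {0..<int L}) \<le> nat (n + 1) + nat n" by simp
    then have "real (card (?A \<inter> {0..<int L})) \<le> 2 * real_of_int n + 1" using assms by linarith
    then show ?thesis using N by (intro mult_right_mono) auto
  qed
  finally have cB: "real (card ?B) \<le> (2 * real_of_int n + 1) * ?N / real L"
    using L_pos by (simp add: field_simps)
  have "(\<Sum>v\<in>V. \<gamma> v) = (\<Sum>v\<in>V - ?B. \<gamma> v) + (\<Sum>v\<in>?B. \<gamma> v)"
    by (rule sum.subset_diff) auto
  also have "(\<Sum>v\<in>V - ?B. \<gamma> v) \<le> real (card (V - ?B)) * \<gamma> (axis i n)"
    using mid by (rule sum_bounded_above)
  also have "\<dots> \<le> ?N * \<gamma> (axis i n)"
  proof (intro mult_right_mono \<gamma>_nonneg)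
    have "card (V - ?B) \<le> card V" by (intro card_mono) auto
    then have "real (card (V - ?B)) \<le> real (L ^ CARD('d))" unfolding card_torus by (simp only: of_nat_le_iff)
    then show "real (card (V - ?B)) \<le> ?N" by (simp only: of_nat_power)
  qed
  also have "(\<Sum>v\<in>?B. \<gamma> v) \<le> real (card ?B) * ?K"
    using \<gamma>_bound by (intro sum_bounded_above)
  also have "\<dots> \<le> (2 * real_of_int n + 1) * ?N / real L * ?K"
    using cB K by (intro mult_right_mono)
  finally have "(\<Sum>v\<in>V. \<gamma> v) \<le> ?N * (\<gamma> (axis i n) + ?K * (2 * real_of_int n + 1) / real L)"
    by (simp add: algebra_simps)
  then show ?thesis unfolding M_def using N by (simp add: field_simps)
qed

text \<open>The rewiring is used for 0 and \<open>y\<close> with their translates by the unit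
  vector. By translation invariance both partition functions with two points removed equal
  \<open>D.Z V * \<gamma> v\<close>.\<close>

lemma visits_lower:
  "(u (axis i 1))\<^sup>2 * (\<gamma> v)\<^sup>2 \<le> D.visits 0 (T v) / (D.Z V)\<^sup>2"
proof -
  let ?e = "axis i (1 :: int) :: int ^ 'd"
  define y where "y = T v"
  define b where "b = T (y + ?e)"
  have V: "y \<in> V" "b \<in> V" "?e \<in> V" unfolding y_def b_def using axis_in_V by auto
  have gy: "\<gamma> y = \<gamma> v" unfolding y_def by simp
  have Z2: "0 < (D.Z V)\<^sup>2" using Z_pos by simp
  have pe: "u ?e \<le> p ?e" "0 < u ?e" using p_ge u_axis_pos by auto
  show ?thesis
  proof (cases "even (coord_sum y)")
    case True
    then have "\<gamma> v = 0" using \<gamma>_even gy by metis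
    moreover have "0 \<le> D.visits 0 (T v)"
      unfolding D.visits_def by (intro sum_nonneg) (simp add: less_imp_le[OF D.cover_weight_pos])
    ultimately show ?thesis by simp
  next
    case False
    then have y0: "y \<noteq> 0" by (auto simp: coord_sum_def)
    have G0y: "D.Z (V - {0, y}) = D.Z V * \<gamma> v"
      using G0_eq[OF zero_in V(1)] gy y0 unfolding D.G0_def by simp
    show ?thesis
    \<comment> \<open>The equality covers \<open>y = ?e\<close> and \<open>y\<close> congruent to
      \<open>- ?e\<close>, the cases in which the four points would coincide. There the single dimer
      joining 0 and \<open>y\<close> suffices.\<close>
    proof (cases "p y = p ?e")
      case True
      have "{0, y} \<in> D.E"
        unfolding D.edge_in using V y0 True p_axis_pos[of i] by (simp add: periodised_eq)
      from D.visits_edge[OF this]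
      have "p ?e * (D.Z V * \<gamma> v) * D.Z V \<le> D.visits 0 y" unfolding G0y by (simp add: periodised_eq True)
      then have 1: "p ?e * \<gamma> v \<le> D.visits 0 y / (D.Z V)\<^sup>2"
        using Z2 by (simp add: field_simps power2_eq_square)
      have "0 \<le> u ?e * \<gamma> v" using pe \<gamma>_nonneg by simp
      moreover have "u ?e * \<gamma> v \<le> p ?e * \<gamma> v" using pe \<gamma>_nonneg by (intro mult_right_mono) auto
      moreover have "p ?e * \<gamma> v \<le> 1" using p_\<gamma>_le[of y] True gy by simp
      ultimately have "(u ?e * \<gamma> v)\<^sup>2 \<le> p ?e * \<gamma> v"
        unfolding power2_eq_square using mult_left_le[of "u ?e * \<gamma> v" "u ?e * \<gamma> v"] by linarith
      then show ?thesis using 1 unfolding y_def by (simp add: power_mult_distrib)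
    next
      case n: False
      have ey: "?e \<noteq> y" using n by auto
      have by0: "b \<noteq> 0"
      proof
        assume "b = 0"
        then have "T (T (y + ?e) - ?e) = T (0 - ?e)" unfolding b_def by simp
        then have "T y = T (- ?e)" by simp
        then have "p y = p (- ?e)" using p_T by metis
        then show False using n by simp
      qed
      have odd_e: "odd (coord_sum ?e)" by simp
      have b_even: "even (coord_sum b)"
        unfolding b_def even_coord_sum_torus[OF L_even] coord_sum_add using False by simp
      have e1: "{0, ?e} \<in> D.E"
        unfolding D.edge_in using V p_axis_pos[of i] by (auto simp: periodised_eq axis_eq_0_iff)
      have pb: "p (b - y) = p ?e"
        using p_T[of "b - y"] p_T[of ?e] unfolding b_def by simp
      have e2: "{y, b} \<in> D.E"
        unfolding D.edge_in using V p_axis_pos[of i] False b_even by (auto simp: periodised_eq pb)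
      have dist: "distinct [0, y, ?e, b]"
        using y0 ey by0 False b_even odd_e by (auto simp: axis_eq_0_iff)
      have col: "even (coord_sum s) \<noteq> even (coord_sum t)" if "{s, t} \<in> D.E" for s t
      proof -
        have "p (t - s) \<noteq> 0" using that unfolding D.edge_in by (simp add: periodised_eq)
        then have "odd (coord_sum (t - s))" using p_even by blast
        then show ?thesis by (simp add: coord_sum_diff)
      qed
      have "P 0 ?e * P y b * (D.Z (V - {0, y}) * D.Z (V - {?e, b})) \<le> D.visits 0 y"
        by (rule D.visits_ge[OF col e1 e2 dist]) (use False b_even in \<open>auto simp: coord_sum_def[of 0]\<close>)
      moreover have "D.Z (V - {?e, b}) = D.Z V * \<gamma> v"
      proof -
        have "\<gamma> (b - ?e) = \<gamma> y" using \<gamma>_T[of "b - ?e"] \<gamma>_T[of y] unfolding b_def by simp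
        then show ?thesis using G0_eq[OF V(3,2)] gy dist unfolding D.G0_def by simp
      qed
      ultimately have "p ?e * p ?e * ((D.Z V * \<gamma> v) * (D.Z V * \<gamma> v)) \<le> D.visits 0 y"
        unfolding G0y by (simp add: periodised_eq pb)
      then have "(p ?e)\<^sup>2 * (\<gamma> v)\<^sup>2 \<le> D.visits 0 y / (D.Z V)\<^sup>2"
        using Z2 by (simp add: field_simps power2_eq_square)
      moreover have "(u ?e)\<^sup>2 * (\<gamma> v)\<^sup>2 \<le> (p ?e)\<^sup>2 * (\<gamma> v)\<^sup>2"
        using pe by (intro mult_right_mono power_mono) auto
      ultimately show ?thesis unfolding y_def by linarith
    qed
  qed
qed

lemma prob_lower: "(u (axis i 1))\<^sup>2 * (\<gamma> v)\<^sup>2 \<le> torus_prob_visit L w v"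
  unfolding torus_prob_visit_def torus_mdd_def D.prob_visit[OF P_self] by (rule visits_lower)

text \<open>The expected length is at least the sum of the visiting probabilities, and by
  Cauchy-Schwarz the mean of the squares of \<open>\<gamma>\<close> is at least the square of its
  mean.\<close>

lemma length_lower: "(u (axis i 1))\<^sup>2 * M\<^sup>2 \<le> torus_exp_length L w / real L ^ CARD('d)"
proof -
  let ?N = "real L ^ CARD('d)"
  have N: "0 < ?N" using L_pos by simp
  have "(\<Sum>v\<in>V. \<gamma> v)\<^sup>2 \<le> (\<Sum>v\<in>V. (\<gamma> v)\<^sup>2) * ?N"
    using sum_squared_le_sum_of_squares[of \<gamma> V] by (simp add: card_torus)
  then have "M\<^sup>2 * ?N \<le> (\<Sum>v\<in>V. (\<gamma> v)\<^sup>2)"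
    unfolding M_def using N by (simp add: power_divide field_simps power2_eq_square)
  then have "(u (axis i 1))\<^sup>2 * (M\<^sup>2 * ?N) \<le> (u (axis i 1))\<^sup>2 * (\<Sum>v\<in>V. (\<gamma> v)\<^sup>2)"
    by (intro mult_left_mono) auto
  also have "\<dots> = (\<Sum>v\<in>V. (u (axis i 1))\<^sup>2 * (\<gamma> v)\<^sup>2)" by (rule sum_distrib_left)
  also have "\<dots> \<le> (\<Sum>v\<in>V. D.visits 0 v / (D.Z V)\<^sup>2)"
  proof (rule sum_mono)
    fix v assume "v \<in> V"
    then show "(u (axis i 1))\<^sup>2 * (\<gamma> v)\<^sup>2 \<le> D.visits 0 v / (D.Z V)\<^sup>2"
      using visits_lower[of i v] T_id by simp
  qed
  also have "\<dots> = (\<Sum>v\<in>V. D.visits 0 v) / (D.Z V)\<^sup>2" by (simp add: sum_divide_distrib)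
  also have "\<dots> \<le> torus_exp_length L w"
    unfolding torus_exp_length_def torus_mdd_def by (rule D.expected_length_ge[OF P_self zero_in])
  finally show ?thesis using N by (simp add: field_simps)
qed

end

theorem theorem3p1:
  fixes w :: "int ^ 'd::finite \<Rightarrow> int ^ 'd \<Rightarrow> real"
    and first :: 'd
  assumes "admissible w"
    and "bipartite w"
    and "green w < ennreal (4 / 3)"
  shows "\<exists>c::real. c > 0 \<and>
    Liminf even_to_infinity (\<lambda>L. ereal (torus_M L w)) \<ge> ereal c \<and>
    Liminf even_to_infinity (\<lambda>L. ereal (torus_exp_length L w / real L ^ CARD('d))) \<ge> ereal c \<and>
    (\<forall>\<^sub>F L in even_to_infinity. \<forall>n::int. odd n \<and> 0 < n \<and> real_of_int n < c * real L \<longrightarrow>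
       torus_G L w (axis first n) \<ge> c \<and>
       torus_prob_visit L w (axis first n) \<ge> c)"
proof -
  interpret W: admissible_weight w by unfold_locales (rule assms(1))
  have tw: "torus_weight w L" if "even L" "0 < L" for L
    using that assms(2) by unfold_locales auto
  define g where "g = enn2real (green w)"
  have fin: "green w < \<infinity>" using assms(3) by (rule less_trans) simp
  have g: "g < 4 / 3"
  proof -
    have "ennreal g = green w" unfolding g_def using fin by (intro ennreal_enn2real) simp
    moreover have "0 \<le> g" unfolding g_def by simp
    ultimately show ?thesis using assms(3) ennreal_less_iff[of g "4 / 3"] by (simp only:)
  qed
  \<comment> \<open>In the limit the mean is at least \<open>(3 - 9 / 4 * g) / 2\<close>; half of
    this is kept for large finite \<open>L\<close>.\<close>
  define c0 where "c0 = (3 - 9 / 4 * g) / 4"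
  have c0: "0 < c0" using g by (simp add: c0_def)
  define a where "a = w 0 (axis first 1)"
  have a: "0 < a" unfolding a_def by (rule W.u_axis_pos)
  define K where "K = (\<Sum>i\<in>UNIV. 1 / w 0 (axis i 1))"
  have K: "0 < K" unfolding K_def by (intro sum_pos) (auto simp: W.u_axis_pos)
  \<comment> \<open>The first entry limits \<open>n\<close> so that the boundary layers, together
    with \<open>K / L \<le> c0 / 4\<close>, cost at most \<open>c0 / 2\<close>, leaving
    \<open>\<gamma> \<ge> c0 / 2\<close>. The second serves the two-point function and its mean, the
    third the expected length, the fourth the visiting probability.\<close>
  define c where "c = Min {c0 / (8 * K), c0 / 2, a\<^sup>2 * c0\<^sup>2, a\<^sup>2 * (c0 / 2)\<^sup>2}"
  have "0 < c" unfolding c_def using c0 K a by simp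
  moreover have "c \<le> x" if "x \<in> {c0 / (8 * K), c0 / 2, a\<^sup>2 * c0\<^sup>2, a\<^sup>2 * (c0 / 2)\<^sup>2}" for x
    unfolding c_def using that by (intro Min_le) auto
  ultimately have c: "0 < c" "c \<le> c0 / (8 * K)" "c \<le> c0 / 2" "c \<le> a\<^sup>2 * c0\<^sup>2" "c \<le> a\<^sup>2 * (c0 / 2)\<^sup>2"
    by blast+
  have lim: "((\<lambda>L. (\<Sum>k \<in> dual_torus L - {0}. 1 / (1 - fourier w k)) / of_nat L ^ CARD('d))
      \<longlongrightarrow> complex_of_real g) even_to_infinity"
    using assms(1) fin unfolding admissible_def g_def by blast
  have pos_ev: "\<forall>\<^sub>F L in even_to_infinity. even L \<and> 0 < L"
    unfolding even_to_infinity_iff using eventually_gt_at_top[of 0] by eventually_elim auto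
  have inv_lim: "((\<lambda>L. 3 / real L ^ CARD('d)) \<longlongrightarrow> 0) even_to_infinity"
  proof -
    have "filterlim (\<lambda>L. real L ^ CARD('d)) at_top sequentially"
      by (intro filterlim_pow_at_top filterlim_real_sequentially) simp
    then have "((\<lambda>L. 3 / real L ^ CARD('d)) \<longlongrightarrow> 0) sequentially"
      by (intro real_tendsto_divide_at_top[OF tendsto_const])
    then show ?thesis unfolding even_to_infinity_def by (rule tendsto_mono[rotated]) simp
  qed
  let ?torus_green = "\<lambda>L. Re ((\<Sum>k \<in> dual_torus L - {0}. 1 / (1 - fourier w k)) / of_nat L ^ CARD('d))"
  have "((\<lambda>L. 3 - 9 / 4 * ?torus_green L - 3 / real L ^ CARD('d)) \<longlongrightarrow> 3 - 9 / 4 * g - 0) even_to_infinity"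
    by (intro tendsto_diff tendsto_const tendsto_mult inv_lim) (use tendsto_Re[OF lim] in simp)
  moreover have "2 * c0 < 3 - 9 / 4 * g - 0" using c0 by (simp add: c0_def)
  ultimately have "\<forall>\<^sub>F L in even_to_infinity. 2 * c0 < 3 - 9 / 4 * ?torus_green L - 3 / real L ^ CARD('d)"
    by (rule order_tendstoD(1))
  then have M_ev: "\<forall>\<^sub>F L in even_to_infinity. even L \<and> 0 < L \<and> c0 \<le> torus_M L w"
    using pos_ev
  proof eventually_elim
    case (elim L)
    then interpret torus_weight w L using tw by blast
    have "?torus_green L = torus_green / real L ^ CARD('d)"
    proof -
      have "(\<Sum>k \<in> dual_torus L - {0}. 1 / (1 - fourier w k)) / of_nat L ^ CARD('d)
          = complex_of_real (torus_green / real L ^ CARD('d))" unfolding dual_sum by simp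
      then show ?thesis by (simp only: Re_complex_of_real)
    qed
    then show ?case using elim M_ge unfolding torus_M_eq by simp
  qed
  have L_ev: "\<forall>\<^sub>F L in even_to_infinity. K / real L \<le> c0 / 4"
  proof -
    have "\<forall>\<^sub>F L in sequentially. K / real L < c0 / 4"
      using c0 by (intro order_tendstoD(2)[OF lim_const_over_n]) simp
    then show ?thesis unfolding even_to_infinity_iff by eventually_elim auto
  qed
  have 1: "ereal c \<le> Liminf even_to_infinity (\<lambda>L. ereal (torus_M L w))"
    by (rule Liminf_bounded, rule eventually_mono[OF M_ev]) (use c c0 in auto)
  have 2: "ereal c \<le> Liminf even_to_infinity (\<lambda>L. ereal (torus_exp_length L w / real L ^ CARD('d)))"
  proof (rule Liminf_bounded, rule eventually_mono[OF M_ev])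
    fix L assume L: "even L \<and> 0 < L \<and> c0 \<le> torus_M L w"
    then interpret torus_weight w L using tw by blast
    have "a\<^sup>2 * c0\<^sup>2 \<le> a\<^sup>2 * M\<^sup>2"
      using L c0 unfolding torus_M_eq by (intro mult_left_mono power_mono) auto
    also have "\<dots> \<le> torus_exp_length L w / real L ^ CARD('d)" unfolding a_def by (rule length_lower)
    finally show "ereal c \<le> ereal (torus_exp_length L w / real L ^ CARD('d))" using c by simp
  qed
  have 3: "\<forall>\<^sub>F L in even_to_infinity. \<forall>n::int. odd n \<and> 0 < n \<and> real_of_int n < c * real L \<longrightarrow>
       torus_G L w (axis first n) \<ge> c \<and> torus_prob_visit L w (axis first n) \<ge> c"
    using M_ev L_ev
  proof eventually_elim
    case (elim L)
    then interpret torus_weight w L using tw by blast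
    have L0: "0 < real L" using elim by simp
    show ?case
    proof (intro allI impI)
      fix n :: int assume n: "odd n \<and> 0 < n \<and> real_of_int n < c * real L"
      have "K * (2 * real_of_int n + 1) / real L = 2 * K * (real_of_int n / real L) + K / real L"
        by (simp add: add_divide_distrib algebra_simps)
      also have "2 * K * (real_of_int n / real L) \<le> 2 * K * (c0 / (8 * K))"
      proof (intro mult_left_mono)
        have "real_of_int n / real L \<le> c" using n L0 by (simp add: field_simps)
        then show "real_of_int n / real L \<le> c0 / (8 * K)" using c by linarith
      qed (use K in simp)
      also have "2 * K * (c0 / (8 * K)) = c0 / 4" using K by simp
      also have "K / real L \<le> c0 / 4" using elim by blast
      finally have "K * (2 * real_of_int n + 1) / real L \<le> c0 / 2" by simp
      moreover have "M \<le> \<gamma> (axis first n) + K * (2 * real_of_int n + 1) / real L"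
        unfolding K_def using n by (intro M_le) auto
      moreover have "c0 \<le> M" using elim unfolding torus_M_eq by blast
      ultimately have G: "c0 / 2 \<le> \<gamma> (axis first n)" by linarith
      have "a\<^sup>2 * (c0 / 2)\<^sup>2 \<le> a\<^sup>2 * (\<gamma> (axis first n))\<^sup>2"
        using G c0 by (intro mult_left_mono power_mono) auto
      also have "\<dots> \<le> torus_prob_visit L w (axis first n)" unfolding a_def by (rule prob_lower)
      finally show "torus_G L w (axis first n) \<ge> c \<and> torus_prob_visit L w (axis first n) \<ge> c"
        using c G unfolding torus_G_eq by simp
    qed
  qed
  show ?thesis using c(1) 1 2 3 by blast
qed

end
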